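(* Let $(R,\mathfrak m)$ be a Noetherian local ring. Suppose $f_1,\dots,f_r\in R$ is a filter-regular sequence and $J\subseteq R$ is an ideal such that $(f_1,\dots,f_r)+J$ is $\mathfrak m$-primary. Then there exists an integer $N>0$ such that for every $\varepsilon_1,\dots,\varepsilon_r\in\mathfrak m^N$ the Hilbert--Samuel functions of $R/(f_1,\dots,f_r)$ and of $R/(f_1+\varepsilon_1,\dots,f_r+\varepsilon_r)$ with respect to $J$ are equal, i.e. for all $n\ge 0$ \[ \ell\big(R/((f_1,\dots,f_r)+J^n)\big)=\ell\big(R/((f_1+\varepsilon_1,\dots,f_r+\varepsilon_r)+J^n)\big). \] In fact, there is an isomorphism of associated graded rings \[ \operatorname{gr}_J\big(R/(f_1,\dots,f_r)\big)\cong \operatorname{gr}_J\big(R/(f_1+\varepsilon_1,\dots,f_r+\varepsilon_r)\big). \]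
   Context: All rings are commutative and Noetherian with identity. Let $(R,\mathfrak m)$ be a local ring. An element $f\in R$ is called filter-regular if $f\notin P$ for every $P\in\operatorname{Ass}(R)\setminus\{\mathfrak m\}$. A sequence $f_1,\dots,f_r$ in $R$ is filter-regular if for every $0\le i<r$ the image of $f_{i+1}$ in the local ring $R/(f_1,\dots,f_i)$ is a filter-regular element. For ideals $I,J\subseteq R$, $\operatorname{gr}_J(R/I)=\bigoplus_{n\ge 0} (J^n+I)/(J^{n+1}+I)$ denotes the associated graded ring of $R/I$ with respect to the image of $J$. $\ell(\cdot)$ denotes length. *)

theory Defs
  imports "HOL-Algebra.Ring_Divisibility" "HOL-Algebra.Ideal_Product" "HOL-Algebra.Module"
    "HOL-Library.Extended_Nat"
begin

section \<open>Local rings, associated primes, filter-regular sequences\<close>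

locale local_ring = cring R for R (structure) +
  assumes ex1_maximalideal: "\<exists>!M. maximalideal M R"

definition max_ideal :: "('a, 'm) ring_scheme \<Rightarrow> 'a set"
  where "max_ideal R = (THE M. maximalideal M R)"

definition annihilator :: "('a, 'm) ring_scheme \<Rightarrow> 'a \<Rightarrow> 'a set"
  where "annihilator R x = {r \<in> carrier R. r \<otimes>\<^bsub>R\<^esub> x = \<zero>\<^bsub>R\<^esub>}"

definition Ass :: "('a, 'm) ring_scheme \<Rightarrow> 'a set set"
  where "Ass R = {P. primeideal P R \<and> (\<exists>x \<in> carrier R. P = annihilator R x)}"

definition filter_regular :: "('a, 'm) ring_scheme \<Rightarrow> 'a \<Rightarrow> bool"
  where "filter_regular R f \<longleftrightarrow>
    f \<in> carrier R \<and> (\<forall>P \<in> Ass R - {max_ideal R}. f \<notin> P)"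

text \<open>The list \<open>fs\<close> is indexed from 0, so \<open>fs ! i\<close> is the element that must be
  filter-regular modulo the \<open>i\<close> elements preceding it.\<close>

definition filter_regular_seq :: "('a, 'm) ring_scheme \<Rightarrow> 'a list \<Rightarrow> bool"
  where "filter_regular_seq R fs \<longleftrightarrow> set fs \<subseteq> carrier R \<and>
    (\<forall>i < length fs. let I = Idl\<^bsub>R\<^esub> (set (take i fs)) in
       filter_regular (R Quot I) (I +>\<^bsub>R\<^esub> fs ! i))"


section \<open>Primary ideals and powers of ideals\<close>

definition radical :: "('a, 'm) ring_scheme \<Rightarrow> 'a set \<Rightarrow> 'a set"
  where "radical R I = {x \<in> carrier R. \<exists>n::nat. x [^]\<^bsub>R\<^esub> n \<in> I}"

locale primaryideal = ideal Q R + cring R for Q and R (structure) +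
  assumes Q_notcarr: "carrier R \<noteq> Q"
    and Q_primary: "\<lbrakk>a \<in> carrier R; b \<in> carrier R; a \<otimes> b \<in> Q\<rbrakk> \<Longrightarrow> a \<in> Q \<or> b \<in> radical R Q"

definition is_primary_to :: "('a, 'm) ring_scheme \<Rightarrow> 'a set \<Rightarrow> 'a set \<Rightarrow> bool"
  where "is_primary_to R P Q \<longleftrightarrow> primaryideal Q R \<and> radical R Q = P"

abbreviation ideal_pow :: "('a, 'm) ring_scheme \<Rightarrow> 'a set \<Rightarrow> nat \<Rightarrow> 'a set"
  where "ideal_pow R J n \<equiv> J [^]\<^bsub>ideals_set R\<^esub> n"


section \<open>Length of a module\<close>

definition module_length :: "('a, 'm) ring_scheme \<Rightarrow> ('a, 'b, 'n) module_scheme \<Rightarrow> enat"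
  where "module_length R M = Sup {enat n | n. \<exists>C :: nat \<Rightarrow> 'b set.
    (\<forall>i \<le> n. submodule (C i) R M) \<and> (\<forall>i < n. C i \<subset> C (Suc i))}"

definition quot_module :: "('a, 'm) ring_scheme \<Rightarrow> 'a set \<Rightarrow> ('a, 'a set) module"
  where "quot_module R I = ring.extend (R Quot I)
    (module.fields (\<lambda>r A. (I +>\<^bsub>R\<^esub> r) \<otimes>\<^bsub>R Quot I\<^esub> A))"


section \<open>The associated graded ring\<close>

definition adic_filt :: "('a, 'm) ring_scheme \<Rightarrow> 'a set \<Rightarrow> 'a set \<Rightarrow> nat \<Rightarrow> 'a set"
  where "adic_filt R J I n = ideal_pow R J n <+>\<^bsub>R\<^esub> I"

text \<open>The ring \<open>gr\<^sub>J(R/I)\<close>. With \<open>F n = J\<^sup>n + I\<close>, an element is a finitely supported family \<open>u\<close>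
  whose component \<open>u n\<close> is a coset of \<open>F (n+1)\<close> represented by an element of \<open>F n\<close>. The product of
  \<open>x + F (p+1)\<close> and \<open>y + F (q+1)\<close> is \<open>x y + F (p+q+1)\<close>, which is the set
  \<open>rcoset_mult R (F (p+q+1)) (x + F (p+1)) (y + F (q+1))\<close>, because \<open>F p F (q+1)\<close> and
  \<open>F (p+1) F q\<close> lie in \<open>F (p+q+1)\<close>.\<close>

definition assoc_gr :: "('a, 'm) ring_scheme \<Rightarrow> 'a set \<Rightarrow> 'a set \<Rightarrow> (nat \<Rightarrow> 'a set) ring"
  where "assoc_gr R J I = (let F = adic_filt R J I in
    \<lparr>carrier = {u. (\<forall>n. \<exists>x \<in> F n. u n = F (Suc n) +>\<^bsub>R\<^esub> x) \<and> finite {n. u n \<noteq> F (Suc n)}},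
     mult = (\<lambda>u v n. finsum (R Quot F (Suc n))
               (\<lambda>p. rcoset_mult R (F (Suc n)) (u p) (v (n - p))) {..n}),
     one = (\<lambda>n. if n = 0 then F (Suc 0) +>\<^bsub>R\<^esub> \<one>\<^bsub>R\<^esub> else F (Suc n)),
     zero = (\<lambda>n. F (Suc n)),
     add = (\<lambda>u v n. u n <+>\<^bsub>R\<^esub> v n)\<rparr>)"

definition homogeneous :: "(nat \<Rightarrow> 'c) ring \<Rightarrow> nat \<Rightarrow> (nat \<Rightarrow> 'c) set"
  where "homogeneous G n = {u \<in> carrier G. \<forall>k. k \<noteq> n \<longrightarrow> u k = \<zero>\<^bsub>G\<^esub> k}"

definition graded_ring_iso :: "(nat \<Rightarrow> 'c) ring \<Rightarrow> (nat \<Rightarrow> 'd) ring \<Rightarrow> ((nat \<Rightarrow> 'c) \<Rightarrow> nat \<Rightarrow> 'd) set"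
  where "graded_ring_iso G H =
    {\<phi> \<in> ring_iso G H. \<forall>n. \<phi> ` homogeneous G n = homogeneous H n}"

end

theory Submission
  imports Defs
begin

text \<open>
  Let \<open>I = (f\<^sub>1, \<dots>, f\<^sub>r)\<close> and let \<open>I'\<close> be the ideal of the perturbed sequence. Passing from \<open>J\<close> to \<open>J + I\<close> does
  not change \<open>J\<^sup>n + I\<close>, and for a small perturbation it does not change \<open>J\<^sup>n + I'\<close> either, since then
  \<open>J + I = J + I'\<close> (\<open>adic_filt_enlarge\<close>, \<open>le_if_le_mod_square\<close>). So \<open>J\<close> may be taken \<open>\<mm>\<close>-primary, and the
  perturbations \<open>\<epsilon>\<^sub>i\<close> lie in a high power of \<open>J\<close>. The degree \<open>n\<close> part of \<open>gr\<^sub>J(R/I)\<close> is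
  \<open>J\<^sup>n / (J\<^sup>n \<inter> (J\<^bsup>n + 1\<^esup> + I))\<close>, so both claims follow once \<open>I\<close> and \<open>I'\<close> have the same initial ideal in
  \<open>gr\<^sub>J(R)\<close>: see \<open>length_eq\<close> and \<open>transfer_graded_iso\<close>.

  By the Artin-Rees lemma an element of \<open>I \<inter> J\<^sup>n\<close> is a combination of the \<open>f\<^sub>i\<close> with coefficients in
  \<open>J\<^bsup>n - c\<^esup>\<close>, so replacing \<open>f\<^sub>i\<close> by \<open>f\<^sub>i + \<epsilon>\<^sub>i\<close> does not change its initial form. The converse needs such a
  bound for \<open>I'\<close>, uniformly in \<open>\<epsilon>\<close>. What could go wrong are combinations of the \<open>f\<^sub>i + \<epsilon>\<^sub>i\<close> of high order
  with coefficients of low order, that is, syzygies of \<open>f\<close> that do not deform. Koszul syzygies deform, and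
  for a filter-regular sequence some \<open>J\<^sup>t\<close> multiplies every syzygy into the Koszul ones: the homology \<open>H\<^sub>1\<close>
  of the Koszul complex is torsion (\<open>filter_regular_koszul_torsion\<close>).

  The generators are perturbed one at a time. Let \<open>g\<close> be the one that changes, to \<open>g + \<epsilon>\<close>, and let \<open>Q\<close> be
  generated by the others. Then \<open>(Q : g) / Q\<close> is a quotient of \<open>H\<^sub>1\<close>, hence killed by \<open>\<epsilon>\<close>, and this suffices
  to raise the order of the coefficient of \<open>g + \<epsilon>\<close> step by step (\<open>coefficient_order\<close>): the initial ideal
  does not change. Two numbers have to stay under control for the next generator. The Artin-Rees constant
  \<open>c\<close> survives since the initial ideal does (\<open>artin_rees_perturbed\<close>). The torsion exponent \<open>t\<close> at most
  doubles: in the exact sequence \<open>0 \<rightarrow> H\<^sub>1(Q) / g H\<^sub>1(Q) \<rightarrow> H\<^sub>1(Q, g) \<rightarrow> (Q : g) / Q \<rightarrow> 0\<close> (written here with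
  the generators of \<open>Q\<close> understood) \<open>J\<^sup>t\<close> still kills the outer terms when \<open>g\<close> becomes \<open>g + \<epsilon>\<close>, the left
  one by Nakayama's lemma (\<open>syz_torsion_perturbed\<close>) and the right one by Krull's theorem
  (\<open>colon_perturbed_le\<close>). So a bound on the order of \<open>\<epsilon>\<close> that depends on \<open>c\<close>, \<open>t\<close> and \<open>r\<close> alone works for all
  steps (\<open>perturb_all\<close>).
\<close>

section \<open>Ideals and their powers\<close>

no_notation Sum_Type.Plus (infixr \<open><+>\<close> 65)

context cring
begin

lemma ideal_memI:
  assumes "ideal I R"
  shows "\<zero> \<in> I" "a \<in> I \<Longrightarrow> a \<in> carrier R" "a \<in> I \<Longrightarrow> b \<in> I \<Longrightarrow> a \<oplus> b \<in> I"
    "a \<in> I \<Longrightarrow> \<ominus> a \<in> I" "a \<in> I \<Longrightarrow> b \<in> I \<Longrightarrow> a \<ominus> b \<in> I"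
    "a \<in> I \<Longrightarrow> r \<in> carrier R \<Longrightarrow> r \<otimes> a \<in> I" "a \<in> I \<Longrightarrow> r \<in> carrier R \<Longrightarrow> a \<otimes> r \<in> I"
proof -
  interpret ideal I R by fact
  show "\<zero> \<in> I" "a \<in> I \<Longrightarrow> a \<in> carrier R" "a \<in> I \<Longrightarrow> b \<in> I \<Longrightarrow> a \<oplus> b \<in> I"
    "a \<in> I \<Longrightarrow> \<ominus> a \<in> I" "a \<in> I \<Longrightarrow> r \<in> carrier R \<Longrightarrow> r \<otimes> a \<in> I" "a \<in> I \<Longrightarrow> r \<in> carrier R \<Longrightarrow> a \<otimes> r \<in> I"
    by (auto intro: I_l_closed I_r_closed)
  then show "a \<in> I \<Longrightarrow> b \<in> I \<Longrightarrow> a \<ominus> b \<in> I"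
    by (simp add: minus_eq)
qed

lemma cring_idealI:
  assumes "I \<subseteq> carrier R" "\<zero> \<in> I" "\<And>a b. a \<in> I \<Longrightarrow> b \<in> I \<Longrightarrow> a \<oplus> b \<in> I"
    and mult: "\<And>a r. a \<in> I \<Longrightarrow> r \<in> carrier R \<Longrightarrow> r \<otimes> a \<in> I"
  shows "ideal I R"
proof (rule idealI)
  have neg: "\<ominus> a \<in> I" if "a \<in> I" for a
    using mult[of a "\<ominus> \<one>"] that assms(1) by (auto simp: l_minus)
  show "subgroup I (add_monoid R)"
    by (rule subgroup.intro) (use assms neg in \<open>auto simp: a_inv_def\<close>)
  show "x \<otimes> a \<in> I" "a \<otimes> x \<in> I" if "a \<in> I" "x \<in> carrier R" for a x
    using mult[OF that] m_comm[of a x] that assms(1) by auto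
qed (rule ring_axioms)

lemma mem_add_iff: "x \<in> A <+> B \<longleftrightarrow> (\<exists>a\<in>A. \<exists>b\<in>B. x = a \<oplus> b)"
  by (auto simp: set_add_def')

lemma add_le:
  assumes "ideal K R" "A \<subseteq> K" "B \<subseteq> K"
  shows "A <+> B \<subseteq> K"
  using assms(2,3) ideal_memI(3)[OF assms(1)] unfolding mem_add_iff subset_iff by metis

lemma le_addL:
  assumes "ideal A R" "ideal B R"
  shows "A \<subseteq> A <+> B"
proof
  fix x assume "x \<in> A"
  then show "x \<in> A <+> B"
    unfolding mem_add_iff using ideal_memI(1)[OF assms(2)] ideal_memI(2)[OF assms(1)]
    by (intro bexI[of _ x] bexI[of _ \<zero>]) simp_all
qed

lemma le_addR:
  assumes "ideal A R" "ideal B R"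
  shows "B \<subseteq> A <+> B"
proof
  fix x assume "x \<in> B"
  then show "x \<in> A <+> B"
    unfolding mem_add_iff using ideal_memI(1)[OF assms(1)] ideal_memI(2)[OF assms(2)]
    by (intro bexI[of _ \<zero>] bexI[of _ x]) simp_all
qed

lemma set_add_mono: "\<lbrakk>A \<subseteq> A'; B \<subseteq> B'\<rbrakk> \<Longrightarrow> A <+> B \<subseteq> A' <+> B'"
  unfolding mem_add_iff subset_iff by metis

lemma prod_le:
  assumes "ideal K R" "\<And>i j. i \<in> A \<Longrightarrow> j \<in> B \<Longrightarrow> i \<otimes> j \<in> K"
  shows "A \<cdot> B \<subseteq> K"
proof
  fix x assume "x \<in> A \<cdot> B"
  then show "x \<in> K"
    by (induct rule: ideal_prod.induct) (use assms ideal_memI(3) in auto)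
qed

lemma prod_mono:
  assumes "A \<subseteq> A'" "B \<subseteq> B'"
  shows "A \<cdot> B \<subseteq> A' \<cdot> B'"
proof
  fix x assume "x \<in> A \<cdot> B"
  then show "x \<in> A' \<cdot> B'"
    by (induct rule: ideal_prod.induct) (use assms in \<open>auto intro: ideal_prod.intros\<close>)
qed

lemma ideals_set_simps [simp]:
  "\<one>\<^bsub>ideals_set R\<^esub> = carrier R" "A \<otimes>\<^bsub>ideals_set R\<^esub> B = A \<cdot> B"
  by (simp_all add: ideals_set_def)

lemma pow_Suc: "ideal_pow R J (Suc n) = ideal_pow R J n \<cdot> J"
  by simp

lemma pow_ideal: "ideal J R \<Longrightarrow> ideal (ideal_pow R J n) R"
proof -
  assume "ideal J R"
  interpret S: comm_monoid "ideals_set R" by (rule ideals_set_is_comm_monoid)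
  from \<open>ideal J R\<close> show ?thesis using S.nat_pow_closed[of J n] by (simp add: ideals_set_def)
qed

lemma pow_1: "ideal J R \<Longrightarrow> ideal_pow R J (Suc 0) = J"
  using ideal_prod_one[of J] ideal_prod_commute[of J "carrier R"] oneideal by (simp add: pow_Suc)

lemma pow_add: "ideal J R \<Longrightarrow> ideal_pow R J (m + n) = ideal_pow R J m \<cdot> ideal_pow R J n"
proof -
  assume "ideal J R"
  interpret S: comm_monoid "ideals_set R" by (rule ideals_set_is_comm_monoid)
  from \<open>ideal J R\<close> show ?thesis using S.nat_pow_mult[of J m n] by (simp add: ideals_set_def)
qed

lemma pow_pow: "ideal J R \<Longrightarrow> ideal_pow R (ideal_pow R J m) n = ideal_pow R J (m * n)"
proof -
  assume "ideal J R"
  interpret S: comm_monoid "ideals_set R" by (rule ideals_set_is_comm_monoid)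
  from \<open>ideal J R\<close> show ?thesis using S.nat_pow_pow[of J m n] by (simp add: ideals_set_def)
qed

lemma pow_mult_mem:
  "\<lbrakk>ideal J R; x \<in> ideal_pow R J m; y \<in> ideal_pow R J n\<rbrakk> \<Longrightarrow> x \<otimes> y \<in> ideal_pow R J (m + n)"
  by (simp add: pow_add ideal_prod.prod)

lemma pow_antimono:
  assumes "ideal J R" "m \<le> n"
  shows "ideal_pow R J n \<subseteq> ideal_pow R J m"
proof -
  have "ideal_pow R J n = ideal_pow R J m \<cdot> ideal_pow R J (n - m)"
    using assms pow_add[of J m "n - m"] by simp
  then show ?thesis
    using ideal_prod_inter[of "ideal_pow R J m" "ideal_pow R J (n - m)"] pow_ideal assms by auto
qed

lemma pow_mono:
  assumes "J \<subseteq> K"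
  shows "ideal_pow R J n \<subseteq> ideal_pow R K n"
  by (induct n) (simp_all add: pow_Suc prod_mono assms)

lemma colon_ideal:
  assumes "ideal I R" "x \<in> carrier R"
  shows "ideal {a \<in> carrier R. a \<otimes> x \<in> I} R"
  by (rule cring_idealI)
    (use assms in \<open>auto simp: l_distr m_assoc intro: ideal_memI[OF assms(1)]\<close>)

section \<open>Linear combinations of a finite family\<close>

definition lin :: "'i set \<Rightarrow> ('i \<Rightarrow> 'a) \<Rightarrow> ('i \<Rightarrow> 'a) \<Rightarrow> 'a"
  where "lin S a f = (\<Oplus>j\<in>S. a j \<otimes> f j)"

definition lspan :: "'i set \<Rightarrow> ('i \<Rightarrow> 'a) \<Rightarrow> 'a set"
  where "lspan S f = {lin S a f | a. a \<in> S \<rightarrow> carrier R}"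

lemma lin_closed [simp]: "\<lbrakk>a \<in> S \<rightarrow> carrier R; f \<in> S \<rightarrow> carrier R\<rbrakk> \<Longrightarrow> lin S a f \<in> carrier R"
  unfolding lin_def by (rule finsum_closed) auto

lemma lin_cong:
  "\<lbrakk>\<And>j. j \<in> S \<Longrightarrow> a j = b j; \<And>j. j \<in> S \<Longrightarrow> f j = g j; b \<in> S \<rightarrow> carrier R; g \<in> S \<rightarrow> carrier R\<rbrakk>
    \<Longrightarrow> lin S a f = lin S b g"
  unfolding lin_def by (rule finsum_cong') auto

lemma lin_add:
  assumes "a \<in> S \<rightarrow> carrier R" "b \<in> S \<rightarrow> carrier R" "f \<in> S \<rightarrow> carrier R"
  shows "lin S (\<lambda>j. a j \<oplus> b j) f = lin S a f \<oplus> lin S b f"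
proof -
  have "lin S (\<lambda>j. a j \<oplus> b j) f = (\<Oplus>j\<in>S. a j \<otimes> f j \<oplus> b j \<otimes> f j)"
    unfolding lin_def using assms by (intro finsum_cong') (auto simp: l_distr Pi_iff)
  also have "\<dots> = lin S a f \<oplus> lin S b f"
    unfolding lin_def using assms by (intro finsum_addf) auto
  finally show ?thesis .
qed

lemma lin_smult:
  "\<lbrakk>finite S; r \<in> carrier R; a \<in> S \<rightarrow> carrier R; f \<in> S \<rightarrow> carrier R\<rbrakk>
    \<Longrightarrow> lin S (\<lambda>j. r \<otimes> a j) f = r \<otimes> lin S a f"
  unfolding lin_def
  by (subst finsum_rdistr) (auto intro!: finsum_cong' m_assoc)

lemma lin_minus:
  assumes "finite S" "a \<in> S \<rightarrow> carrier R" "b \<in> S \<rightarrow> carrier R" "f \<in> S \<rightarrow> carrier R"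
  shows "lin S (\<lambda>j. a j \<ominus> b j) f = lin S a f \<ominus> lin S b f"
proof -
  have "lin S (\<lambda>j. a j \<ominus> b j) f = lin S (\<lambda>j. a j \<oplus> (\<ominus> \<one>) \<otimes> b j) f"
    using assms by (intro lin_cong) (auto simp: minus_eq l_minus Pi_iff)
  also have "\<dots> = lin S a f \<oplus> (\<ominus> \<one>) \<otimes> lin S b f"
    using assms by (subst lin_add) (auto simp: lin_smult Pi_iff)
  also have "\<dots> = lin S a f \<ominus> lin S b f"
    using assms by (simp add: minus_eq l_minus)
  finally show ?thesis .
qed

lemma lin_insert:
  "\<lbrakk>finite S; i \<notin> S; a \<in> insert i S \<rightarrow> carrier R; f \<in> insert i S \<rightarrow> carrier R\<rbrakk>
    \<Longrightarrow> lin (insert i S) a f = a i \<otimes> f i \<oplus> lin S a f"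
  unfolding lin_def by (subst finsum_insert) auto

lemma lin_mem:
  assumes "finite S" "ideal I R" "a \<in> S \<rightarrow> carrier R" "f \<in> S \<rightarrow> carrier R"
    and "\<And>j. j \<in> S \<Longrightarrow> a j \<in> I \<or> f j \<in> I"
  shows "lin S a f \<in> I"
  using assms(1,3,4,5)
proof (induct S)
  case empty
  then show ?case using ideal_memI(1)[OF assms(2)] by (simp add: lin_def)
next
  case (insert i S)
  have "a i \<otimes> f i \<in> I"
    using insert(4,5) insert(6)[of i] ideal_memI(6,7)[OF assms(2)] by auto
  then show ?case
    using insert ideal_memI(3)[OF assms(2)] by (simp add: lin_insert Pi_iff)
qed

lemma lspanI: "a \<in> S \<rightarrow> carrier R \<Longrightarrow> lin S a f \<in> lspan S f"
  by (auto simp: lspan_def)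

lemma lin_zero: "f \<in> S \<rightarrow> carrier R \<Longrightarrow> lin S (\<lambda>_. \<zero>) f = \<zero>"
  unfolding lin_def by (rule add.finprod_one_eqI) (auto simp: Pi_iff)

lemma lspan_ideal:
  assumes "finite S" "f \<in> S \<rightarrow> carrier R"
  shows "ideal (lspan S f) R"
proof (rule cring_idealI)
  show "lspan S f \<subseteq> carrier R" using assms by (auto simp: lspan_def)
  show "\<zero> \<in> lspan S f" using lspanI[of "\<lambda>_. \<zero>" S f] lin_zero[OF assms(2)] by simp
next
  fix a b assume "a \<in> lspan S f" "b \<in> lspan S f"
  then obtain u v where "u \<in> S \<rightarrow> carrier R" "v \<in> S \<rightarrow> carrier R" "a = lin S u f" "b = lin S v f"
    by (auto simp: lspan_def)
  then show "a \<oplus> b \<in> lspan S f"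
    using lspanI[of "\<lambda>j. u j \<oplus> v j" S f] assms by (auto simp: lin_add Pi_iff)
next
  fix a r assume "a \<in> lspan S f" "r \<in> carrier R"
  then obtain u where "u \<in> S \<rightarrow> carrier R" "a = lin S u f"
    by (auto simp: lspan_def)
  then show "r \<otimes> a \<in> lspan S f"
    using lspanI[of "\<lambda>j. r \<otimes> u j" S f] assms \<open>r \<in> carrier R\<close> by (auto simp: lin_smult Pi_iff)
qed

lemma lin_unit:
  assumes "finite S" "f \<in> S \<rightarrow> carrier R" "i \<in> S" "r \<in> carrier R"
  shows "lin S (\<lambda>j. if j = i then r else \<zero>) f = r \<otimes> f i"
proof -
  have "lin S (\<lambda>j. if j = i then r else \<zero>) f = (\<Oplus>j\<in>S. if i = j then r \<otimes> f j else \<zero>)"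
    unfolding lin_def using assms by (intro finsum_cong') (auto simp: Pi_iff)
  also have "\<dots> = r \<otimes> f i"
    using assms by (subst finsum_singleton) (auto simp: Pi_iff)
  finally show ?thesis .
qed

lemma lspan_base: "\<lbrakk>finite S; f \<in> S \<rightarrow> carrier R; i \<in> S\<rbrakk> \<Longrightarrow> f i \<in> lspan S f"
  using lin_unit[of S f i \<one>] lspanI[of "\<lambda>j. if j = i then \<one> else \<zero>" S f] by (auto simp: Pi_iff)

lemma lspan_eq_Idl:
  assumes "finite S" "f \<in> S \<rightarrow> carrier R"
  shows "lspan S f = Idl (f ` S)"
proof
  have I: "ideal (Idl (f ` S)) R" using assms by (intro genideal_ideal) auto
  have "f ` S \<subseteq> Idl (f ` S)" using assms by (intro genideal_self) auto
  then show "lspan S f \<subseteq> Idl (f ` S)"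
    using assms by (auto simp: lspan_def intro!: lin_mem[OF _ I])
  show "Idl (f ` S) \<subseteq> lspan S f"
    using assms lspan_base by (intro genideal_minimal lspan_ideal) auto
qed

lemma prod_lspan:
  assumes "finite S" "f \<in> S \<rightarrow> carrier R" "ideal K R"
  shows "K \<cdot> lspan S f = {lin S a f | a. a \<in> S \<rightarrow> K}"
proof
  have K: "a \<in> S \<rightarrow> K \<Longrightarrow> a \<in> S \<rightarrow> carrier R" for a
    using ideal_memI(2)[OF assms(3)] by auto
  show "K \<cdot> lspan S f \<subseteq> {lin S a f | a. a \<in> S \<rightarrow> K}"
  proof
    fix x assume "x \<in> K \<cdot> lspan S f"
    then show "x \<in> {lin S a f | a. a \<in> S \<rightarrow> K}"
    proof (induct rule: ideal_prod.induct)
      case (prod k j)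
      then obtain u where u: "u \<in> S \<rightarrow> carrier R" "j = lin S u f" by (auto simp: lspan_def)
      have "k \<otimes> j = lin S (\<lambda>j. k \<otimes> u j) f"
        using u prod assms ideal_memI(2)[OF assms(3)] by (simp add: lin_smult)
      moreover have "(\<lambda>j. k \<otimes> u j) \<in> S \<rightarrow> K"
        using u prod ideal_memI(7)[OF assms(3)] by auto
      ultimately show ?case by auto
    next
      case (sum s1 s2)
      then obtain u v where uv: "u \<in> S \<rightarrow> K" "v \<in> S \<rightarrow> K" "s1 = lin S u f" "s2 = lin S v f"
        by auto
      have "s1 \<oplus> s2 = lin S (\<lambda>j. u j \<oplus> v j) f"
        using uv K assms by (simp add: lin_add)
      moreover have "(\<lambda>j. u j \<oplus> v j) \<in> S \<rightarrow> K"
        using uv ideal_memI(3)[OF assms(3)] by auto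
      ultimately show ?case by auto
    qed
  qed
  have I: "ideal (K \<cdot> lspan S f) R" using assms by (intro ideal_prod_is_ideal lspan_ideal)
  show "{lin S a f | a. a \<in> S \<rightarrow> K} \<subseteq> K \<cdot> lspan S f"
  proof clarify
    fix a assume a: "a \<in> S \<rightarrow> K"
    have "lin S a f = lin S (\<lambda>_. \<one>) (\<lambda>j. a j \<otimes> f j)"
      unfolding lin_def using a K[OF a] assms(2) by (intro finsum_cong') (auto simp: Pi_iff)
    also have "\<dots> \<in> K \<cdot> lspan S f"
    proof (rule lin_mem[OF assms(1) I])
      show "(\<lambda>j. a j \<otimes> f j) \<in> S \<rightarrow> carrier R" using K[OF a] assms(2) by auto
      show "\<one> \<in> K \<cdot> lspan S f \<or> a j \<otimes> f j \<in> K \<cdot> lspan S f" if "j \<in> S" for j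
        using that a lspan_base[OF assms(1,2)] by (auto intro: ideal_prod.prod)
    qed auto
    finally show "lin S a f \<in> K \<cdot> lspan S f" .
  qed
qed

definition adjoin :: "'a set \<Rightarrow> 'a \<Rightarrow> 'a set"
  where "adjoin Q g = Q <+> PIdl g"

lemma adjoin_ideal: "\<lbrakk>ideal Q R; g \<in> carrier R\<rbrakk> \<Longrightarrow> ideal (adjoin Q g) R"
  unfolding adjoin_def by (intro add_ideals cgenideal_ideal)

lemma prod_adjoin_iff:
  assumes K: "ideal K R" and Q: "ideal Q R" and g: "g \<in> carrier R"
  shows "x \<in> K \<cdot> adjoin Q g \<longleftrightarrow> (\<exists>q \<in> K \<cdot> Q. \<exists>\<alpha>\<in>K. x = q \<oplus> \<alpha> \<otimes> g)"
proof -
  have P: "z \<in> K \<cdot> (PIdl g) \<longleftrightarrow> (\<exists>\<alpha>\<in>K. z = \<alpha> \<otimes> g)" for z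
  proof
    assume "z \<in> K \<cdot> (PIdl g)"
    then show "\<exists>\<alpha>\<in>K. z = \<alpha> \<otimes> g"
    proof (induct rule: ideal_prod.induct)
      case (prod i y)
      then obtain r where "r \<in> carrier R" "y = r \<otimes> g" by (auto simp: cgenideal_def)
      then show ?case using prod(1) ideal_memI(2,7)[OF K] g
        by (intro bexI[of _ "i \<otimes> r"]) (auto simp: m_assoc)
    next
      case (sum s1 s2)
      then obtain u v where "u \<in> K" "s1 = u \<otimes> g" "v \<in> K" "s2 = v \<otimes> g" by auto
      then show ?case using ideal_memI(2,3)[OF K] g
        by (intro bexI[of _ "u \<oplus> v"]) (auto simp: l_distr)
    qed
  next
    assume "\<exists>\<alpha>\<in>K. z = \<alpha> \<otimes> g"
    then show "z \<in> K \<cdot> (PIdl g)" using cgenideal_self[OF g] by (auto intro: ideal_prod.prod)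
  qed
  show ?thesis
    unfolding adjoin_def ideal_prod_r_distr[OF K Q cgenideal_ideal[OF g]] mem_add_iff
    unfolding Bex_def P by blast
qed

lemma prod_carrier_left: "ideal I R \<Longrightarrow> carrier R \<cdot> I = I"
  using ideal_prod_one ideal_prod_commute oneideal by metis

lemma adjoin_iff:
  assumes "ideal Q R" "g \<in> carrier R"
  shows "x \<in> adjoin Q g \<longleftrightarrow> (\<exists>q\<in>Q. \<exists>\<alpha>\<in>carrier R. x = q \<oplus> \<alpha> \<otimes> g)"
  using prod_adjoin_iff[OF oneideal assms, of x] prod_carrier_left adjoin_ideal assms by simp

end

section \<open>The Artin-Rees lemma and Krull's intersection theorem\<close>

lemma (in noetherian_ring) maximal_ideal_in:
  assumes "X \<noteq> {}" "\<And>I. I \<in> X \<Longrightarrow> ideal I R"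
  obtains M where "M \<in> X" "\<And>I. \<lbrakk>I \<in> X; M \<subseteq> I\<rbrakk> \<Longrightarrow> I = M"
proof -
  have "\<exists>M\<in>X. \<forall>I\<in>X. M \<subseteq> I \<longrightarrow> I = M"
  proof (rule subset_Zorn_nonempty[OF assms(1)])
    fix C assume C: "C \<noteq> {}" "subset.chain X C"
    then have "subset.chain {I. ideal I R} C"
      using assms(2) by (auto simp: subset.chain_def)
    then have "\<Union>C \<in> C" by (rule ideal_chain_is_trivial[OF C(1)])
    then show "\<Union>C \<in> X" using C(2) by (auto simp: subset.chain_def)
  qed
  then show ?thesis using that by blast
qed

text \<open>The combinatorial core of the Artin-Rees lemma, in the role of Dickson's lemma. Some \<open>L \<alpha>0\<close> is
  maximal, so \<open>L\<close> is constant above \<open>\<alpha>0\<close>. Any other exponent has a coordinate below a fixed bound;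
  freezing that coordinate leaves finitely many families with one coordinate fewer. The coordinates
  outside \<open>S\<close> are the frozen ones, with values given by \<open>\<beta>\<close>.\<close>

lemma (in noetherian_ring) monotone_family_stabilizes:
  fixes L :: "(nat \<Rightarrow> nat) \<Rightarrow> 'a set"
  assumes ideals: "\<And>\<alpha>. ideal (L \<alpha>) R" and mono: "\<And>\<alpha> \<beta>. \<alpha> \<le> \<beta> \<Longrightarrow> L \<alpha> \<subseteq> L \<beta>"
    and "finite S"
  shows "\<exists>c. \<forall>\<alpha>. (\<forall>i. i \<notin> S \<longrightarrow> \<alpha> i = \<beta> i) \<longrightarrow> L \<alpha> = L (\<lambda>i. if i \<in> S then min (\<alpha> i) c else \<beta> i)"
  using \<open>finite S\<close>
proof (induct S arbitrary: \<beta> rule: finite_psubset_induct)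
  case (psubset S)
  let ?A = "{\<alpha>. \<forall>i. i \<notin> S \<longrightarrow> \<alpha> i = \<beta> i}"
  have "L ` ?A \<noteq> {}" by auto
  then obtain M where M: "M \<in> L ` ?A" "\<And>I. \<lbrakk>I \<in> L ` ?A; M \<subseteq> I\<rbrakk> \<Longrightarrow> I = M"
    by (rule maximal_ideal_in) (use ideals in auto)
  then obtain \<alpha>0 where \<alpha>0: "\<alpha>0 \<in> ?A" "M = L \<alpha>0" by auto
  have top: "L \<alpha> = M" if "\<alpha> \<in> ?A" "\<And>i. i \<in> S \<Longrightarrow> \<alpha>0 i \<le> \<alpha> i" for \<alpha>
  proof (rule M(2))
    have "\<alpha>0 \<le> \<alpha>"
      unfolding le_fun_def
    proof
      fix i show "\<alpha>0 i \<le> \<alpha> i"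
        using that \<alpha>0(1) by (cases "i \<in> S") auto
    qed
    then show "M \<subseteq> L \<alpha>" using mono \<alpha>0(2) by simp
  qed (use that in auto)
  define c0 where "c0 = (\<Sum>i\<in>S. \<alpha>0 i)"
  have c0: "\<alpha>0 i \<le> c0" if "i \<in> S" for i
    unfolding c0_def using that psubset(1) by (intro member_le_sum) auto
  define stab where "stab i v c \<longleftrightarrow> (\<forall>\<alpha>. (\<forall>j. j \<notin> S - {i} \<longrightarrow> \<alpha> j = (\<beta>(i := v)) j) \<longrightarrow>
      L \<alpha> = L (\<lambda>j. if j \<in> S - {i} then min (\<alpha> j) c else (\<beta>(i := v)) j))" for i v c
  have "\<exists>c. stab i v c" if "i \<in> S" for i v
    unfolding stab_def using that by (intro psubset(2)) blast
  then obtain c where stab: "\<And>i v. i \<in> S \<Longrightarrow> stab i v (c i v)"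
    by metis
  have c: "L \<alpha> = L (\<lambda>j. if j \<in> S - {i} then min (\<alpha> j) (c i v) else (\<beta>(i := v)) j)"
    if "i \<in> S" "\<forall>j. j \<notin> S - {i} \<longrightarrow> \<alpha> j = (\<beta>(i := v)) j" for i v \<alpha>
    using stab[OF that(1), of v] that(2) unfolding stab_def by (elim allE[of _ \<alpha>] impE)
  define c' where "c' = c0 + (\<Sum>i\<in>S. \<Sum>v<c0. c i v)"
  have c': "c i v \<le> c'" if "i \<in> S" "v < c0" for i v
  proof -
    have "c i v \<le> (\<Sum>v<c0. c i v)" using that by (intro member_le_sum) auto
    also have "\<dots> \<le> (\<Sum>i\<in>S. \<Sum>v<c0. c i v)"
      using that psubset(1) by (intro member_le_sum[of i S "\<lambda>i. \<Sum>v<c0. c i v"]) auto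
    finally show ?thesis by (simp add: c'_def)
  qed
  show ?case
  proof (intro exI[of _ c'] allI impI)
    fix \<alpha> assume \<alpha>: "\<forall>i. i \<notin> S \<longrightarrow> \<alpha> i = \<beta> i"
    let ?\<delta> = "\<lambda>i. if i \<in> S then min (\<alpha> i) c' else \<beta> i"
    show "L \<alpha> = L ?\<delta>"
    proof (cases "\<forall>i\<in>S. c0 \<le> \<alpha> i")
      case True
      have "L \<alpha> = M"
        using \<alpha> True order_trans[OF c0] by (intro top) auto
      moreover have "L ?\<delta> = M"
        using True order_trans[OF c0] trans_le_add1[OF c0] by (intro top) (auto simp: c'_def)
      ultimately show ?thesis by simp
    next
      case False
      then obtain i where i: "i \<in> S" "\<alpha> i < c0" by (auto simp: not_le)
      have "L \<alpha> = L (\<lambda>j. if j \<in> S - {i} then min (\<alpha> j) (c i (\<alpha> i)) else (\<beta>(i := \<alpha> i)) j)"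
        using i \<alpha> by (intro c) auto
      also have "\<dots> \<subseteq> L ?\<delta>"
        using i c'[OF i] by (intro mono) (auto simp: le_fun_def c'_def min_le_iff_disj)
      finally have "L \<alpha> \<subseteq> L ?\<delta>" .
      moreover have "L ?\<delta> \<subseteq> L \<alpha>"
        using \<alpha> by (intro mono) (auto simp: le_fun_def)
      ultimately show ?thesis by simp
    qed
  qed
qed

text \<open>Requiring zeros from \<open>d\<close> on makes an exponent the only function with its values below \<open>d\<close>, which
  the totality of the lexicographic order needs.\<close>

definition expo :: "nat \<Rightarrow> nat \<Rightarrow> (nat \<Rightarrow> nat) set"
  where "expo d n = {\<alpha>. (\<forall>i\<ge>d. \<alpha> i = 0) \<and> (\<Sum>i<d. \<alpha> i) = n}"

definition lexless :: "nat \<Rightarrow> (nat \<Rightarrow> nat) \<Rightarrow> (nat \<Rightarrow> nat) \<Rightarrow> bool"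
  where "lexless d \<alpha> \<beta> \<longleftrightarrow> (\<exists>i<d. \<alpha> i < \<beta> i \<and> (\<forall>j<i. \<alpha> j = \<beta> j))"

lemma lexless_trans: "lexless d \<alpha> \<beta> \<Longrightarrow> lexless d \<beta> \<gamma> \<Longrightarrow> lexless d \<alpha> \<gamma>"
  unfolding lexless_def
proof (elim exE conjE)
  fix i j assume "i < d" "\<alpha> i < \<beta> i" "\<forall>j<i. \<alpha> j = \<beta> j" "j < d" "\<beta> j < \<gamma> j" "\<forall>i<j. \<beta> i = \<gamma> i"
  then show "\<exists>i<d. \<alpha> i < \<gamma> i \<and> (\<forall>j<i. \<alpha> j = \<gamma> j)"
    by (intro exI[of _ "min i j"]) (cases i j rule: linorder_cases; auto simp: min_def)
qed

lemma lexless_total: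
  assumes "\<alpha> \<in> expo d n" "\<beta> \<in> expo d m"
  shows "lexless d \<alpha> \<beta> \<or> \<alpha> = \<beta> \<or> lexless d \<beta> \<alpha>"
proof (rule ccontr)
  assume not: "\<not> ?thesis"
  then obtain k where "\<alpha> k \<noteq> \<beta> k" by auto
  define i where "i = (LEAST i. \<alpha> i \<noteq> \<beta> i)"
  have i: "\<alpha> i \<noteq> \<beta> i" unfolding i_def by (rule LeastI) fact
  have "\<forall>j<i. \<alpha> j = \<beta> j" unfolding i_def using not_less_Least by auto
  moreover have "i < d" using i assms by (auto simp: expo_def not_le[symmetric])
  ultimately have "lexless d \<alpha> \<beta> \<or> lexless d \<beta> \<alpha>"
    using i by (auto simp: lexless_def neq_iff)
  then show False using not by blast
qed

lemma lexless_wf: "wf {(\<alpha>, \<beta>). lexless d \<alpha> \<beta>}"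
proof (rule wf_subset)
  show "wf (inv_image (lexn less_than d) (\<lambda>\<alpha>. map \<alpha> [0..<d]))"
    by (intro wf_inv_image wf_lexn) simp
  show "{(\<alpha>, \<beta>). lexless d \<alpha> \<beta>} \<subseteq> inv_image (lexn less_than d) (\<lambda>\<alpha>. map \<alpha> [0..<d])"
  proof clarify
    fix \<alpha> \<beta> :: "nat \<Rightarrow> nat" assume "lexless d \<alpha> \<beta>"
    then obtain i where i: "i < d" "\<alpha> i < \<beta> i" "\<forall>j<i. \<alpha> j = \<beta> j" by (auto simp: lexless_def)
    have "[0..<d] = [0..<i] @ i # [Suc i..<d]"
      using i(1) by (metis le_add_diff_inverse less_imp_le upt_add_eq_append upt_conv_Cons zero_le)
    then have "map \<alpha> [0..<d] = map \<alpha> [0..<i] @ \<alpha> i # map \<alpha> [Suc i..<d]"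
      "map \<beta> [0..<d] = map \<alpha> [0..<i] @ \<beta> i # map \<beta> [Suc i..<d]"
      using i(3) by auto
    then show "(\<alpha>, \<beta>) \<in> inv_image (lexn less_than d) (\<lambda>\<alpha>. map \<alpha> [0..<d])"
      unfolding in_inv_image lexn_conv using i(1,2)
      by (intro CollectI case_prodI conjI exI[of _ "map \<alpha> [0..<i]"] exI[of _ "\<alpha> i"] exI[of _ "\<beta> i"]
        exI[of _ "map \<alpha> [Suc i..<d]"] exI[of _ "map \<beta> [Suc i..<d]"]) simp_all
  qed
qed

context cring
begin

text \<open>The subtraction truncates, so the condition is empty for \<open>p \<le> c\<close>.\<close>

definition artin_rees :: "'a set \<Rightarrow> 'a set \<Rightarrow> nat \<Rightarrow> bool"
  where "artin_rees J I c \<longleftrightarrow> (\<forall>p. I \<inter> ideal_pow R J p \<subseteq> ideal_pow R J (p - c) \<cdot> I)"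

definition monom :: "nat \<Rightarrow> (nat \<Rightarrow> 'a) \<Rightarrow> (nat \<Rightarrow> nat) \<Rightarrow> 'a"
  where "monom d x \<alpha> = (\<Otimes>i\<in>{..<d}. x i [^] \<alpha> i)"

definition lower_monoms :: "nat \<Rightarrow> (nat \<Rightarrow> 'a) \<Rightarrow> (nat \<Rightarrow> nat) \<Rightarrow> 'a set"
  where "lower_monoms d x \<alpha> = Idl (monom d x ` {\<beta> \<in> expo d (\<Sum>i<d. \<alpha> i). lexless d \<beta> \<alpha>})"

lemma monom_closed [simp]: "x \<in> {..<d} \<rightarrow> carrier R \<Longrightarrow> monom d x \<alpha> \<in> carrier R"
  unfolding monom_def by (rule finprod_closed) auto

lemma monom_add:
  assumes "x \<in> {..<d} \<rightarrow> carrier R"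
  shows "monom d x (\<lambda>i. \<alpha> i + \<beta> i) = monom d x \<alpha> \<otimes> monom d x \<beta>"
proof -
  have "monom d x (\<lambda>i. \<alpha> i + \<beta> i) = (\<Otimes>i\<in>{..<d}. x i [^] \<alpha> i \<otimes> x i [^] \<beta> i)"
    unfolding monom_def using assms by (intro finprod_cong') (auto simp: nat_pow_mult Pi_iff)
  also have "\<dots> = monom d x \<alpha> \<otimes> monom d x \<beta>"
    unfolding monom_def using assms by (intro finprod_multf) auto
  finally show ?thesis .
qed

lemma monom_unit:
  assumes "x \<in> {..<d} \<rightarrow> carrier R" "i < d"
  shows "monom d x (\<lambda>j. if j = i then 1 else 0) = x i"
proof -
  have "monom d x (\<lambda>j. if j = i then 1 else 0) = (\<Otimes>j\<in>{..<d}. if i = j then x j else \<one>)"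
    unfolding monom_def using assms by (intro finprod_cong') (auto simp: Pi_iff)
  also have "\<dots> = x i" using assms by (subst finprod_singleton) (auto simp: Pi_iff)
  finally show ?thesis .
qed

lemma monom_mem_pow:
  assumes J: "ideal J R" and x: "x \<in> {..<d} \<rightarrow> J"
  shows "monom d x \<alpha> \<in> ideal_pow R J (\<Sum>i<d. \<alpha> i)"
  using x
proof (induct d)
  case 0
  then show ?case by (simp add: monom_def)
next
  case (Suc d)
  have xc: "x i \<in> carrier R" if "i < Suc d" for i
    using Suc(2) that ideal_memI(2)[OF J] by auto
  have "x d [^] k \<in> ideal_pow R J k" for k :: nat
  proof (induct k)
    case (Suc k)
    then show ?case using \<open>x \<in> {..<Suc d} \<rightarrow> J\<close> by (auto simp: intro: ideal_prod.prod)
  qed simp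
  moreover have "monom (Suc d) x \<alpha> = monom d x \<alpha> \<otimes> x d [^] \<alpha> d"
    unfolding monom_def lessThan_Suc using xc by (subst finprod_insert) (auto simp: Pi_iff m_comm)
  ultimately show ?case
    using Suc pow_mult_mem[OF J, of "monom d x \<alpha>" _ "x d [^] \<alpha> d"] by (simp add: Pi_iff)
qed

lemma prod_Idl_le:
  assumes "A \<subseteq> carrier R" "B \<subseteq> carrier R" "ideal K R"
    and AB: "\<And>a b. a \<in> A \<Longrightarrow> b \<in> B \<Longrightarrow> a \<otimes> b \<in> K"
  shows "(Idl A) \<cdot> (Idl B) \<subseteq> K"
proof (rule prod_le[OF assms(3)])
  fix i j assume i: "i \<in> Idl A" and j: "j \<in> Idl B"
  note ic = ideal_memI(2)[OF genideal_ideal[OF assms(1)] i]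
  have "Idl B \<subseteq> {y \<in> carrier R. y \<otimes> a \<in> K}" if "a \<in> A" for a
    using that assms AB m_comm[of _ a] by (intro genideal_minimal colon_ideal) (auto simp: subset_iff)
  then have "j \<in> carrier R \<and> j \<otimes> a \<in> K" if "a \<in> A" for a
    using that j by blast
  then have "a \<otimes> j \<in> K" if "a \<in> A" for a
    using that assms(1) m_comm[of j a] by (metis subsetD)
  then have "Idl A \<subseteq> {y \<in> carrier R. y \<otimes> j \<in> K}"
    using assms j ideal_memI(2)[OF genideal_ideal[OF assms(2)]]
    by (intro genideal_minimal colon_ideal) auto
  then show "i \<otimes> j \<in> K" using i by auto
qed

lemma pow_eq_monoms:
  assumes x: "x \<in> {..<d} \<rightarrow> carrier R" and J: "J = Idl (x ` {..<d})"
  shows "ideal_pow R J n = Idl (monom d x ` expo d n)"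
proof
  have JI: "ideal J R" unfolding J using x by (intro genideal_ideal) auto
  have "x ` {..<d} \<subseteq> J" unfolding J using x by (intro genideal_self) auto
  then have xJ: "x \<in> {..<d} \<rightarrow> J" by auto
  show "Idl (monom d x ` expo d n) \<subseteq> ideal_pow R J n"
    using monom_mem_pow[OF JI xJ]
    by (intro genideal_minimal pow_ideal JI) (auto simp: expo_def)
  have MC: "monom d x ` expo d n \<subseteq> carrier R" for n using x by auto
  show "ideal_pow R J n \<subseteq> Idl (monom d x ` expo d n)"
  proof (induct n)
    case 0
    have "monom d x (\<lambda>_. 0) = \<one>" unfolding monom_def by (rule finprod_one_eqI) auto
    moreover have "(\<lambda>_. 0) \<in> expo d 0" by (simp add: expo_def)
    ultimately have "\<one> \<in> Idl (monom d x ` expo d 0)"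
      using genideal_self[OF MC] by (metis image_eqI subsetD)
    then show ?case using ideal_memI(6)[OF genideal_ideal[OF MC], of \<one> 0] by force
  next
    case (Suc n)
    have "ideal_pow R J (Suc n) \<subseteq> (Idl (monom d x ` expo d n)) \<cdot> (Idl (x ` {..<d}))"
      using Suc by (simp add: J[symmetric] prod_mono)
    also have "\<dots> \<subseteq> Idl (monom d x ` expo d (Suc n))"
    proof (rule prod_Idl_le[OF MC])
      fix a b assume "a \<in> monom d x ` expo d n" "b \<in> x ` {..<d}"
      then obtain \<alpha> i where \<alpha>: "\<alpha> \<in> expo d n" "a = monom d x \<alpha>" "i < d" "b = x i" by auto
      let ?e = "\<lambda>j. if j = i then 1 else (0::nat)"
      have "a \<otimes> b = monom d x (\<lambda>j. \<alpha> j + ?e j)"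
        using \<alpha> x by (simp add: monom_add monom_unit[OF x])
      moreover have "(\<lambda>j. \<alpha> j + ?e j) \<in> expo d (Suc n)"
        using \<alpha> by (auto simp: expo_def sum.distrib)
      ultimately show "a \<otimes> b \<in> Idl (monom d x ` expo d (Suc n))"
        by (intro genideal_self[OF MC, THEN subsetD]) (rule image_eqI)
    qed (use x MC in \<open>auto intro: genideal_ideal\<close>)
    finally show ?case .
  qed
qed

lemma lower_monoms_ideal: "x \<in> {..<d} \<rightarrow> carrier R \<Longrightarrow> ideal (lower_monoms d x \<alpha>) R"
  unfolding lower_monoms_def by (intro genideal_ideal) auto

lemma monom_in_lower:
  "\<lbrakk>x \<in> {..<d} \<rightarrow> carrier R; \<alpha> \<in> expo d n; \<beta> \<in> expo d n; lexless d \<beta> \<alpha>\<rbrakk>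
    \<Longrightarrow> monom d x \<beta> \<in> lower_monoms d x \<alpha>"
  unfolding lower_monoms_def
  by (intro genideal_self[THEN subsetD]) (auto simp: expo_def)

lemma lower_monoms_mono:
  assumes "x \<in> {..<d} \<rightarrow> carrier R" "\<alpha> \<in> expo d n" "\<beta> \<in> expo d n" "lexless d \<beta> \<alpha>"
  shows "lower_monoms d x \<beta> \<subseteq> lower_monoms d x \<alpha>"
  unfolding lower_monoms_def[of d x \<beta>] using assms
  by (intro genideal_minimal lower_monoms_ideal)
    (auto simp: expo_def intro!: monom_in_lower[of _ _ _ n] intro: lexless_trans)

text \<open>Because the order is total, of two elements with leading exponents in \<open>A\<close> the one with the smaller
  exponent is a lower term for the other. So the elements that have such a leading term form, with
  zero, an ideal.\<close>

lemma leading_monom: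
  assumes x: "x \<in> {..<d} \<rightarrow> carrier R" and A: "A \<subseteq> expo d n" and w: "w \<in> Idl (monom d x ` A)"
  shows "w = \<zero> \<or> (\<exists>\<alpha>\<in>A. \<exists>r\<in>carrier R. \<exists>v\<in>lower_monoms d x \<alpha>. w = r \<otimes> monom d x \<alpha> \<oplus> v)"
proof -
  define T where "T \<alpha> = {r \<otimes> monom d x \<alpha> \<oplus> v | r v. r \<in> carrier R \<and> v \<in> lower_monoms d x \<alpha>}" for \<alpha>
  let ?K = "{\<zero>} \<union> (\<Union>\<alpha>\<in>A. T \<alpha>)"
  note LI = lower_monoms_ideal[OF x]
  note mc = monom_closed[OF x]
  have lc: "v \<in> carrier R" if "v \<in> lower_monoms d x \<alpha>" for v \<alpha>
    using ideal_memI(2)[OF LI that] .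
  have TE: "r \<otimes> monom d x \<alpha> \<oplus> v \<in> T \<alpha>" if "r \<in> carrier R" "v \<in> lower_monoms d x \<alpha>" for r v \<alpha>
    using that by (auto simp: T_def)
  have lower_le_T: "v \<in> T \<alpha>" if "v \<in> lower_monoms d x \<alpha>" for v \<alpha>
    using TE[OF zero_closed that] mc[of \<alpha>] lc[OF that] by simp
  have TI: "ideal (T \<alpha>) R" for \<alpha>
  proof (rule cring_idealI)
    show "T \<alpha> \<subseteq> carrier R" using lc mc by (auto simp: T_def)
    show "\<zero> \<in> T \<alpha>" using lower_le_T ideal_memI(1)[OF LI] .
  next
    fix a b assume "a \<in> T \<alpha>" "b \<in> T \<alpha>"
    then obtain r s u v where *: "r \<in> carrier R" "s \<in> carrier R" "u \<in> lower_monoms d x \<alpha>"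
      "v \<in> lower_monoms d x \<alpha>" "a = r \<otimes> monom d x \<alpha> \<oplus> u" "b = s \<otimes> monom d x \<alpha> \<oplus> v"
      by (auto simp: T_def)
    then have "a \<oplus> b = (r \<oplus> s) \<otimes> monom d x \<alpha> \<oplus> (u \<oplus> v)"
      using lc[of u] lc[of v] mc[of \<alpha>] by (simp add: l_distr a_ac)
    then show "a \<oplus> b \<in> T \<alpha>" using TE[of "r \<oplus> s" "u \<oplus> v"] * ideal_memI(3)[OF LI *(3,4)] by simp
  next
    fix a s assume "a \<in> T \<alpha>" and s: "s \<in> carrier R"
    then obtain r u where *: "r \<in> carrier R" "u \<in> lower_monoms d x \<alpha>"
      "a = r \<otimes> monom d x \<alpha> \<oplus> u" by (auto simp: T_def)
    then have "s \<otimes> a = (s \<otimes> r) \<otimes> monom d x \<alpha> \<oplus> s \<otimes> u"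
      using lc[of u] mc[of \<alpha>] s by (simp add: r_distr m_assoc)
    then show "s \<otimes> a \<in> T \<alpha>"
      using TE[of "s \<otimes> r" "s \<otimes> u"] * s ideal_memI(6)[OF LI *(2) s] by simp
  qed
  have Tle: "T \<beta> \<subseteq> T \<alpha>" if "\<alpha> \<in> A" "\<beta> \<in> A" "lexless d \<beta> \<alpha>" for \<alpha> \<beta>
  proof
    fix y assume "y \<in> T \<beta>"
    then obtain r v where *: "r \<in> carrier R" "v \<in> lower_monoms d x \<beta>" "y = r \<otimes> monom d x \<beta> \<oplus> v"
      by (auto simp: T_def)
    have "\<alpha> \<in> expo d n" "\<beta> \<in> expo d n" using that A by auto
    note \<alpha>\<beta> = this
    have "r \<otimes> monom d x \<beta> \<in> lower_monoms d x \<alpha>"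
      using ideal_memI(6)[OF LI monom_in_lower[OF x \<alpha>\<beta> that(3)] *(1)] .
    moreover have "v \<in> lower_monoms d x \<alpha>"
      using lower_monoms_mono[OF x \<alpha>\<beta> that(3)] *(2) by (rule subsetD)
    ultimately have "y \<in> lower_monoms d x \<alpha>" unfolding *(3) by (rule ideal_memI(3)[OF LI])
    then show "y \<in> T \<alpha>" by (rule lower_le_T)
  qed
  have TC: "a \<in> carrier R" if "a \<in> T \<alpha>" for a \<alpha>
    using ideal_memI(2)[OF TI that] .
  have "ideal ?K R"
  proof (rule cring_idealI)
    show "?K \<subseteq> carrier R" using TC by auto
    show "\<zero> \<in> ?K" by simp
  next
    fix a b assume ab: "a \<in> ?K" "b \<in> ?K"
    show "a \<oplus> b \<in> ?K"
    proof (cases "a = \<zero> \<or> b = \<zero>")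
      case True
      moreover have "a \<in> carrier R" "b \<in> carrier R" using ab TC by auto
      ultimately have "a \<oplus> b = b \<or> a \<oplus> b = a" by auto
      then show ?thesis using ab by metis
    next
      case False
      then obtain \<alpha> \<beta> where 1: "\<alpha> \<in> A" "\<beta> \<in> A" "a \<in> T \<alpha>" "b \<in> T \<beta>" using ab by blast
      then have "lexless d \<alpha> \<beta> \<or> \<alpha> = \<beta> \<or> lexless d \<beta> \<alpha>"
        using lexless_total A by blast
      then obtain \<gamma> where \<gamma>: "\<gamma> \<in> A" "a \<in> T \<gamma>" "b \<in> T \<gamma>"
        using 1 Tle by blast
      then show ?thesis using ideal_memI(3)[OF TI \<gamma>(2,3)] by blast
    qed
  next
    fix a r assume "a \<in> ?K" "r \<in> carrier R"
    then show "r \<otimes> a \<in> ?K" using ideal_memI(6)[OF TI] by auto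
  qed
  moreover have "monom d x ` A \<subseteq> ?K"
  proof
    fix y assume "y \<in> monom d x ` A"
    then obtain \<alpha> where "\<alpha> \<in> A" "y = monom d x \<alpha>" by blast
    moreover have "monom d x \<alpha> \<in> T \<alpha>"
      using TE[OF one_closed ideal_memI(1)[OF LI], of \<alpha>] mc[of \<alpha>] by simp
    ultimately show "y \<in> ?K" by blast
  qed
  ultimately have "Idl (monom d x ` A) \<subseteq> ?K" by (rule genideal_minimal)
  then have "w \<in> ?K" using w by blast
  then show ?thesis by (auto simp: T_def)
qed

end

lemma (in cring) lower_monoms_shift:
  assumes x: "x \<in> {..<d} \<rightarrow> carrier R" and w: "w \<in> lower_monoms d x \<alpha>" and "\<forall>i\<ge>d. \<gamma> i = 0"
  shows "monom d x \<gamma> \<otimes> w \<in> lower_monoms d x (\<lambda>i. \<alpha> i + \<gamma> i)"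
proof -
  let ?K = "{z \<in> carrier R. z \<otimes> monom d x \<gamma> \<in> lower_monoms d x (\<lambda>i. \<alpha> i + \<gamma> i)}"
  have "lower_monoms d x \<alpha> \<subseteq> ?K"
    unfolding lower_monoms_def[of _ _ \<alpha>]
  proof (rule genideal_minimal)
    show "ideal ?K R" using x by (intro colon_ideal lower_monoms_ideal) auto
    show "monom d x ` {\<beta> \<in> expo d (\<Sum>i<d. \<alpha> i). lexless d \<beta> \<alpha>} \<subseteq> ?K"
    proof clarify
      fix \<beta> assume \<beta>: "\<beta> \<in> expo d (\<Sum>i<d. \<alpha> i)" "lexless d \<beta> \<alpha>"
      have "lexless d (\<lambda>i. \<beta> i + \<gamma> i) (\<lambda>i. \<alpha> i + \<gamma> i)" using \<beta>(2) by (auto simp: lexless_def)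
      moreover have "(\<lambda>i. \<beta> i + \<gamma> i) \<in> expo d (\<Sum>i<d. \<alpha> i + \<gamma> i)"
        using \<beta>(1) assms(3) by (auto simp: expo_def sum.distrib)
      ultimately have "monom d x (\<lambda>i. \<beta> i + \<gamma> i) \<in> lower_monoms d x (\<lambda>i. \<alpha> i + \<gamma> i)"
        unfolding lower_monoms_def using x by (intro genideal_self[THEN subsetD]) auto
      then show "monom d x \<beta> \<in> carrier R \<and>
          monom d x \<beta> \<otimes> monom d x \<gamma> \<in> lower_monoms d x (\<lambda>i. \<alpha> i + \<gamma> i)"
        using x by (simp add: monom_add)
    qed
  qed
  then show ?thesis using w m_comm[of w "monom d x \<gamma>"] x by auto
qed

locale noetherian_cring = noetherian_ring R + cring R for R (structure)
begin

lemma indexed_generators: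
  assumes "ideal J R"
  obtains x and d :: nat where "x \<in> {..<d} \<rightarrow> carrier R" "J = Idl (x ` {..<d})"
proof -
  obtain G where G: "G \<subseteq> carrier R" "finite G" "J = Idl G" using finetely_gen[OF assms] by blast
  obtain d x where "G = x ` {i::nat. i < d}"
    using finite_imp_nat_seg_image_inj_on[OF G(2)] by (metis (no_types))
  then have "x ` {..<d} = G" by (simp add: lessThan_def)
  then show ?thesis using G by (intro that[of x d]) auto
qed

text \<open>Let \<open>J = (x\<^sub>1, \<dots>, x\<^sub>d)\<close>. The leading coefficient ideals \<open>L \<alpha> = (I + lower terms) : x\<^sup>\<alpha>\<close> grow with
  \<open>\<alpha>\<close>, so they depend only on \<open>\<alpha>\<close> truncated at some \<open>c\<close>. Hence the leading term of an element of
  \<open>I \<inter> J\<^sup>n\<close> is a monomial multiple of the leading term of an element of \<open>I\<close> of degree at most \<open>d c\<close>;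
  subtracting that multiple, which lies in \<open>J\<^bsup>n - d c\<^esup> I\<close>, lowers the leading exponent. This is Hilbert's
  basis theorem for the Rees algebra, carried out with ideals of \<open>R\<close> only.\<close>

theorem artin_rees_exists:
  assumes J: "ideal J R" and I: "ideal I R"
  shows "\<exists>c. artin_rees J I c"
proof -
  obtain x and d :: nat where x: "x \<in> {..<d} \<rightarrow> carrier R" and Jx: "J = Idl (x ` {..<d})"
    using indexed_generators[OF J] .
  note mc = monom_closed[OF x] and LI = lower_monoms_ideal[OF x] and pow = pow_eq_monoms[OF x Jx]
  have "x ` {..<d} \<subseteq> J" unfolding Jx using x by (intro genideal_self) auto
  then have xJ: "x \<in> {..<d} \<rightarrow> J" by auto
  define L where "L \<alpha> = {r \<in> carrier R. r \<otimes> monom d x \<alpha> \<in> I <+> lower_monoms d x \<alpha>}" for \<alpha>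
  have SI: "ideal (I <+> lower_monoms d x \<alpha>) R" for \<alpha> using I LI by (rule add_ideals)
  define Z where "Z \<alpha> = (\<lambda>i. if i < d then \<alpha> i else (0::nat))" for \<alpha>
  have "\<exists>c. \<forall>\<alpha>. (\<forall>i. i \<notin> {..<d} \<longrightarrow> \<alpha> i = 0) \<longrightarrow>
      L (Z \<alpha>) = L (Z (\<lambda>i. if i \<in> {..<d} then min (\<alpha> i) c else 0))"
  proof (rule monotone_family_stabilizes)
    show "ideal (L (Z \<alpha>)) R" for \<alpha>
      unfolding L_def using SI mc by (intro colon_ideal)
    show "L (Z \<alpha>) \<subseteq> L (Z \<beta>)" if "\<alpha> \<le> \<beta>" for \<alpha> \<beta>
    proof
      fix r assume r: "r \<in> L (Z \<alpha>)"
      define \<gamma> where "\<gamma> i = Z \<beta> i - Z \<alpha> i" for i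
      have \<beta>: "Z \<beta> = (\<lambda>i. Z \<alpha> i + \<gamma> i)" using that by (auto simp: \<gamma>_def Z_def le_fun_def)
      from r obtain i w where iw: "i \<in> I" "w \<in> lower_monoms d x (Z \<alpha>)" "r \<otimes> monom d x (Z \<alpha>) = i \<oplus> w"
        "r \<in> carrier R"
        by (auto simp: L_def mem_add_iff)
      have "monom d x \<gamma> \<otimes> w \<in> lower_monoms d x (Z \<beta>)"
        unfolding \<beta> by (rule lower_monoms_shift[OF x iw(2)]) (simp add: \<gamma>_def Z_def)
      moreover have "monom d x \<gamma> \<otimes> i \<in> I" using ideal_memI(6)[OF I iw(1)] mc by simp
      moreover have "r \<otimes> monom d x (Z \<beta>) = monom d x \<gamma> \<otimes> (r \<otimes> monom d x (Z \<alpha>))"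
        unfolding \<beta> monom_add[OF x] using mc iw(4) by (simp add: m_ac)
      then have "r \<otimes> monom d x (Z \<beta>) = monom d x \<gamma> \<otimes> i \<oplus> monom d x \<gamma> \<otimes> w"
        unfolding iw(3) using mc ideal_memI(2)[OF I iw(1)] ideal_memI(2)[OF LI iw(2)] by (simp add: r_distr)
      ultimately show "r \<in> L (Z \<beta>)" using iw(4) unfolding L_def mem_add_iff by blast
    qed
  qed simp
  then obtain c where c0: "\<And>\<alpha>. (\<forall>i. i \<notin> {..<d} \<longrightarrow> \<alpha> i = 0) \<Longrightarrow>
      L (Z \<alpha>) = L (Z (\<lambda>i. if i \<in> {..<d} then min (\<alpha> i) c else 0))" by blast
  define trunc where "trunc \<alpha> = (\<lambda>i. if i < d then min (\<alpha> i) c else (0::nat))" for \<alpha>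
  have Lc: "L \<alpha> = L (trunc \<alpha>)" if "\<alpha> \<in> expo d n" for \<alpha> n
  proof -
    have "Z \<alpha> = \<alpha>" "Z (trunc \<alpha>) = trunc \<alpha>" using that by (auto simp: Z_def trunc_def expo_def)
    moreover have "trunc \<alpha> = (\<lambda>i. if i \<in> {..<d} then min (\<alpha> i) c else 0)" by (simp add: trunc_def)
    ultimately show ?thesis using c0[of \<alpha>] that by (simp add: expo_def)
  qed
  have "artin_rees J I (d * c)"
    unfolding artin_rees_def
  proof
    fix n
    let ?M = "ideal_pow R J (n - d * c) \<cdot> I"
    have MI: "ideal ?M R" using J I by (intro ideal_prod_is_ideal pow_ideal)
    have step: "y \<in> ?M" if "y \<in> I" "\<alpha> \<in> expo d n" "r \<in> carrier R" "v \<in> lower_monoms d x \<alpha>"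
      "y = r \<otimes> monom d x \<alpha> \<oplus> v" for y \<alpha> r v
      using that
    proof (induct \<alpha> arbitrary: y r v rule: wf_induct_rule[OF lexless_wf[of d]])
      case (1 \<alpha>)
      note yc = ideal_memI(2)[OF I 1(2)] and vc = ideal_memI(2)[OF LI 1(5)]
      have "r \<otimes> monom d x \<alpha> = y \<oplus> \<ominus> v" using 1(4,6) vc mc[of \<alpha>] yc by (simp add: a_assoc r_neg)
      then have "r \<in> L \<alpha>" unfolding L_def mem_add_iff using 1(2,4) ideal_memI(4)[OF LI 1(5)] by blast
      then have "r \<in> L (trunc \<alpha>)" using Lc[OF 1(3)] by simp
      then obtain z w where zw: "z \<in> I" "w \<in> lower_monoms d x (trunc \<alpha>)"
          "r \<otimes> monom d x (trunc \<alpha>) = z \<oplus> w"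
        by (auto simp: L_def mem_add_iff)
      note zc = ideal_memI(2)[OF I zw(1)] and wc = ideal_memI(2)[OF LI zw(2)]
      define \<gamma> where "\<gamma> i = \<alpha> i - trunc \<alpha> i" for i
      have \<alpha>: "\<alpha> = (\<lambda>i. trunc \<alpha> i + \<gamma> i)" using 1(3) by (auto simp: \<gamma>_def trunc_def expo_def)
      have "(\<Sum>i<d. trunc \<alpha> i) \<le> (\<Sum>i<d. c)" by (intro sum_mono) (simp add: trunc_def)
      moreover have "n = (\<Sum>i<d. trunc \<alpha> i) + (\<Sum>i<d. \<gamma> i)"
        using 1(3) \<alpha> unfolding expo_def by (metis (mono_tags, lifting) mem_Collect_eq sum.cong sum.distrib)
      ultimately have "n - d * c \<le> (\<Sum>i<d. \<gamma> i)" by simp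
      then have "monom d x \<gamma> \<in> ideal_pow R J (n - d * c)"
        using monom_mem_pow[OF J xJ] pow_antimono[OF J] by blast
      then have gz: "monom d x \<gamma> \<otimes> z \<in> ?M" using zw(1) by (rule ideal_prod.prod)
      have gw: "monom d x \<gamma> \<otimes> w \<in> lower_monoms d x \<alpha>"
        using lower_monoms_shift[OF x zw(2), of \<gamma>] 1(3) \<alpha> by (simp add: \<gamma>_def expo_def)
      define y' where "y' = v \<oplus> monom d x \<gamma> \<otimes> w"
      have y': "y' \<in> lower_monoms d x \<alpha>" unfolding y'_def using 1(5) gw by (rule ideal_memI(3)[OF LI])
      have "monom d x \<alpha> = monom d x (trunc \<alpha>) \<otimes> monom d x \<gamma>"
        using monom_add[OF x, of "trunc \<alpha>" \<gamma>] \<alpha> by simp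
      then have "r \<otimes> monom d x \<alpha> = monom d x \<gamma> \<otimes> (z \<oplus> w)"
        using zw(3)[symmetric] mc 1(4) by (simp add: m_ac)
      then have y: "y = monom d x \<gamma> \<otimes> z \<oplus> y'"
        unfolding 1(6) y'_def using mc zc wc vc by (simp add: r_distr a_ac)
      have y'c: "y' \<in> carrier R" using ideal_memI(2)[OF LI y'] .
      have "y' = y \<ominus> monom d x \<gamma> \<otimes> z"
        unfolding y using y'c mc[of \<gamma>] zc
        by (simp add: minus_eq a_comm[of _ y'] a_assoc r_neg)
      then have y'I: "y' \<in> I" using 1(2) ideal_memI(5)[OF I] ideal_memI(6)[OF I zw(1)] mc by simp
      have "y' = \<zero> \<or> (\<exists>\<beta>\<in>{\<beta> \<in> expo d (\<Sum>i<d. \<alpha> i). lexless d \<beta> \<alpha>}.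
          \<exists>r\<in>carrier R. \<exists>v\<in>lower_monoms d x \<beta>. y' = r \<otimes> monom d x \<beta> \<oplus> v)"
        using y' unfolding lower_monoms_def[of d x \<alpha>] by (intro leading_monom[OF x]) auto
      moreover have "(\<Sum>i<d. \<alpha> i) = n" using 1(3) by (simp add: expo_def)
      ultimately have "y' \<in> ?M"
        using 1(1)[OF _ y'I] ideal_memI(1)[OF MI] by auto
      then show ?case unfolding y using gz ideal_memI(3)[OF MI] by blast
    qed
    show "I \<inter> ideal_pow R J n \<subseteq> ?M"
    proof
      fix y assume y: "y \<in> I \<inter> ideal_pow R J n"
      then have "y = \<zero> \<or> (\<exists>\<alpha>\<in>expo d n. \<exists>r\<in>carrier R. \<exists>v\<in>lower_monoms d x \<alpha>. y = r \<otimes> monom d x \<alpha> \<oplus> v)"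
        using leading_monom[OF x order_refl, of y n] pow by auto
      then show "y \<in> ?M" using step y ideal_memI(1)[OF MI] by blast
    qed
  qed
  then show ?thesis by blast
qed

end

locale noetherian_local_ring = noetherian_cring R + local_ring R for R (structure)
begin

abbreviation \<mm> :: "'a set" where "\<mm> \<equiv> max_ideal R"

lemma max_ideal_maximal: "maximalideal \<mm> R"
  unfolding max_ideal_def by (rule theI'[OF ex1_maximalideal])

lemma max_ideal_ideal: "ideal \<mm> R"
  using max_ideal_maximal by (rule maximalideal.axioms)

lemma one_notin_max_ideal: "\<one> \<notin> \<mm>"
  using ideal.one_imp_carrier[OF max_ideal_ideal] maximalideal.I_notcarr[OF max_ideal_maximal] by blast

lemma proper_le_max_ideal:
  assumes "ideal I R" "\<one> \<notin> I"
  shows "I \<subseteq> \<mm>"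
proof -
  let ?X = "{K. ideal K R \<and> I \<subseteq> K \<and> \<one> \<notin> K}"
  obtain M where M: "M \<in> ?X" "\<And>K. \<lbrakk>K \<in> ?X; M \<subseteq> K\<rbrakk> \<Longrightarrow> K = M"
    using maximal_ideal_in[of ?X] assms by (metis (mono_tags, lifting) empty_iff mem_Collect_eq order_refl)
  have "maximalideal M R"
  proof (rule maximalidealI)
    show "ideal M R" "carrier R \<noteq> M" using M by auto
  next
    fix K assume K: "ideal K R" "M \<subseteq> K" "K \<subseteq> carrier R"
    show "K = M \<or> K = carrier R"
      using M K ideal.one_imp_carrier[OF K(1)] by (cases "\<one> \<in> K") auto
  qed
  then have "M = \<mm>" using ex1_maximalideal max_ideal_maximal by blast
  then show ?thesis using M by blast
qed

lemma one_minus_cancel: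
  assumes "u \<in> \<mm>" "ideal Q R" "x \<in> carrier R" "(\<one> \<ominus> u) \<otimes> x \<in> Q"
  shows "x \<in> Q"
proof -
  have uc: "u \<in> carrier R" using ideal_memI(2)[OF max_ideal_ideal assms(1)] .
  have "\<one> \<in> PIdl (\<one> \<ominus> u)"
  proof (rule ccontr)
    assume "\<one> \<notin> PIdl (\<one> \<ominus> u)"
    then have "PIdl (\<one> \<ominus> u) \<subseteq> \<mm>" using uc by (intro proper_le_max_ideal cgenideal_ideal) auto
    then have "\<one> \<ominus> u \<in> \<mm>" using cgenideal_self uc by auto
    then have "(\<one> \<ominus> u) \<oplus> u \<in> \<mm>" using ideal_memI(3)[OF max_ideal_ideal] assms(1) by blast
    then show False using one_notin_max_ideal uc by (simp add: minus_eq a_assoc l_neg)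
  qed
  then obtain v where v: "v \<in> carrier R" "\<one> = v \<otimes> (\<one> \<ominus> u)" by (auto simp: cgenideal_def)
  have "x = v \<otimes> ((\<one> \<ominus> u) \<otimes> x)" using v assms(3) uc by (metis l_one m_assoc minus_closed one_closed)
  then show ?thesis using ideal_memI(6)[OF assms(2,4) v(1)] by simp
qed

text \<open>The Artin-Rees lemma for \<open>Q + (x)\<close> gives \<open>x \<in> Q + J x\<close>, that is \<open>(1 - u) x \<in> Q\<close> with \<open>u \<in> J\<close>, and
  \<open>1 - u\<close> is a unit.\<close>

theorem krull_intersection:
  assumes J: "ideal J R" "J \<subseteq> \<mm>" and Q: "ideal Q R" and x: "x \<in> carrier R"
    and all: "\<And>n. x \<in> Q <+> ideal_pow R J n"
  shows "x \<in> Q"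
proof -
  note Qx = adjoin_ideal[OF Q x] and iff = adjoin_iff[OF Q x]
  obtain c where c: "artin_rees J (adjoin Q x) c" using artin_rees_exists[OF J(1) Qx] by blast
  obtain q j where qj: "q \<in> Q" "j \<in> ideal_pow R J (Suc c)" "x = q \<oplus> j"
    using all[of "Suc c"] by (auto simp: mem_add_iff)
  note qc = ideal_memI(2)[OF Q qj(1)] and jc = ideal_memI(2)[OF pow_ideal[OF J(1)] qj(2)]
  have "j = \<ominus> q \<oplus> \<one> \<otimes> x" unfolding qj(3) using qc jc by algebra
  then have "j \<in> adjoin Q x" unfolding iff using ideal_memI(4)[OF Q qj(1)] by blast
  then have "j \<in> ideal_pow R J (Suc c - c) \<cdot> adjoin Q x"
    using c qj(2) unfolding artin_rees_def by blast
  then have "j \<in> J \<cdot> adjoin Q x" using pow_1[OF J(1)] by simp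
  then obtain q' u where u: "q' \<in> Q" "u \<in> J" "j = q' \<oplus> u \<otimes> x"
    unfolding prod_adjoin_iff[OF J(1) Q x] using ideal_prod_inter[OF J(1) Q] by blast
  note uc = ideal_memI(2)[OF J(1) u(2)] and q'c = ideal_memI(2)[OF Q u(1)]
  have "(\<one> \<ominus> u) \<otimes> x = (q \<oplus> j) \<ominus> u \<otimes> x" unfolding qj(3)[symmetric] using uc x by algebra
  also have "\<dots> = q \<oplus> q'" unfolding u(3) using qc q'c uc x by algebra
  finally have "(\<one> \<ominus> u) \<otimes> x \<in> Q" using ideal_memI(3)[OF Q qj(1) u(1)] by simp
  then show ?thesis using one_minus_cancel[OF _ Q x] u(2) J(2) by blast
qed

end

section \<open>Perturbing one generator of an ideal\<close>

context cring
begin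

text \<open>The map from \<open>J\<^sup>n\<close> onto the degree \<open>n\<close> part of \<open>gr\<^sub>J(R/I)\<close> has kernel \<open>J\<^sup>n \<inter> (J\<^bsup>n + 1\<^esup> + I)\<close>, so this
  says that \<open>I\<close> and \<open>I'\<close> have the same initial ideal in \<open>gr\<^sub>J(R)\<close>.\<close>

definition same_initial :: "'a set \<Rightarrow> 'a set \<Rightarrow> 'a set \<Rightarrow> bool"
  where "same_initial J I I' \<longleftrightarrow> (\<forall>n. ideal_pow R J n \<inter> (ideal_pow R J (Suc n) <+> I)
    = ideal_pow R J n \<inter> (ideal_pow R J (Suc n) <+> I'))"

lemma initial_le:
  assumes J: "ideal J R" and I: "ideal I R" and I': "ideal I' R"
    and le: "I \<inter> ideal_pow R J n \<subseteq> I' <+> ideal_pow R J (Suc n)"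
  shows "ideal_pow R J n \<inter> (ideal_pow R J (Suc n) <+> I) \<subseteq> ideal_pow R J (Suc n) <+> I'"
proof
  fix x assume x: "x \<in> ideal_pow R J n \<inter> (ideal_pow R J (Suc n) <+> I)"
  then obtain j i where ji: "j \<in> ideal_pow R J (Suc n)" "i \<in> I" "x = j \<oplus> i" by (auto simp only: mem_add_iff)
  note P = pow_ideal[OF J]
  have c: "j \<in> carrier R" "i \<in> carrier R" using ideal_memI(2)[OF P ji(1)] ideal_memI(2)[OF I ji(2)] .
  have "j \<in> ideal_pow R J n" using pow_antimono[OF J, of n "Suc n"] ji(1) by auto
  moreover have "i = x \<ominus> j" unfolding ji(3) using c by algebra
  ultimately have "i \<in> ideal_pow R J n" using x ideal_memI(5)[OF P] by auto
  then obtain i' j' where i: "i' \<in> I'" "j' \<in> ideal_pow R J (Suc n)" "i = i' \<oplus> j'"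
    using le ji(2) unfolding mem_add_iff subset_iff by blast
  have c': "j' \<in> carrier R" "i' \<in> carrier R" using ideal_memI(2)[OF P i(2)] ideal_memI(2)[OF I' i(1)] .
  have "x = (j \<oplus> j') \<oplus> i'" unfolding ji(3) i(3) using c c' by algebra
  then show "x \<in> ideal_pow R J (Suc n) <+> I'"
    unfolding mem_add_iff using i(1) ideal_memI(3)[OF P ji(1) i(2)] by blast
qed

lemma same_initialI:
  assumes J: "ideal J R" and I: "ideal I R" and I': "ideal I' R"
    and "\<And>n. I \<inter> ideal_pow R J n \<subseteq> I' <+> ideal_pow R J (Suc n)"
    and "\<And>n. I' \<inter> ideal_pow R J n \<subseteq> I <+> ideal_pow R J (Suc n)"
  shows "same_initial J I I'"
  unfolding same_initial_def
  using initial_le[OF J I I' assms(4)] initial_le[OF J I' I assms(5)] by blast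

end

locale local_ring_with_ideal = noetherian_local_ring R for R (structure) +
  fixes J :: "'a set"
  assumes J_ideal: "ideal J R" and J_le_max: "J \<subseteq> max_ideal R"
begin

abbreviation P :: "nat \<Rightarrow> 'a set" where "P n \<equiv> ideal_pow R J n"

lemma P_ideal: "ideal (P n) R" by (rule pow_ideal[OF J_ideal])

lemma P_carr: "x \<in> P n \<Longrightarrow> x \<in> carrier R" by (rule ideal_memI(2)[OF P_ideal])

lemma P_mono: "m \<le> n \<Longrightarrow> x \<in> P n \<Longrightarrow> x \<in> P m" using pow_antimono[OF J_ideal] by blast

lemma P_mult: "\<lbrakk>x \<in> P m; y \<in> P n; k \<le> m + n\<rbrakk> \<Longrightarrow> x \<otimes> y \<in> P k"
  using pow_mult_mem[OF J_ideal] P_mono by blast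

end

text \<open>The ideal \<open>Q\<close> stands for the generators that stay and \<open>g\<close> for the one that moves. The assumption
  \<open>colon\<close> says that \<open>J\<^sup>t\<close> kills \<open>(Q : g) / Q\<close>; this holds when \<open>J\<^sup>t\<close> kills the first Koszul homology of
  all generators.\<close>

locale one_perturbation = local_ring_with_ideal R J for R (structure) and J +
  fixes Q :: "'a set" and g \<epsilon> :: 'a and c t k :: nat
  assumes Q: "ideal Q R" and g: "g \<in> carrier R"
    and AR: "artin_rees J (adjoin Q g) c"
    and colon: "\<And>\<alpha> y. \<lbrakk>\<alpha> \<in> carrier R; \<alpha> \<otimes> g \<in> Q; y \<in> ideal_pow R J t\<rbrakk> \<Longrightarrow> y \<otimes> \<alpha> \<in> Q"
    and eps: "\<epsilon> \<in> ideal_pow R J k" and ck: "c < k" and tk: "t \<le> k"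
begin

abbreviation "g' \<equiv> g \<oplus> \<epsilon>"

lemma epsc [simp, intro]: "\<epsilon> \<in> carrier R" using P_carr[OF eps] .
lemma gc [simp, intro]: "g \<in> carrier R" by (rule g)
lemma g'c [simp, intro]: "g' \<in> carrier R" by simp
lemma Qc: "x \<in> Q \<Longrightarrow> x \<in> carrier R" by (rule ideal_memI(2)[OF Q])

lemmas Iiff = adjoin_iff[OF Q gc] and I'iff = adjoin_iff[OF Q g'c]
lemmas I = adjoin_ideal[OF Q gc] and I' = adjoin_ideal[OF Q g'c]

lemma AR_mem:
  assumes "x \<in> adjoin Q g" "x \<in> P p"
  obtains q \<alpha> where "q \<in> P (p - c) \<cdot> Q" "q \<in> Q" "\<alpha> \<in> P (p - c)" "x = q \<oplus> \<alpha> \<otimes> g"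
proof -
  have "x \<in> P (p - c) \<cdot> adjoin Q g" using AR assms unfolding artin_rees_def by blast
  then show ?thesis
    using that ideal_prod_inter[OF P_ideal Q] unfolding prod_adjoin_iff[OF P_ideal Q gc] by blast
qed

lemma initial_subset: "adjoin Q g \<inter> P n \<subseteq> adjoin Q g' <+> P (Suc n)"
proof
  fix x assume x: "x \<in> adjoin Q g \<inter> P n"
  then obtain q \<alpha> where q: "q \<in> Q" "\<alpha> \<in> P (n - c)" "x = q \<oplus> \<alpha> \<otimes> g" by (meson AR_mem IntD1 IntD2)
  note cs = Qc[OF q(1)] P_carr[OF q(2)]
  have "\<alpha> \<otimes> \<epsilon> \<in> P (Suc n)" using ck by (intro P_mult[OF q(2) eps]) auto
  then have "\<ominus> (\<alpha> \<otimes> \<epsilon>) \<in> P (Suc n)" by (rule ideal_memI(4)[OF P_ideal])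
  moreover have "x = (q \<oplus> \<alpha> \<otimes> g') \<oplus> \<ominus> (\<alpha> \<otimes> \<epsilon>)" unfolding q(3) using cs gc epsc by algebra
  moreover have "q \<oplus> \<alpha> \<otimes> g' \<in> adjoin Q g'" unfolding I'iff using q cs by blast
  ultimately show "x \<in> adjoin Q g' <+> P (Suc n)" unfolding mem_add_iff by blast
qed

lemma eps_colon: "\<lbrakk>\<alpha> \<in> carrier R; \<alpha> \<otimes> g \<in> Q\<rbrakk> \<Longrightarrow> \<alpha> \<otimes> \<epsilon> \<in> Q"
  using colon[of \<alpha> \<epsilon>] P_mono[OF tk eps] m_comm[of \<alpha> \<epsilon>] by simp

text \<open>This is the step that fails for an arbitrary ideal. If \<open>\<alpha>\<close> has order \<open>p < n - c\<close>, then \<open>q + \<alpha> g\<close> has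
  order above \<open>p + c\<close> and can be rewritten with a coefficient \<open>\<alpha>2\<close> of higher order. The difference
  \<open>\<alpha> - \<alpha>2\<close> lies in \<open>Q : g\<close>, which \<open>\<epsilon>\<close> multiplies into \<open>Q\<close>, so \<open>\<alpha>\<close> may be replaced by \<open>\<alpha>2\<close> in front of
  \<open>g + \<epsilon>\<close> as well.\<close>

lemma coefficient_order:
  assumes x: "x \<in> adjoin Q g'" "x \<in> P n"
  shows "p = 0 \<or> p + c \<le> n \<Longrightarrow> \<exists>q\<in>Q. \<exists>\<alpha>\<in>P p. x = q \<oplus> \<alpha> \<otimes> g'"
proof (induct p)
  case 0
  then show ?case using x I'iff by simp
next
  case (Suc p)
  then obtain q \<alpha> where q: "q \<in> Q" "\<alpha> \<in> P p" "x = q \<oplus> \<alpha> \<otimes> g'" by auto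
  note cs = Qc[OF q(1)] P_carr[OF q(2)]
  have eq: "q \<oplus> \<alpha> \<otimes> g = x \<ominus> \<alpha> \<otimes> \<epsilon>" unfolding q(3) using cs gc epsc by algebra
  have 1: "\<alpha> \<otimes> \<epsilon> \<in> P (Suc p + c)" using ck by (intro P_mult[OF q(2) eps]) auto
  have "x \<in> P (Suc p + c)" using Suc(2) x(2) P_mono by blast
  then have "q \<oplus> \<alpha> \<otimes> g \<in> P (Suc p + c)" unfolding eq using 1 by (rule ideal_memI(5)[OF P_ideal])
  moreover have "q \<oplus> \<alpha> \<otimes> g \<in> adjoin Q g" unfolding Iiff using q cs by blast
  ultimately obtain q2 \<alpha>2 where q2: "q2 \<in> Q" "\<alpha>2 \<in> P (Suc p + c - c)" "q \<oplus> \<alpha> \<otimes> g = q2 \<oplus> \<alpha>2 \<otimes> g"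
    using AR_mem by metis
  note cs2 = Qc[OF q2(1)] P_carr[OF q2(2)]
  have "(\<alpha> \<ominus> \<alpha>2) \<otimes> g = (q \<oplus> \<alpha> \<otimes> g) \<ominus> q \<ominus> \<alpha>2 \<otimes> g" using cs cs2 gc by algebra
  also have "\<dots> = q2 \<ominus> q" unfolding q2(3) using cs cs2 gc by algebra
  finally have d: "(\<alpha> \<ominus> \<alpha>2) \<otimes> g \<in> Q" using ideal_memI(5)[OF Q q2(1) q(1)] by simp
  then have e: "(\<alpha> \<ominus> \<alpha>2) \<otimes> \<epsilon> \<in> Q" using cs cs2 by (intro eps_colon) auto
  have "x = (q \<oplus> ((\<alpha> \<ominus> \<alpha>2) \<otimes> g \<oplus> (\<alpha> \<ominus> \<alpha>2) \<otimes> \<epsilon>)) \<oplus> \<alpha>2 \<otimes> g'"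
    unfolding q(3) using cs cs2 gc epsc by algebra
  moreover have "q \<oplus> ((\<alpha> \<ominus> \<alpha>2) \<otimes> g \<oplus> (\<alpha> \<ominus> \<alpha>2) \<otimes> \<epsilon>) \<in> Q"
    using q(1) d e ideal_memI(3)[OF Q] by simp
  ultimately show ?case using q2(2) by auto
qed

lemma initial_supset: "adjoin Q g' \<inter> P n \<subseteq> adjoin Q g <+> P (Suc n)"
proof
  fix x assume x: "x \<in> adjoin Q g' \<inter> P n"
  then obtain q \<alpha> where q: "q \<in> Q" "\<alpha> \<in> P (n - c)" "x = q \<oplus> \<alpha> \<otimes> g'"
    using coefficient_order[of x n "n - c"] by (cases "n \<le> c") auto
  note cs = Qc[OF q(1)] P_carr[OF q(2)]
  have "\<alpha> \<otimes> \<epsilon> \<in> P (Suc n)" using ck by (intro P_mult[OF q(2) eps]) auto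
  moreover have "x = (q \<oplus> \<alpha> \<otimes> g) \<oplus> \<alpha> \<otimes> \<epsilon>" unfolding q(3) using cs gc epsc by algebra
  moreover have "q \<oplus> \<alpha> \<otimes> g \<in> adjoin Q g" unfolding Iiff using q cs by blast
  ultimately show "x \<in> adjoin Q g <+> P (Suc n)" unfolding mem_add_iff by blast
qed

lemma same_initial_adjoin: "same_initial J (adjoin Q g) (adjoin Q g')"
  using same_initialI[OF J_ideal I I' initial_subset initial_supset] .

lemma artin_rees_step:
  "adjoin Q g' \<inter> P m \<subseteq> P (m - c) \<cdot> adjoin Q g' <+> (adjoin Q g' \<inter> P (Suc m))"
proof
  fix x assume x: "x \<in> adjoin Q g' \<inter> P m"
  then obtain y j where yj: "y \<in> adjoin Q g" "j \<in> P (Suc m)" "x = y \<oplus> j"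
    using initial_supset[of m] unfolding subset_iff mem_add_iff by blast
  note cs = ideal_memI(2)[OF I yj(1)] P_carr[OF yj(2)]
  have "y = x \<ominus> j" unfolding yj(3) using cs by algebra
  then have "y \<in> P m" using x P_mono[of m "Suc m", OF _ yj(2)] ideal_memI(5)[OF P_ideal] by simp
  then obtain q \<alpha> where q: "q \<in> P (m - c) \<cdot> Q" "q \<in> Q" "\<alpha> \<in> P (m - c)" "y = q \<oplus> \<alpha> \<otimes> g"
    using yj(1) AR_mem by blast
  note cs2 = Qc[OF q(2)] P_carr[OF q(3)]
  let ?y' = "q \<oplus> \<alpha> \<otimes> g'"
  have y': "?y' \<in> P (m - c) \<cdot> adjoin Q g'"
    unfolding prod_adjoin_iff[OF P_ideal Q g'c] using q by blast
  then have y'I: "?y' \<in> adjoin Q g'" using ideal_prod_inter[OF P_ideal I'] by blast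
  have eq: "x = ?y' \<oplus> (j \<ominus> \<alpha> \<otimes> \<epsilon>)" unfolding yj(3) q(4) using cs cs2 gc epsc by algebra
  have "\<alpha> \<otimes> \<epsilon> \<in> P (Suc m)" using ck by (intro P_mult[OF q(3) eps]) auto
  then have z: "j \<ominus> \<alpha> \<otimes> \<epsilon> \<in> P (Suc m)" using ideal_memI(5)[OF P_ideal yj(2)] by blast
  have "j \<ominus> \<alpha> \<otimes> \<epsilon> = x \<ominus> ?y'" unfolding eq using cs cs2 gc epsc by algebra
  then have "j \<ominus> \<alpha> \<otimes> \<epsilon> \<in> adjoin Q g'" using ideal_memI(5)[OF I' _ y'I] x by simp
  then show "x \<in> P (m - c) \<cdot> adjoin Q g' <+> (adjoin Q g' \<inter> P (Suc m))"
    unfolding mem_add_iff using eq y' z by blast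
qed

text \<open>The constant \<open>c\<close> survives because the initial ideals agree. The constant \<open>c'\<close> that the Artin-Rees
  lemma yields for the perturbed ideal may depend on \<open>\<epsilon>\<close>; it serves only to end the iteration of the
  preceding lemma far out, where \<open>p + c'\<close> already leaves order \<open>p\<close>.\<close>

lemma artin_rees_perturbed: "artin_rees J (adjoin Q g') c"
  unfolding artin_rees_def
proof
  fix p
  let ?M = "P (p - c) \<cdot> adjoin Q g'"
  have M: "ideal ?M R" using P_ideal I' by (rule ideal_prod_is_ideal)
  have IP: "ideal (adjoin Q g' \<inter> P n) R" for n using I' P_ideal by (rule i_intersect)
  have *: "adjoin Q g' \<inter> P p \<subseteq> ?M <+> (adjoin Q g' \<inter> P (p + d))" for d
  proof (induct d)
    case 0
    then show ?case using le_addR[OF M IP[of p]] by simp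
  next
    case (Suc d)
    have "P (p + d - c) \<cdot> adjoin Q g' \<subseteq> ?M" by (intro prod_mono pow_antimono J_ideal) auto
    then have "P (p + d - c) \<cdot> adjoin Q g' \<subseteq> ?M <+> (adjoin Q g' \<inter> P (p + Suc d))"
      using le_addL[OF M IP] by blast
    then have "P (p + d - c) \<cdot> adjoin Q g' <+> (adjoin Q g' \<inter> P (Suc (p + d)))
        \<subseteq> ?M <+> (adjoin Q g' \<inter> P (p + Suc d))"
      using le_addR[OF M IP] by (intro add_le add_ideals M IP) (simp_all only: add_Suc_right)
    then have "adjoin Q g' \<inter> P (p + d) \<subseteq> ?M <+> (adjoin Q g' \<inter> P (p + Suc d))"
      using artin_rees_step[of "p + d"] by blast
    then have "?M <+> (adjoin Q g' \<inter> P (p + d)) \<subseteq> ?M <+> (adjoin Q g' \<inter> P (p + Suc d))"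
      using le_addL[OF M IP] by (intro add_le add_ideals M IP)
    then show ?case using Suc by blast
  qed
  obtain c' where c': "artin_rees J (adjoin Q g') c'" using artin_rees_exists[OF J_ideal I'] by blast
  have "adjoin Q g' \<inter> P (p + c') \<subseteq> P (p + c' - c') \<cdot> adjoin Q g'"
    using c' unfolding artin_rees_def by blast
  also have "\<dots> \<subseteq> ?M" by (intro prod_mono pow_antimono J_ideal) auto
  finally have "?M <+> (adjoin Q g' \<inter> P (p + c')) \<subseteq> ?M" by (intro add_le M) auto
  then show "adjoin Q g' \<inter> P p \<subseteq> ?M" using *[of c'] by blast
qed

text \<open>If \<open>\<alpha> = \<beta> + j\<close> with \<open>\<beta> \<in> Q : g\<close> and \<open>j\<close> of order \<open>n\<close>, then \<open>j g\<close> equals \<open>- j \<epsilon>\<close> modulo \<open>Q\<close>, so Artin-Rees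
  lets \<open>j\<close> be replaced, modulo \<open>Q : g\<close>, by an element of order \<open>n + 1\<close>. So \<open>\<alpha>\<close> lies in \<open>(Q : g) + J\<^sup>n\<close> for all \<open>n\<close>,
  and Krull's theorem applies.\<close>

lemma colon_perturbed_le:
  assumes \<alpha>: "\<alpha> \<in> carrier R" "\<alpha> \<otimes> g' \<in> Q"
  shows "\<alpha> \<otimes> g \<in> Q"
proof -
  let ?C = "{\<beta> \<in> carrier R. \<beta> \<otimes> g \<in> Q}"
  have C: "ideal ?C R" using Q gc by (rule colon_ideal)
  have "\<alpha> \<in> ?C <+> P n" for n
  proof (induct n)
    case 0
    then show ?case using le_addR[OF C P_ideal[of 0]] \<alpha> by auto
  next
    case (Suc n)
    then obtain \<beta> j where \<beta>: "\<beta> \<in> carrier R" "\<beta> \<otimes> g \<in> Q" "j \<in> P n" "\<alpha> = \<beta> \<oplus> j"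
      unfolding mem_add_iff by blast
    note jc = P_carr[OF \<beta>(3)]
    have \<beta>g': "\<beta> \<otimes> g' \<in> Q"
      using ideal_memI(3)[OF Q \<beta>(2) eps_colon[OF \<beta>(1,2)]] \<beta>(1) by (simp add: r_distr)
    have "j \<otimes> g' = \<alpha> \<otimes> g' \<ominus> \<beta> \<otimes> g'" unfolding \<beta>(4) using \<beta>(1) jc g'c by algebra
    then have jg': "j \<otimes> g' \<in> Q" using ideal_memI(5)[OF Q \<alpha>(2) \<beta>g'] by simp
    have jec: "j \<otimes> \<epsilon> \<in> P (Suc n + c)" using ck by (intro P_mult[OF \<beta>(3) eps]) auto
    have "j \<otimes> \<epsilon> = j \<otimes> g' \<oplus> (\<ominus> j) \<otimes> g" using jc gc epsc by algebra
    then have "j \<otimes> \<epsilon> \<in> adjoin Q g" unfolding Iiff using jg' jc by blast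
    then obtain q \<delta> where q: "q \<in> Q" "\<delta> \<in> P (Suc n + c - c)" "j \<otimes> \<epsilon> = q \<oplus> \<delta> \<otimes> g"
      using AR_mem[OF _ jec] by metis
    note cs = Qc[OF q(1)] P_carr[OF q(2)]
    have "(j \<oplus> \<delta>) \<otimes> g = j \<otimes> g' \<ominus> j \<otimes> \<epsilon> \<oplus> \<delta> \<otimes> g" using jc gc epsc cs by algebra
    also have "\<dots> = j \<otimes> g' \<ominus> q" unfolding q(3) using jc cs gc epsc by algebra
    finally have "(j \<oplus> \<delta>) \<otimes> g \<in> Q" using ideal_memI(5)[OF Q jg' q(1)] by simp
    moreover have "(\<beta> \<oplus> (j \<oplus> \<delta>)) \<otimes> g = \<beta> \<otimes> g \<oplus> (j \<oplus> \<delta>) \<otimes> g" using \<beta>(1) jc gc cs by algebra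
    ultimately have "\<beta> \<oplus> (j \<oplus> \<delta>) \<in> ?C" using \<beta>(1,2) jc cs ideal_memI(3)[OF Q] by simp
    moreover have "\<ominus> \<delta> \<in> P (Suc n)" using ideal_memI(4)[OF P_ideal q(2)] by simp
    moreover have "\<alpha> = (\<beta> \<oplus> (j \<oplus> \<delta>)) \<oplus> \<ominus> \<delta>" unfolding \<beta>(4) using \<beta>(1) jc cs by algebra
    ultimately show ?case unfolding mem_add_iff by blast
  qed
  then have "\<alpha> \<in> ?C" using krull_intersection[OF J_ideal J_le_max C \<alpha>(1)] by blast
  then show ?thesis by simp
qed

end

section \<open>The first Koszul homology\<close>

context cring
begin

definition syz :: "'i set \<Rightarrow> ('i \<Rightarrow> 'a) \<Rightarrow> ('i \<Rightarrow> 'a) \<Rightarrow> bool"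
  where "syz S f a \<longleftrightarrow> a \<in> S \<rightarrow> carrier R \<and> lin S a f = \<zero>"

text \<open>The boundaries in degree one of the Koszul complex, spanned by the relations
  \<open>f\<^sub>j e\<^sub>i - f\<^sub>i e\<^sub>j\<close>; the alternating matrix \<open>W\<close> holds the coefficients.\<close>

definition koszul :: "'i set \<Rightarrow> ('i \<Rightarrow> 'a) \<Rightarrow> ('i \<Rightarrow> 'a) \<Rightarrow> bool"
  where "koszul S f b \<longleftrightarrow> (\<exists>W. (\<forall>i\<in>S. W i \<in> S \<rightarrow> carrier R) \<and> (\<forall>i\<in>S. W i i = \<zero>) \<and>
    (\<forall>i\<in>S. \<forall>j\<in>S. W j i = \<ominus> W i j) \<and> (\<forall>i\<in>S. b i = lin S (W i) f))"

definition vector_submodule :: "'i set \<Rightarrow> (('i \<Rightarrow> 'a) \<Rightarrow> bool) \<Rightarrow> bool"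
  where "vector_submodule S X \<longleftrightarrow> (\<forall>x. X x \<longrightarrow> x \<in> S \<rightarrow> carrier R) \<and> X (\<lambda>_. \<zero>) \<and>
    (\<forall>x y. X x \<longrightarrow> X y \<longrightarrow> X (\<lambda>j. x j \<oplus> y j)) \<and> (\<forall>r x. r \<in> carrier R \<longrightarrow> X x \<longrightarrow> X (\<lambda>j. r \<otimes> x j))"

lemma vector_submoduleD:
  assumes "vector_submodule S X"
  shows "X x \<Longrightarrow> j \<in> S \<Longrightarrow> x j \<in> carrier R" "X (\<lambda>_. \<zero>)" "X x \<Longrightarrow> X y \<Longrightarrow> X (\<lambda>j. x j \<oplus> y j)"
    "r \<in> carrier R \<Longrightarrow> X x \<Longrightarrow> X (\<lambda>j. r \<otimes> x j)"
  using assms unfolding vector_submodule_def by auto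

text \<open>Since the multipliers that carry \<open>z\<close> close to a submodule form an ideal, membership of a whole power
  of \<open>J\<close> can be tested on products.\<close>

lemma conductor_ideal:
  assumes X: "vector_submodule S X" and K: "ideal K R" and z: "z \<in> S \<rightarrow> carrier R"
  shows "ideal {e \<in> carrier R. \<exists>x. X x \<and> (\<forall>j\<in>S. e \<otimes> z j \<ominus> x j \<in> K)} R"
    (is "ideal ?E R")
proof (rule cring_idealI)
  note XD = vector_submoduleD[OF X]
  have zc: "j \<in> S \<Longrightarrow> z j \<in> carrier R" for j using z by auto
  show "\<zero> \<in> ?E"
    using XD(2) ideal_memI(1)[OF K] zc by (auto intro!: exI[of _ "\<lambda>_. \<zero>"] simp: minus_eq)
  fix a b assume "a \<in> ?E"
    "b \<in> ?E"
  then obtain x y where x: "a \<in> carrier R" "X x" "\<forall>j\<in>S. a \<otimes> z j \<ominus> x j \<in> K"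
    and y: "b \<in> carrier R" "X y" "\<forall>j\<in>S. b \<otimes> z j \<ominus> y j \<in> K" by blast
  have "(a \<oplus> b) \<otimes> z j \<ominus> (x j \<oplus> y j) \<in> K" if j: "j \<in> S" for j
  proof -
    have "(a \<oplus> b) \<otimes> z j \<ominus> (x j \<oplus> y j) = (a \<otimes> z j \<ominus> x j) \<oplus> (b \<otimes> z j \<ominus> y j)"
      using x(1) y(1) zc[OF j] XD(1)[OF x(2) j] XD(1)[OF y(2) j] by algebra
    then show ?thesis using x(3) y(3) j ideal_memI(3)[OF K] by simp
  qed
  then show "a \<oplus> b \<in> ?E"
    using x(1) y(1) XD(3)[OF x(2) y(2)] by (intro CollectI conjI exI[of _ "\<lambda>j. x j \<oplus> y j"]) auto
next
  note XD = vector_submoduleD[OF X]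
  fix a r assume "a \<in> ?E" and r: "r \<in> carrier R"
  then obtain x where x: "a \<in> carrier R" "X x" "\<forall>j\<in>S. a \<otimes> z j \<ominus> x j \<in> K" by blast
  have "(r \<otimes> a) \<otimes> z j \<ominus> r \<otimes> x j \<in> K" if j: "j \<in> S" for j
  proof -
    have "z j \<in> carrier R" using j z by auto
    then have "(r \<otimes> a) \<otimes> z j \<ominus> r \<otimes> x j = r \<otimes> (a \<otimes> z j \<ominus> x j)"
      using x(1) r XD(1)[OF x(2) j] by algebra
    then show ?thesis using x(3) j r ideal_memI(6)[OF K] by simp
  qed
  then show "r \<otimes> a \<in> ?E"
    using x(1) r XD(4)[OF r x(2)] by (intro CollectI conjI exI[of _ "\<lambda>j. r \<otimes> x j"]) auto
qed auto

lemma koszul_submodule: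
  assumes S: "finite S" and f: "f \<in> S \<rightarrow> carrier R"
  shows "vector_submodule S (koszul S f)"
  unfolding vector_submodule_def
proof (intro conjI allI impI)
  fix x assume "koszul S f x"
  then obtain W where "\<forall>i\<in>S. W i \<in> S \<rightarrow> carrier R" "\<forall>i\<in>S. x i = lin S (W i) f"
    unfolding koszul_def by blast
  then show "x \<in> S \<rightarrow> carrier R" using f by auto
next
  show "koszul S f (\<lambda>_. \<zero>)"
    unfolding koszul_def by (intro exI[of _ "\<lambda>_ _. \<zero>"]) (simp add: lin_zero f)
next
  fix x y assume "koszul S f x" "koszul S f y"
  then obtain V W where
    V: "\<forall>i\<in>S. V i \<in> S \<rightarrow> carrier R" "\<forall>i\<in>S. V i i = \<zero>" "\<forall>i\<in>S. \<forall>j\<in>S. V j i = \<ominus> V i j"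
      "\<forall>i\<in>S. x i = lin S (V i) f" and
    W: "\<forall>i\<in>S. W i \<in> S \<rightarrow> carrier R" "\<forall>i\<in>S. W i i = \<zero>" "\<forall>i\<in>S. \<forall>j\<in>S. W j i = \<ominus> W i j"
      "\<forall>i\<in>S. y i = lin S (W i) f"
    unfolding koszul_def by blast
  have anti: "V j i \<oplus> W j i = \<ominus> (V i j \<oplus> W i j)" if "i \<in> S" "j \<in> S" for i j
  proof -
    have "V i j \<in> carrier R" "W i j \<in> carrier R" using V(1) W(1) that by auto
    moreover have "V j i = \<ominus> V i j" "W j i = \<ominus> W i j" using V(3) W(3) that by blast+
    ultimately show ?thesis by (simp add: minus_add)
  qed
  show "koszul S f (\<lambda>j. x j \<oplus> y j)"
    unfolding koszul_def using V(1,2,4) W(1,2,4) f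
    by (intro exI[of _ "\<lambda>i j. V i j \<oplus> W i j"] conjI ballI anti) (simp_all add: lin_add Pi_iff)
next
  fix r x assume r: "r \<in> carrier R" and "koszul S f x"
  then obtain V where
    V: "\<forall>i\<in>S. V i \<in> S \<rightarrow> carrier R" "\<forall>i\<in>S. V i i = \<zero>" "\<forall>i\<in>S. \<forall>j\<in>S. V j i = \<ominus> V i j"
      "\<forall>i\<in>S. x i = lin S (V i) f"
    unfolding koszul_def by blast
  have anti: "r \<otimes> V j i = \<ominus> (r \<otimes> V i j)" if "i \<in> S" "j \<in> S" for i j
  proof -
    have "V i j \<in> carrier R" using V(1) that by auto
    moreover have "V j i = \<ominus> V i j" using V(3) that by blast
    ultimately show ?thesis using r by (simp add: r_minus)
  qed
  show "koszul S f (\<lambda>j. r \<otimes> x j)"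
    unfolding koszul_def using V(1,2,4) f r S
    by (intro exI[of _ "\<lambda>i j. r \<otimes> V i j"] conjI ballI anti) (simp_all add: lin_smult Pi_iff)
qed

text \<open>Adding a generator gives the exact sequence
  \<open>0 \<rightarrow> H\<^sub>1(S) / f\<^sub>i H\<^sub>1(S) \<rightarrow> H\<^sub>1(S \<union> {i}) \<rightarrow> (Q : f\<^sub>i) / Q \<rightarrow> 0\<close>, where \<open>Q\<close> is generated by the \<open>f\<^sub>j\<close> with \<open>j \<in> S\<close>.
  On boundaries it takes the following form, and the lemmas on torsion below read off its two outer
  terms and put them together again.\<close>

lemma koszul_insert:
  assumes S: "finite S" "i \<notin> S" and f: "f \<in> insert i S \<rightarrow> carrier R"
  shows "koszul (insert i S) f b \<longleftrightarrow> (\<exists>b0 c. koszul S f b0 \<and> c \<in> S \<rightarrow> carrier R \<and>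
    (\<forall>j\<in>S. b j = b0 j \<oplus> f i \<otimes> c j) \<and> b i = \<ominus> lin S c f)" (is "?L \<longleftrightarrow> ?R")
proof
  have fi: "f i \<in> carrier R" and fS: "f \<in> S \<rightarrow> carrier R" using f by auto
  assume ?L
  then obtain W where W: "\<forall>j\<in>insert i S. W j \<in> insert i S \<rightarrow> carrier R" "\<forall>j\<in>insert i S. W j j = \<zero>"
    "\<forall>j\<in>insert i S. \<forall>k\<in>insert i S. W k j = \<ominus> W j k" "\<forall>j\<in>insert i S. b j = lin (insert i S) (W j) f"
    unfolding koszul_def by blast
  have b: "b j = W j i \<otimes> f i \<oplus> lin S (W j) f" if "j \<in> insert i S" for j
    using W(1,4) that lin_insert[OF S _ f, of "W j"] by auto
  let ?b0 = "\<lambda>j. lin S (W j) f" and ?c = "\<lambda>j. W j i"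
  have cS: "?c \<in> S \<rightarrow> carrier R" using W(1) by auto
  have "\<forall>j\<in>S. W j \<in> S \<rightarrow> carrier R" using W(1) by auto
  then have "koszul S f ?b0"
    unfolding koszul_def using W(2,3) by (intro exI[of _ W] conjI) blast+
  moreover have "\<forall>j\<in>S. b j = ?b0 j \<oplus> f i \<otimes> ?c j"
  proof
    fix j assume j: "j \<in> S"
    then have "W j i \<in> carrier R" "lin S (W j) f \<in> carrier R" using W(1) fS by (auto intro!: lin_closed)
    then show "b j = ?b0 j \<oplus> f i \<otimes> ?c j" using b[of j] j fi by (simp add: a_comm m_comm)
  qed
  moreover have "b i = \<ominus> lin S ?c f"
  proof -
    have "lin S (W i) f = lin S (\<lambda>j. (\<ominus> \<one>) \<otimes> ?c j) f"
    proof (rule lin_cong)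
      fix j assume j: "j \<in> S"
      have "W i j = \<ominus> W j i" using W(3) j by blast
      then show "W i j = \<ominus> \<one> \<otimes> W j i" using cS j by (simp add: l_minus Pi_iff)
    qed (use cS fS in auto)
    also have "\<dots> = \<ominus> lin S ?c f" using S cS fS by (subst lin_smult) (auto simp: l_minus)
    finally show ?thesis using b[of i] W(2) fi lin_closed[OF cS fS] by simp
  qed
  ultimately show ?R using cS by (intro exI[of _ ?b0] exI[of _ ?c]) auto
next
  have fi: "f i \<in> carrier R" and fS: "f \<in> S \<rightarrow> carrier R" using f by auto
  assume ?R
  then obtain b0 c W where c: "c \<in> S \<rightarrow> carrier R" "\<forall>j\<in>S. b j = b0 j \<oplus> f i \<otimes> c j" "b i = \<ominus> lin S c f"
    and W: "\<forall>j\<in>S. W j \<in> S \<rightarrow> carrier R" "\<forall>j\<in>S. W j j = \<zero>"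
    "\<forall>j\<in>S. \<forall>k\<in>S. W k j = \<ominus> W j k" "\<forall>j\<in>S. b0 j = lin S (W j) f"
    unfolding koszul_def by blast
  define V where "V = (\<lambda>j k. if j = i then (if k = i then \<zero> else \<ominus> c k) else if k = i then c j else W j k)"
  have V1: "\<forall>j\<in>insert i S. V j \<in> insert i S \<rightarrow> carrier R" using W(1) c(1) by (auto simp: V_def Pi_iff)
  have V3: "\<forall>j\<in>insert i S. \<forall>k\<in>insert i S. V k j = \<ominus> V j k"
  proof (intro ballI)
    fix j k assume "j \<in> insert i S" "k \<in> insert i S"
    then show "V k j = \<ominus> V j k"
      using W(3)[rule_format, of j k] c(1) by (cases "j = i"; cases "k = i") (auto simp: V_def Pi_iff)
  qed
  have V4: "b j = lin (insert i S) (V j) f" if "j \<in> insert i S" for j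
  proof -
    have ex: "lin (insert i S) (V j) f = V j i \<otimes> f i \<oplus> lin S (V j) f"
      using V1 that by (intro lin_insert S f) auto
    show ?thesis
    proof (cases "j = i")
      case True
      have "lin S (V j) f = lin S (\<lambda>k. (\<ominus> \<one>) \<otimes> c k) f"
        using c(1) fS S(2) True by (intro lin_cong) (auto simp: V_def l_minus Pi_iff)
      also have "\<dots> = \<ominus> lin S c f" using S c(1) fS by (subst lin_smult) (auto simp: l_minus)
      finally show ?thesis using ex True c(3) fi lin_closed[OF c(1) fS] by (simp add: V_def)
    next
      case False
      then have j: "j \<in> S" using that by simp
      have "lin S (V j) f = lin S (W j) f"
        using W(1) j fS S(2) False by (intro lin_cong) (auto simp: V_def)
      moreover have "c j \<in> carrier R" "lin S (W j) f \<in> carrier R" using c(1) j W(1) fS by (auto intro!: lin_closed)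
      ultimately show ?thesis using ex j False c(2) W(4) fi by (simp add: V_def a_comm m_comm)
    qed
  qed
  have "\<forall>j\<in>insert i S. V j j = \<zero>" using W(2) by (simp add: V_def)
  then show ?L unfolding koszul_def
    using V1 V3 V4 by (intro exI[of _ V] conjI ballI) blast+
qed

lemma lspan_insert:
  assumes S: "finite S" "i \<notin> S" and f: "f \<in> insert i S \<rightarrow> carrier R"
  shows "lspan (insert i S) f = adjoin (lspan S f) (f i)"
proof -
  have fi: "f i \<in> carrier R" and fS: "f \<in> S \<rightarrow> carrier R" using f by auto
  show ?thesis
  proof (rule equalityI; rule subsetI)
    fix x assume "x \<in> lspan (insert i S) f"
    then obtain a where a: "a \<in> insert i S \<rightarrow> carrier R" "x = lin (insert i S) a f" by (auto simp: lspan_def)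
    then have "x = lin S a f \<oplus> a i \<otimes> f i" using lin_insert[OF S a(1) f] fi fS by (simp add: a_comm Pi_iff)
    moreover have "lin S a f \<in> lspan S f" using a(1) by (intro lspanI) auto
    ultimately show "x \<in> adjoin (lspan S f) (f i)"
      unfolding adjoin_iff[OF lspan_ideal[OF S(1) fS] fi] using a(1) by blast
  next
    fix x assume "x \<in> adjoin (lspan S f) (f i)"
    then obtain u \<alpha> where u: "u \<in> S \<rightarrow> carrier R" "\<alpha> \<in> carrier R" "x = lin S u f \<oplus> \<alpha> \<otimes> f i"
      unfolding adjoin_iff[OF lspan_ideal[OF S(1) fS] fi] by (auto simp: lspan_def)
    let ?a = "\<lambda>j. if j = i then \<alpha> else u j"
    have ac: "?a \<in> insert i S \<rightarrow> carrier R" using u by auto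
    have "lin S ?a f = lin S u f" using u(1) fS S(2) by (intro lin_cong) auto
    then have "lin (insert i S) ?a f = x"
      using lin_insert[OF S ac f] u fi lin_closed[OF u(1) fS] by (simp add: a_comm)
    then show "x \<in> lspan (insert i S) f" using lspanI[OF ac, of f] by simp
  qed
qed


lemma lspan_cong:
  assumes "\<And>a. a \<in> S \<rightarrow> carrier R \<Longrightarrow> lin S a f = lin S a h"
  shows "lspan S f = lspan S h"
  unfolding lspan_def by (rule Collect_cong) (metis assms)

lemma koszul_cong: "(\<And>j. j \<in> S \<Longrightarrow> f j = h j) \<Longrightarrow> h \<in> S \<rightarrow> carrier R \<Longrightarrow> koszul S f b \<longleftrightarrow> koszul S h b"
proof -
  assume fh: "\<And>j. j \<in> S \<Longrightarrow> f j = h j" and h: "h \<in> S \<rightarrow> carrier R"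
  have "lin S a f = lin S a h" if "a \<in> S \<rightarrow> carrier R" for a
    using that h fh by (intro lin_cong) auto
  then have eq: "(b i = lin S (W i) f) = (b i = lin S (W i) h)"
    if "\<forall>i\<in>S. W i \<in> S \<rightarrow> carrier R" "i \<in> S" for W i using that by metis
  show ?thesis unfolding koszul_def
    by (intro ex_cong1 conj_cong ball_cong refl) (rule eq; assumption)
qed

text \<open>The ideal \<open>J\<^sup>t\<close> annihilates the homology (syzygies modulo boundaries), but with the boundaries replaced
  by their \<open>J\<close>-adic closure. Over a Noetherian local ring the closure adds nothing, but in this form
  the Artin-Rees lemma and Krull's theorem are only ever applied to ideals.\<close>

definition koszul_torsion :: "'a set \<Rightarrow> nat \<Rightarrow> 'i set \<Rightarrow> ('i \<Rightarrow> 'a) \<Rightarrow> bool"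
  where "koszul_torsion J t S f \<longleftrightarrow> (\<forall>a y n. syz S f a \<longrightarrow> y \<in> ideal_pow R J t \<longrightarrow>
    (\<exists>b. koszul S f b \<and> (\<forall>j\<in>S. y \<otimes> a j \<ominus> b j \<in> ideal_pow R J n)))"

text \<open>The submodule \<open>B + g Z\<close> of boundaries and \<open>g\<close>-multiples of syzygies.\<close>

definition koszul_mult :: "'i set \<Rightarrow> ('i \<Rightarrow> 'a) \<Rightarrow> 'a \<Rightarrow> ('i \<Rightarrow> 'a) \<Rightarrow> bool"
  where "koszul_mult S f g x \<longleftrightarrow> x \<in> S \<rightarrow> carrier R \<and>
    (\<exists>b c. koszul S f b \<and> syz S f c \<and> (\<forall>j\<in>S. x j = b j \<oplus> g \<otimes> c j))"

text \<open>This says that \<open>J\<^sup>t\<close> annihilates \<open>H\<^sub>1 / g H\<^sub>1\<close>, again up to closure.\<close>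

definition syz_torsion :: "'a set \<Rightarrow> nat \<Rightarrow> 'i set \<Rightarrow> ('i \<Rightarrow> 'a) \<Rightarrow> 'a \<Rightarrow> bool"
  where "syz_torsion J t S f g \<longleftrightarrow> (\<forall>z y n. syz S f z \<longrightarrow> y \<in> ideal_pow R J t \<longrightarrow>
    (\<exists>x. koszul_mult S f g x \<and> (\<forall>j\<in>S. y \<otimes> z j \<ominus> x j \<in> ideal_pow R J n)))"

lemma syz_submodule:
  assumes "finite S" "f \<in> S \<rightarrow> carrier R"
  shows "vector_submodule S (syz S f)"
  unfolding vector_submodule_def syz_def using assms
  by (auto simp: lin_zero lin_add lin_smult)

lemma koszul_mult_submodule:
  assumes S: "finite S" and f: "f \<in> S \<rightarrow> carrier R" and g: "g \<in> carrier R"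
  shows "vector_submodule S (koszul_mult S f g)"
  unfolding vector_submodule_def
proof (intro conjI allI impI)
  note K = vector_submoduleD[OF koszul_submodule[OF S f]] and Z = vector_submoduleD[OF syz_submodule[OF S f]]
  show "koszul_mult S f g (\<lambda>_. \<zero>)"
    unfolding koszul_mult_def using K(2) Z(2) g by (intro conjI exI[of _ "\<lambda>_. \<zero>"]) auto
  show "x \<in> S \<rightarrow> carrier R" if "koszul_mult S f g x" for x using that by (simp add: koszul_mult_def)
  fix x assume "koszul_mult S f g x"
  then obtain b c where x: "x \<in> S \<rightarrow> carrier R" "koszul S f b" "syz S f c" "\<forall>j\<in>S. x j = b j \<oplus> g \<otimes> c j"
    unfolding koszul_mult_def by blast
  {
    fix y assume "koszul_mult S f g y"
    then obtain b' c' where y: "y \<in> S \<rightarrow> carrier R" "koszul S f b'" "syz S f c'" "\<forall>j\<in>S. y j = b' j \<oplus> g \<otimes> c' j"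
      unfolding koszul_mult_def by blast
    have "x j \<oplus> y j = (b j \<oplus> b' j) \<oplus> g \<otimes> (c j \<oplus> c' j)" if j: "j \<in> S" for j
      using x(4) y(4) j K(1)[OF x(2) j] K(1)[OF y(2) j] Z(1)[OF x(3) j] Z(1)[OF y(3) j] g
      by (simp add: r_distr a_ac)
    then show "koszul_mult S f g (\<lambda>j. x j \<oplus> y j)"
      unfolding koszul_mult_def using K(3)[OF x(2) y(2)] Z(3)[OF x(3) y(3)] x(1) y(1)
      by (intro conjI exI[of _ "\<lambda>j. b j \<oplus> b' j"] exI[of _ "\<lambda>j. c j \<oplus> c' j"]) auto
  }
  fix r assume r: "r \<in> carrier R"
  have "r \<otimes> x j = r \<otimes> b j \<oplus> g \<otimes> (r \<otimes> c j)" if j: "j \<in> S" for j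
    using x(4) j K(1)[OF x(2) j] Z(1)[OF x(3) j] g r by (simp add: r_distr m_ac)
  then show "koszul_mult S f g (\<lambda>j. r \<otimes> x j)"
    unfolding koszul_mult_def using K(4)[OF r x(2)] Z(4)[OF r x(3)] x(1) r
    by (intro conjI exI[of _ "\<lambda>j. r \<otimes> b j"] exI[of _ "\<lambda>j. r \<otimes> c j"]) auto
qed

end

locale koszul_insert = local_ring_with_ideal R J for R (structure) and J +
  fixes S :: "'i set" and i :: 'i and f :: "'i \<Rightarrow> 'a"
  assumes S: "finite S" "i \<notin> S" and f: "f \<in> insert i S \<rightarrow> carrier R"
begin

lemma fi [simp, intro]: "f i \<in> carrier R" and fS: "f \<in> S \<rightarrow> carrier R"
  using f by auto

lemmas Kos = vector_submoduleD[OF koszul_submodule[OF S(1) fS]]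
lemmas Syz = vector_submoduleD[OF syz_submodule[OF S(1) fS]]

lemma Q_ideal: "ideal (lspan S f) R" using S(1) fS by (rule lspan_ideal)

lemma torsion_imp_colon:
  assumes tor: "koszul_torsion J t (insert i S) f" and \<alpha>: "\<alpha> \<in> carrier R" "\<alpha> \<otimes> f i \<in> lspan S f"
    and y: "y \<in> P t"
  shows "y \<otimes> \<alpha> \<in> lspan S f"
proof (rule krull_intersection[OF J_ideal J_le_max Q_ideal])
  note yc = P_carr[OF y]
  show "y \<otimes> \<alpha> \<in> carrier R" using yc \<alpha> by simp
  fix n
  obtain u where u: "u \<in> S \<rightarrow> carrier R" "\<alpha> \<otimes> f i = lin S u f" using \<alpha>(2) by (auto simp: lspan_def)
  let ?a = "\<lambda>j. if j = i then \<alpha> else (\<ominus> \<one>) \<otimes> u j"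
  have ac: "?a \<in> insert i S \<rightarrow> carrier R" using u \<alpha> by (auto simp: Pi_iff)
  have "lin S ?a f = lin S (\<lambda>j. (\<ominus> \<one>) \<otimes> u j) f"
    using u S(2) fS by (intro lin_cong) (auto simp: Pi_iff)
  also have "\<dots> = \<ominus> lin S u f" using u S fS by (subst lin_smult) (auto simp: l_minus)
  finally have "lin (insert i S) ?a f = \<zero>"
    using lin_insert[OF S ac f] u(2) lin_closed[OF u(1) fS] by (simp add: r_neg)
  then have "syz (insert i S) f ?a" using ac by (simp add: syz_def)
  then obtain b where b: "koszul (insert i S) f b" "\<forall>j\<in>insert i S. y \<otimes> ?a j \<ominus> b j \<in> P n"
    using tor y unfolding koszul_torsion_def by blast
  then obtain c where c: "c \<in> S \<rightarrow> carrier R" "b i = \<ominus> lin S c f"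
    unfolding koszul_insert[OF S f] by blast
  have bQ: "b i \<in> lspan S f" unfolding c(2) using c(1) by (intro ideal_memI(4)[OF Q_ideal] lspanI)
  have "y \<otimes> \<alpha> \<ominus> b i \<in> P n" using b(2) by simp
  moreover have "y \<otimes> \<alpha> = b i \<oplus> (y \<otimes> \<alpha> \<ominus> b i)"
    using yc \<alpha>(1) ideal_memI(2)[OF Q_ideal bQ] by algebra
  ultimately show "y \<otimes> \<alpha> \<in> lspan S f <+> P n" unfolding mem_add_iff using bQ by blast
qed

text \<open>A syzygy \<open>z\<close> of the \<open>f\<^sub>j\<close> with \<open>j \<in> S\<close>, extended by zero, is multiplied close to a boundary whose entry at \<open>i\<close>
  is therefore small but perhaps not zero. Artin-Rees for \<open>Q\<close> corrects the vector \<open>c\<close> by a small amount to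
  an honest syzygy.\<close>

lemma torsion_imp_syz_torsion:
  assumes tor: "koszul_torsion J t (insert i S) f"
  shows "syz_torsion J t S f (f i)"
  unfolding syz_torsion_def
proof (intro allI impI)
  fix z y n assume z: "syz S f z" and y: "y \<in> P t"
  note yc = P_carr[OF y]
  obtain cQ where cQ: "artin_rees J (lspan S f) cQ" using artin_rees_exists[OF J_ideal Q_ideal] by blast
  let ?a = "\<lambda>j. if j = i then \<zero> else z j"
  have zc: "z \<in> S \<rightarrow> carrier R" using z by (simp add: syz_def)
  then have ac: "?a \<in> insert i S \<rightarrow> carrier R" by auto
  have "lin S ?a f = lin S z f" using zc S(2) fS by (intro lin_cong) auto
  then have "syz (insert i S) f ?a"
    using z ac lin_insert[OF S ac f] by (simp add: syz_def)
  then obtain b where b: "koszul (insert i S) f b" "\<forall>j\<in>insert i S. y \<otimes> ?a j \<ominus> b j \<in> P (n + cQ)"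
    using tor y unfolding koszul_torsion_def by blast
  then obtain b0 c where c: "koszul S f b0" "c \<in> S \<rightarrow> carrier R" "\<forall>j\<in>S. b j = b0 j \<oplus> f i \<otimes> c j"
    "b i = \<ominus> lin S c f"
    unfolding koszul_insert[OF S f] by blast
  have lc: "lin S c f \<in> carrier R" using c(2) fS by simp
  have "y \<otimes> \<zero> \<ominus> b i = lin S c f" unfolding c(4) using yc lc by algebra
  moreover have "y \<otimes> \<zero> \<ominus> b i \<in> P (n + cQ)" using bspec[OF b(2) insertI1] by (simp only: refl if_True)
  ultimately have "lin S c f \<in> P (n + cQ)" by simp
  then have "lin S c f \<in> P (n + cQ - cQ) \<cdot> lspan S f"
    using cQ lspanI[OF c(2), of f] unfolding artin_rees_def by blast
  then obtain e where e: "e \<in> S \<rightarrow> P n" "lin S c f = lin S e f"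
    unfolding prod_lspan[OF S(1) fS P_ideal] by auto
  have ec: "e \<in> S \<rightarrow> carrier R" using e P_carr by auto
  let ?c = "\<lambda>j. c j \<ominus> e j"
  have "lin S ?c f = lin S c f \<ominus> lin S e f" using S(1) c(2) ec fS by (rule lin_minus)
  also have "\<dots> = \<zero>" unfolding e(2)[symmetric] using lc by algebra
  finally have s: "syz S f ?c"
    unfolding syz_def using c(2) ec by (auto simp: Pi_iff)
  show "\<exists>x. koszul_mult S f (f i) x \<and> (\<forall>j\<in>S. y \<otimes> z j \<ominus> x j \<in> P n)"
  proof (intro exI[of _ "\<lambda>j. b0 j \<oplus> f i \<otimes> ?c j"] conjI ballI)
    show "koszul_mult S f (f i) (\<lambda>j. b0 j \<oplus> f i \<otimes> ?c j)"
      unfolding koszul_mult_def using c(1) s Kos(1)[OF c(1)] Syz(1)[OF s] fi by blast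
    fix j assume j: "j \<in> S"
    have cs: "z j \<in> carrier R" "c j \<in> carrier R" "e j \<in> carrier R" "b0 j \<in> carrier R"
      using j zc c(2) ec Kos(1)[OF c(1)] by auto
    have "j \<noteq> i" using j S(2) by auto
    then have "y \<otimes> z j \<ominus> b j \<in> P (n + cQ)" using bspec[OF b(2) insertI2[OF j]] by (simp only: if_False)
    then have "y \<otimes> z j \<ominus> b j \<in> P n" using P_mono[of n "n + cQ"] by simp
    moreover have "f i \<otimes> e j \<in> P n" using ideal_memI(6)[OF P_ideal funcset_mem[OF e(1) j] fi] .
    moreover have "y \<otimes> z j \<ominus> (b0 j \<oplus> f i \<otimes> ?c j) = (y \<otimes> z j \<ominus> b j) \<oplus> f i \<otimes> e j"
      using c(3) j cs fi yc by (simp add: minus_eq minus_add r_distr r_minus a_ac)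
    ultimately show "y \<otimes> z j \<ominus> (b0 j \<oplus> f i \<otimes> ?c j) \<in> P n" using ideal_memI(3)[OF P_ideal] by simp
  qed
qed

text \<open>Nakayama's lemma in the form of an approximation: \<open>J\<^sup>t Z \<subseteq> B + g Z\<close> and \<open>\<epsilon> \<in> J\<^sup>t J\<close> give
  \<open>\<epsilon> Z \<subseteq> B + (g + \<epsilon>) Z\<close> up to an error that gains one factor \<open>J\<close> in every round.\<close>

lemma syz_torsion_perturbed:
  assumes tor: "syz_torsion J t S f g" and g: "g \<in> carrier R" and eps: "\<epsilon> \<in> P (Suc t)"
  shows "syz_torsion J t S f (g \<oplus> \<epsilon>)"
proof -
  have ec: "\<epsilon> \<in> carrier R" using P_carr[OF eps] .
  let ?X = "koszul_mult S f (g \<oplus> \<epsilon>)"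
  have X: "vector_submodule S ?X" using g ec by (intro koszul_mult_submodule S fS) auto
  note XD = vector_submoduleD[OF X]
  have "\<exists>x. ?X x \<and> (\<forall>j\<in>S. y \<otimes> z j \<ominus> x j \<in> P n)" if "syz S f z" "y \<in> P t" for z y n
    using that
  proof (induct n arbitrary: z y)
    case 0
    then show ?case using XD(2) Syz(1)[OF 0(1)] P_carr[OF 0(2)] by (intro exI[of _ "\<lambda>_. \<zero>"]) auto
  next
    case (Suc n)
    note yc = P_carr[OF Suc(3)]
    obtain w where w: "koszul_mult S f g w" "\<forall>j\<in>S. y \<otimes> z j \<ominus> w j \<in> P (Suc n)"
      using tor Suc(2,3) unfolding syz_torsion_def by blast
    then obtain b c where bc: "koszul S f b" "syz S f c" "\<forall>j\<in>S. w j = b j \<oplus> g \<otimes> c j"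
      unfolding koszul_mult_def by blast
    let ?E = "{e \<in> carrier R. \<exists>x. ?X x \<and> (\<forall>j\<in>S. e \<otimes> c j \<ominus> x j \<in> P (Suc n))}"
    have cc: "c \<in> S \<rightarrow> carrier R" using bc(2) by (simp add: syz_def)
    have E: "ideal ?E R" using X P_ideal cc by (rule conductor_ideal)
    have "P t \<cdot> J \<subseteq> ?E"
    proof (rule prod_le[OF E])
      fix v \<eta> assume v: "v \<in> P t" and \<eta>: "\<eta> \<in> J"
      obtain x where x: "?X x" "\<forall>j\<in>S. v \<otimes> c j \<ominus> x j \<in> P n" using Suc(1)[OF bc(2) v] by blast
      have vc: "v \<in> carrier R" "\<eta> \<in> carrier R" using P_carr[OF v] ideal_memI(2)[OF J_ideal \<eta>] .
      have "(v \<otimes> \<eta>) \<otimes> c j \<ominus> \<eta> \<otimes> x j \<in> P (Suc n)" if j: "j \<in> S" for j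
      proof -
        have "(v \<otimes> \<eta>) \<otimes> c j \<ominus> \<eta> \<otimes> x j = (v \<otimes> c j \<ominus> x j) \<otimes> \<eta>"
          using vc XD(1)[OF x(1) j] Syz(1)[OF bc(2) j] by algebra
        also have "\<dots> \<in> P n \<cdot> J" using x(2) j \<eta> by (intro ideal_prod.prod) auto
        finally show ?thesis by (simp only: pow_Suc)
      qed
      then show "v \<otimes> \<eta> \<in> ?E" using vc XD(4)[OF vc(2) x(1)] by blast
    qed
    then have "\<epsilon> \<in> ?E" using eps unfolding pow_Suc by blast
    then obtain x where x: "?X x" "\<forall>j\<in>S. \<epsilon> \<otimes> c j \<ominus> x j \<in> P (Suc n)" by blast
    let ?u = "\<lambda>j. (b j \<oplus> (g \<oplus> \<epsilon>) \<otimes> c j) \<oplus> (\<ominus> \<one>) \<otimes> x j"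
    have "?X (\<lambda>j. b j \<oplus> (g \<oplus> \<epsilon>) \<otimes> c j)"
      unfolding koszul_mult_def using bc(1,2) Kos(1)[OF bc(1)] Syz(1)[OF bc(2)] g ec by blast
    then have "?X ?u" using XD(3) XD(4)[OF _ x(1), of "\<ominus> \<one>"] by simp
    moreover have "y \<otimes> z j \<ominus> ?u j \<in> P (Suc n)" if j: "j \<in> S" for j
    proof -
      have cs: "z j \<in> carrier R" "b j \<in> carrier R" "c j \<in> carrier R" "x j \<in> carrier R"
        using j Syz(1)[OF Suc(2)] Kos(1)[OF bc(1)] Syz(1)[OF bc(2)] XD(1)[OF x(1)] by auto
      have eq: "y \<otimes> z j \<ominus> ?u j = (y \<otimes> z j \<ominus> (b j \<oplus> g \<otimes> c j)) \<ominus> (\<epsilon> \<otimes> c j \<ominus> x j)"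
        using cs g ec yc by algebra
      have "y \<otimes> z j \<ominus> (b j \<oplus> g \<otimes> c j) \<in> P (Suc n)" using bspec[OF w(2) j] bspec[OF bc(3) j] by (simp only:)
      then show ?thesis unfolding eq using bspec[OF x(2) j] by (rule ideal_memI(5)[OF P_ideal])
    qed
    ultimately show ?case by blast
  qed
  then show ?thesis unfolding syz_torsion_def by blast
qed

text \<open>If \<open>y\<^sub>2 a\<^sub>i = \<Sum> u\<^sub>j f\<^sub>j\<close>, then subtracting a boundary from \<open>y\<^sub>2 a\<close> clears the entry at \<open>i\<close> and leaves a syzygy
  \<open>z\<close> of the remaining generators.\<close>

lemma torsion_insert:
  assumes tor: "syz_torsion J t1 S f (f i)"
    and colon: "\<And>\<alpha> y. \<lbrakk>\<alpha> \<in> carrier R; \<alpha> \<otimes> f i \<in> lspan S f; y \<in> P t2\<rbrakk> \<Longrightarrow> y \<otimes> \<alpha> \<in> lspan S f"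
  shows "koszul_torsion J (t1 + t2) (insert i S) f"
  unfolding koszul_torsion_def
proof (intro allI impI)
  fix a y n assume a: "syz (insert i S) f a" and y: "y \<in> P (t1 + t2)"
  have ac: "a \<in> insert i S \<rightarrow> carrier R" "lin (insert i S) a f = \<zero>" using a by (auto simp: syz_def)
  then have aS: "a \<in> S \<rightarrow> carrier R" and ai: "a i \<in> carrier R" by auto
  have rel: "a i \<otimes> f i \<oplus> lin S a f = \<zero>" using lin_insert[OF S ac(1) f] ac(2) by simp
  have la: "lin S a f \<in> carrier R" using aS fS by simp
  have "a i \<otimes> f i = (a i \<otimes> f i \<oplus> lin S a f) \<ominus> lin S a f" using ai fi la by algebra
  also have "\<dots> = \<ominus> lin S a f" unfolding rel using la by algebra
  finally have colon_ai: "a i \<otimes> f i \<in> lspan S f" using lspanI[OF aS] ideal_memI(4)[OF Q_ideal] by simp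
  let ?X = "koszul (insert i S) f"
  let ?E = "{e \<in> carrier R. \<exists>x. ?X x \<and> (\<forall>j\<in>insert i S. e \<otimes> a j \<ominus> x j \<in> P n)}"
  have E: "ideal ?E R" using S f P_ideal ac by (intro conductor_ideal koszul_submodule) auto
  have "P t1 \<cdot> P t2 \<subseteq> ?E"
  proof (rule prod_le[OF E])
    fix y1 y2 assume y1: "y1 \<in> P t1" and y2: "y2 \<in> P t2"
    note yc = P_carr[OF y1] P_carr[OF y2]
    obtain u where u: "u \<in> S \<rightarrow> carrier R" "y2 \<otimes> a i = lin S u f"
      using colon[OF ai colon_ai y2] by (auto simp: lspan_def)
    have lu: "lin S u f \<in> carrier R" using u(1) fS by simp
    let ?z = "\<lambda>j. y2 \<otimes> a j \<oplus> f i \<otimes> u j"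
    have "lin S ?z f = y2 \<otimes> lin S a f \<oplus> f i \<otimes> lin S u f"
      using S(1) yc aS u(1) fS fi by (subst lin_add) (auto simp: lin_smult Pi_iff)
    also have "\<dots> = y2 \<otimes> (a i \<otimes> f i \<oplus> lin S a f)"
      unfolding u(2)[symmetric] using yc la ai fi by algebra
    also have "\<dots> = \<zero>" unfolding rel using yc by simp
    finally have z: "syz S f ?z" using yc aS u(1) fi by (auto simp: syz_def Pi_iff)
    obtain x where "koszul_mult S f (f i) x" "\<forall>j\<in>S. y1 \<otimes> ?z j \<ominus> x j \<in> P n"
      using tor z y1 unfolding syz_torsion_def by blast
    then obtain b c where bc: "koszul S f b" "syz S f c" "\<forall>j\<in>S. y1 \<otimes> ?z j \<ominus> (b j \<oplus> f i \<otimes> c j) \<in> P n"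
      unfolding koszul_mult_def by metis
    have cc: "c \<in> S \<rightarrow> carrier R" "lin S c f = \<zero>" using bc(2) by (auto simp: syz_def)
    let ?d = "\<lambda>j. c j \<ominus> y1 \<otimes> u j"
    let ?b = "\<lambda>j. if j = i then \<ominus> lin S ?d f else b j \<oplus> f i \<otimes> ?d j"
    have dc: "?d \<in> S \<rightarrow> carrier R" using cc u(1) yc by (auto simp: Pi_iff)
    have "?X ?b"
      unfolding koszul_insert[OF S f] using bc(1) dc S(2) by (intro exI[of _ b] exI[of _ ?d]) auto
    moreover have "(y1 \<otimes> y2) \<otimes> a j \<ominus> ?b j \<in> P n" if j: "j \<in> insert i S" for j
    proof (cases "j = i")
      case True
      have yu: "(\<lambda>j. y1 \<otimes> u j) \<in> S \<rightarrow> carrier R" using u(1) yc by auto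
      have "lin S ?d f = lin S c f \<ominus> y1 \<otimes> lin S u f"
        using lin_minus[OF S(1) cc(1) yu fS] lin_smult[OF S(1) yc(1) u(1) fS] by simp
      then have "\<ominus> lin S ?d f = y1 \<otimes> (y2 \<otimes> a i)"
        unfolding cc(2) u(2) using yc lu by (simp add: minus_eq)
      then have "(y1 \<otimes> y2) \<otimes> a j \<ominus> ?b j = \<zero>"
        using True yc ai by (simp add: m_assoc minus_eq r_neg)
      then show ?thesis using ideal_memI(1)[OF P_ideal] by simp
    next
      case False
      then have j: "j \<in> S" using that by simp
      have cs: "a j \<in> carrier R" "u j \<in> carrier R" "b j \<in> carrier R" "c j \<in> carrier R"
        using j aS u(1) Kos(1)[OF bc(1)] cc(1) by auto
      have "(y1 \<otimes> y2) \<otimes> a j \<ominus> (b j \<oplus> f i \<otimes> ?d j) = y1 \<otimes> ?z j \<ominus> (b j \<oplus> f i \<otimes> c j)"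
        using cs yc fi by algebra
      then show ?thesis using bc(3) j False by simp
    qed
    ultimately show "y1 \<otimes> y2 \<in> ?E" using yc by blast
  qed
  then have "y \<in> ?E" using y unfolding pow_add[OF J_ideal] by blast
  then show "\<exists>b. ?X b \<and> (\<forall>j\<in>insert i S. y \<otimes> a j \<ominus> b j \<in> P n)" by blast
qed

lemma perturb_one:
  assumes AR: "artin_rees J (lspan (insert i S) f) c"
    and tor: "koszul_torsion J t (insert i S) f"
    and eps: "\<epsilon> \<in> P k" and ck: "c < k" and tk: "t < k"
  defines "f' \<equiv> f(i := f i \<oplus> \<epsilon>)"
  shows "same_initial J (lspan (insert i S) f) (lspan (insert i S) f')"
    and "artin_rees J (lspan (insert i S) f') c"
    and "koszul_torsion J (2 * t) (insert i S) f'"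
proof -
  note I = lspan_insert[OF S f]
  interpret pert: one_perturbation R J "lspan S f" "f i" \<epsilon> c t k
  proof (rule one_perturbation.intro[OF local_ring_with_ideal_axioms], rule one_perturbation_axioms.intro)
    show "artin_rees J (adjoin (lspan S f) (f i)) c" using AR unfolding I .
    show "y \<otimes> \<alpha> \<in> lspan S f" if "\<alpha> \<in> carrier R" "\<alpha> \<otimes> f i \<in> lspan S f" "y \<in> P t" for \<alpha> y
      using torsion_imp_colon[OF tor that] .
  qed (rule Q_ideal fi eps ck less_imp_le[OF tk])+
  have f': "f' \<in> insert i S \<rightarrow> carrier R" using f by (auto simp: f'_def)
  have eq: "f' j = f j" if "j \<in> S" for j using that S(2) by (auto simp: f'_def)
  have lineq: "lin S a f' = lin S a f" if "a \<in> S \<rightarrow> carrier R" for a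
    using that eq fS by (intro lin_cong) auto
  then have Q': "lspan S f' = lspan S f" by (rule lspan_cong)
  have f'i: "f' i = f i \<oplus> \<epsilon>" by (simp add: f'_def)
  have I': "lspan (insert i S) f' = adjoin (lspan S f) (f i \<oplus> \<epsilon>)"
    using lspan_insert[OF S f'] Q' f'i by simp
  show "same_initial J (lspan (insert i S) f) (lspan (insert i S) f')"
    unfolding I I' by (rule pert.same_initial_adjoin)
  show "artin_rees J (lspan (insert i S) f') c"
    unfolding I' by (rule pert.artin_rees_perturbed)
  interpret f': koszul_insert R J S i f' by unfold_locales (use S f' in auto)
  have "syz_torsion J t S f (f i \<oplus> \<epsilon>)"
    using syz_torsion_perturbed[OF torsion_imp_syz_torsion[OF tor]] P_mono[OF _ eps, of "Suc t"] tk by simp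
  moreover have "syz S f' a \<longleftrightarrow> syz S f a" for a unfolding syz_def using lineq by auto
  moreover have "koszul S f' b \<longleftrightarrow> koszul S f b" for b using eq fS by (rule koszul_cong)
  ultimately have "syz_torsion J t S f' (f' i)"
    unfolding syz_torsion_def koszul_mult_def f'i by simp
  then have "koszul_torsion J (t + t) (insert i S) f'"
  proof (rule f'.torsion_insert)
    fix \<alpha> y assume "\<alpha> \<in> carrier R" "\<alpha> \<otimes> f' i \<in> lspan S f'" "y \<in> P t"
    then show "y \<otimes> \<alpha> \<in> lspan S f'"
      unfolding Q' f'i using pert.colon_perturbed_le pert.colon by blast
  qed
  then show "koszul_torsion J (2 * t) (insert i S) f'" by (simp add: mult_2)
qed

end

section \<open>Perturbing all generators\<close>

context local_ring_with_ideal
begin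

text \<open>Each step keeps \<open>c\<close> and doubles \<open>t\<close>, whatever the perturbation, so one power of \<open>J\<close> suffices for all
  \<open>r\<close> steps.\<close>

lemma perturb_all:
  fixes f e :: "nat \<Rightarrow> 'a"
  assumes f: "f \<in> {..<r} \<rightarrow> carrier R" and AR: "artin_rees J (lspan {..<r} f) c"
    and tor: "koszul_torsion J t {..<r} f"
    and e: "e \<in> {..<r} \<rightarrow> P (Suc (c + 2 ^ r * t))"
  shows "same_initial J (lspan {..<r} f) (lspan {..<r} (\<lambda>j. f j \<oplus> e j))"
proof -
  define h where "h m = (\<lambda>j. if j < m then f j \<oplus> e j else f j)" for m
  have ec: "e j \<in> carrier R" if "j < r" for j
    by (rule P_carr[OF funcset_mem[OF e]]) (use that in simp)
  have "same_initial J (lspan {..<r} f) (lspan {..<r} (h m)) \<and> artin_rees J (lspan {..<r} (h m)) c \<and>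
      koszul_torsion J (2 ^ m * t) {..<r} (h m)" if "m \<le> r" for m
    using that
  proof (induct m)
    case 0
    then show ?case using AR tor by (simp add: h_def same_initial_def)
  next
    case (Suc m)
    have ins: "insert m ({..<r} - {m}) = {..<r}" using Suc(2) by auto
    interpret koszul_insert R J "{..<r} - {m}" m "h m"
      by unfold_locales (use f ec Suc(2) in \<open>auto simp: h_def Pi_iff\<close>)
    have h: "h (Suc m) = (h m)(m := h m m \<oplus> e m)" by (auto simp: h_def less_Suc_eq)
    have "(2::nat) ^ m * t \<le> 2 ^ r * t" using Suc(2) by (simp add: power_increasing)
    then have "2 ^ m * t < Suc (c + 2 ^ r * t)" by (intro le_imp_less_Suc trans_le_add2)
    note p = perturb_one[unfolded ins, of c "2 ^ m * t" "e m" "Suc (c + 2 ^ r * t)", folded h,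
        OF _ _ _ _ this]
    have "e m \<in> P (Suc (c + 2 ^ r * t))" by (rule funcset_mem[OF e]) (use Suc(2) in simp)
    then show ?case using p Suc(1,2) by (simp add: same_initial_def mult.assoc)
  qed
  then have "same_initial J (lspan {..<r} f) (lspan {..<r} (h r))" by blast
  moreover have "lspan {..<r} (h r) = lspan {..<r} (\<lambda>j. f j \<oplus> e j)"
  proof -
    have "lin {..<r} a (h r) = lin {..<r} a (\<lambda>j. f j \<oplus> e j)" if "a \<in> {..<r} \<rightarrow> carrier R" for a
      using that f ec by (intro lin_cong) (auto simp: h_def Pi_iff)
    then show ?thesis by (rule lspan_cong)
  qed
  ultimately show ?thesis by simp
qed

end

section \<open>Torsion of the Koszul homology of a filter-regular sequence\<close>

context noetherian_local_ring
begin

definition max_torsion :: "'a set"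
  where "max_torsion = {x \<in> carrier R. \<exists>s. \<forall>y \<in> ideal_pow R \<mm> s. y \<otimes> x = \<zero>}"

lemmas max_pow_ideal = pow_ideal[OF max_ideal_ideal]

lemma max_torsion_ideal: "ideal max_torsion R"
proof (rule cring_idealI)
  have 0: "\<forall>y \<in> ideal_pow R \<mm> 0. y \<otimes> \<zero> = \<zero>" by simp
  then show "\<zero> \<in> max_torsion" unfolding max_torsion_def by blast
next
  fix a b assume "a \<in> max_torsion" "b \<in> max_torsion"
  then obtain s t where s: "a \<in> carrier R" "\<forall>y \<in> ideal_pow R \<mm> s. y \<otimes> a = \<zero>"
    and t: "b \<in> carrier R" "\<forall>y \<in> ideal_pow R \<mm> t. y \<otimes> b = \<zero>"
    unfolding max_torsion_def by blast
  have "y \<otimes> (a \<oplus> b) = \<zero>" if y: "y \<in> ideal_pow R \<mm> (s + t)" for y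
  proof -
    have "y \<in> ideal_pow R \<mm> s" "y \<in> ideal_pow R \<mm> t"
      using y pow_antimono[OF max_ideal_ideal, of s "s + t"] pow_antimono[OF max_ideal_ideal, of t "s + t"] by auto
    then show ?thesis using s t ideal_memI(2)[OF max_pow_ideal y] by (simp add: r_distr)
  qed
  then show "a \<oplus> b \<in> max_torsion" unfolding max_torsion_def using s(1) t(1) by blast
next
  fix a r assume "a \<in> max_torsion" and r: "r \<in> carrier R"
  then obtain s where s: "a \<in> carrier R" "\<forall>y \<in> ideal_pow R \<mm> s. y \<otimes> a = \<zero>"
    unfolding max_torsion_def by blast
  have "y \<otimes> (r \<otimes> a) = \<zero>" if y: "y \<in> ideal_pow R \<mm> s" for y
    using s y r ideal_memI(2)[OF max_pow_ideal y] by (simp add: m_lcomm)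
  then show "r \<otimes> a \<in> max_torsion" unfolding max_torsion_def using s(1) r by blast
qed (auto simp: max_torsion_def)

lemma annihilator_ideal: "x \<in> carrier R \<Longrightarrow> ideal (annihilator R x) R"
  using colon_ideal[OF zeroideal, of x] by (simp add: annihilator_def)

lemma max_torsion_uniform:
  assumes K: "ideal K R" and le: "K \<subseteq> max_torsion"
  shows "\<exists>s. \<forall>k\<in>K. \<forall>y \<in> ideal_pow R \<mm> s. y \<otimes> k = \<zero>"
proof -
  obtain G where G: "G \<subseteq> carrier R" "finite G" "K = Idl G" using finetely_gen[OF K] by blast
  have "G \<subseteq> max_torsion" using genideal_self[OF G(1)] G(3) le by blast
  then have "\<forall>g\<in>G. \<exists>s. \<forall>y \<in> ideal_pow R \<mm> s. y \<otimes> g = \<zero>" unfolding max_torsion_def by blast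
  then obtain s where s: "\<And>g y. \<lbrakk>g \<in> G; y \<in> ideal_pow R \<mm> (s g)\<rbrakk> \<Longrightarrow> y \<otimes> g = \<zero>" by metis
  define N where "N = (\<Sum>g\<in>G. s g)"
  have "y \<otimes> k = \<zero>" if k: "k \<in> K" and y: "y \<in> ideal_pow R \<mm> N" for k y
  proof -
    have yc: "y \<in> carrier R" using ideal_memI(2)[OF max_pow_ideal y] .
    have "G \<subseteq> annihilator R y"
    proof
      fix g assume g: "g \<in> G"
      then have "s g \<le> N" unfolding N_def using G(2) by (intro member_le_sum) auto
      then have "y \<in> ideal_pow R \<mm> (s g)" using y pow_antimono[OF max_ideal_ideal] by blast
      then have "y \<otimes> g = \<zero>" by (rule s[OF g])
      then show "g \<in> annihilator R y" using g G(1) yc m_comm[of g y] by (auto simp: annihilator_def)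
    qed
    then have "K \<subseteq> annihilator R y" unfolding G(3) using annihilator_ideal[OF yc] by (intro genideal_minimal)
    then have "k \<in> carrier R" "k \<otimes> y = \<zero>" using k by (auto simp: annihilator_def)
    then show ?thesis using yc m_comm[of k y] by simp
  qed
  then show ?thesis by blast
qed

lemma multiples_ideal:
  assumes A: "ideal A R" and x: "x \<in> carrier R"
  shows "ideal {a \<otimes> x | a. a \<in> A} R"
proof (rule cring_idealI)
  note Ac = ideal_memI(2)[OF A]
  show "{a \<otimes> x | a. a \<in> A} \<subseteq> carrier R" using Ac x by auto
  show "\<zero> \<in> {a \<otimes> x | a. a \<in> A}" using ideal_memI(1)[OF A] x by (intro CollectI exI[of _ \<zero>]) simp
  fix u v assume "u \<in> {a \<otimes> x | a. a \<in> A}" "v \<in> {a \<otimes> x | a. a \<in> A}"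
  then obtain a b where "a \<in> A" "b \<in> A" "u = a \<otimes> x" "v = b \<otimes> x" by blast
  then show "u \<oplus> v \<in> {a \<otimes> x | a. a \<in> A}"
    using ideal_memI(3)[OF A] Ac x by (intro CollectI exI[of _ "a \<oplus> b"]) (simp add: l_distr)
next
  note Ac = ideal_memI(2)[OF A]
  fix u r assume "u \<in> {a \<otimes> x | a. a \<in> A}" and r: "r \<in> carrier R"
  then obtain a where "a \<in> A" "u = a \<otimes> x" by blast
  then show "r \<otimes> u \<in> {a \<otimes> x | a. a \<in> A}"
    using ideal_memI(6)[OF A] Ac x r by (intro CollectI exI[of _ "r \<otimes> a"]) (simp add: m_assoc)
qed

lemma max_torsionI_product:
  assumes x: "x \<in> carrier R" and B: "ideal B R"
    and "\<And>y p. \<lbrakk>y \<in> ideal_pow R \<mm> s; p \<in> B\<rbrakk> \<Longrightarrow> (y \<otimes> p) \<otimes> x = \<zero>"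
    and "ideal_pow R \<mm> n \<subseteq> ideal_pow R \<mm> s \<cdot> B"
  shows "x \<in> max_torsion"
proof -
  have "ideal_pow R \<mm> s \<cdot> B \<subseteq> annihilator R x"
    using assms(3) ideal_memI(2)[OF max_pow_ideal] ideal_memI(2)[OF B]
    by (intro prod_le annihilator_ideal x) (auto simp: annihilator_def)
  then have "\<forall>y \<in> ideal_pow R \<mm> n. y \<otimes> x = \<zero>"
    using assms(4) by (auto simp: annihilator_def)
  then show ?thesis unfolding max_torsion_def using x by blast
qed

text \<open>Otherwise some \<open>x\<close> with \<open>x f = 0\<close> is not killed by any power of \<open>\<mm>\<close>. Choose it with \<open>T x = (\<Gamma> : x)\<close>
  maximal, where \<open>\<Gamma>\<close> is the ideal of elements killed by some power of \<open>\<mm>\<close>. Maximality makes \<open>T x\<close> prime.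
  As \<open>T x\<close> is finitely generated, some \<open>\<mm>\<^sup>s\<close> kills \<open>T x \<cdot> x\<close>, so \<open>T x\<close> is the annihilator of a
  multiple \<open>y x\<close> outside \<open>\<Gamma>\<close> with \<open>y \<in> \<mm>\<^sup>s\<close>. It is thus an associated prime other than \<open>\<mm>\<close> that contains \<open>f\<close>.\<close>

theorem filter_regular_annihilator_torsion:
  assumes fr: "filter_regular R f"
  shows "\<exists>t. \<forall>x\<in>carrier R. x \<otimes> f = \<zero> \<longrightarrow> (\<forall>y \<in> ideal_pow R \<mm> t. y \<otimes> x = \<zero>)"
proof -
  have f: "f \<in> carrier R" using fr by (simp add: filter_regular_def)
  define C where "C = annihilator R f"
  have C: "ideal C R" unfolding C_def using f by (rule annihilator_ideal)
  note Cc = ideal_memI(2)[OF C]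
  define T where "T x = {r \<in> carrier R. r \<otimes> x \<in> max_torsion}" for x
  have TI: "ideal (T x) R" if "x \<in> carrier R" for x
    unfolding T_def using max_torsion_ideal that by (rule colon_ideal)
  have "C \<subseteq> max_torsion"
  proof (rule ccontr)
    assume "\<not> C \<subseteq> max_torsion"
    then have "T ` (C - max_torsion) \<noteq> {}" by blast
    then obtain M where M: "M \<in> T ` (C - max_torsion)"
      "\<And>I. \<lbrakk>I \<in> T ` (C - max_torsion); M \<subseteq> I\<rbrakk> \<Longrightarrow> I = M"
      by (rule maximal_ideal_in) (use TI Cc in auto)
    then obtain x where x: "x \<in> C" "x \<notin> max_torsion" "M = T x" by blast
    have xc: "x \<in> carrier R" using Cc[OF x(1)] .
    have top: "T (b \<otimes> x) = T x" if b: "b \<in> carrier R" "b \<otimes> x \<notin> max_torsion" for b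
    proof -
      have "b \<otimes> x \<in> C" using ideal_memI(6)[OF C x(1) b(1)] .
      moreover have "T x \<subseteq> T (b \<otimes> x)"
      proof
        fix r assume "r \<in> T x"
        then have r: "r \<in> carrier R" "r \<otimes> x \<in> max_torsion" by (auto simp: T_def)
        have "r \<otimes> (b \<otimes> x) = b \<otimes> (r \<otimes> x)" using r(1) b(1) xc by (rule m_lcomm)
        then show "r \<in> T (b \<otimes> x)" unfolding T_def using r ideal_memI(6)[OF max_torsion_ideal r(2) b(1)] by simp
      qed
      ultimately show ?thesis using M(2) b(2) x(3) by blast
    qed
    have "{a \<otimes> x | a. a \<in> T x} \<subseteq> max_torsion" by (auto simp: T_def)
    then obtain s where s: "\<forall>k\<in>{a \<otimes> x | a. a \<in> T x}. \<forall>y \<in> ideal_pow R \<mm> s. y \<otimes> k = \<zero>"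
      using max_torsion_uniform[OF multiples_ideal[OF TI[OF xc] xc]] by blast
    have kill: "(y \<otimes> p) \<otimes> x = \<zero>" if "y \<in> ideal_pow R \<mm> s" "p \<in> T x" for y p
    proof -
      have "y \<otimes> (p \<otimes> x) = \<zero>" using s that by blast
      then show ?thesis using ideal_memI(2)[OF max_pow_ideal that(1)] that(2) xc by (simp add: m_assoc T_def)
    qed
    have "\<exists>y \<in> ideal_pow R \<mm> s. y \<otimes> x \<notin> max_torsion"
    proof (rule ccontr)
      assume "\<not> ?thesis"
      then have "{a \<otimes> x | a. a \<in> ideal_pow R \<mm> s} \<subseteq> max_torsion" by blast
      then obtain s' where s': "\<forall>k\<in>{a \<otimes> x | a. a \<in> ideal_pow R \<mm> s}. \<forall>y \<in> ideal_pow R \<mm> s'. y \<otimes> k = \<zero>"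
        using max_torsion_uniform[OF multiples_ideal[OF max_pow_ideal xc]] by blast
      have "x \<in> max_torsion"
      proof (rule max_torsionI_product[OF xc max_pow_ideal[of s], of s' "s' + s"])
        fix y p assume y: "y \<in> ideal_pow R \<mm> s'" and p: "p \<in> ideal_pow R \<mm> s"
        have "y \<otimes> (p \<otimes> x) = \<zero>" using s' y p by blast
        then show "(y \<otimes> p) \<otimes> x = \<zero>" using ideal_memI(2)[OF max_pow_ideal] y p xc by (simp add: m_assoc)
      qed (simp add: pow_add[OF max_ideal_ideal])
      then show False using x(2) by blast
    qed
    then obtain y where y: "y \<in> ideal_pow R \<mm> s" "y \<otimes> x \<notin> max_torsion" by blast
    have yc: "y \<in> carrier R" using ideal_memI(2)[OF max_pow_ideal y(1)] .
    have Tx: "T x = annihilator R (y \<otimes> x)"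
    proof
      show "T x \<subseteq> annihilator R (y \<otimes> x)"
      proof
        fix p assume p: "p \<in> T x"
        then have pc: "p \<in> carrier R" by (simp add: T_def)
        have "p \<otimes> (y \<otimes> x) = (y \<otimes> p) \<otimes> x" using pc yc xc by (simp add: m_ac)
        then show "p \<in> annihilator R (y \<otimes> x)" using kill[OF y(1) p] pc by (simp add: annihilator_def)
      qed
      have "annihilator R (y \<otimes> x) \<subseteq> T (y \<otimes> x)"
        using ideal_memI(1)[OF max_torsion_ideal] by (auto simp: annihilator_def T_def)
      then show "annihilator R (y \<otimes> x) \<subseteq> T x" using top[OF yc y(2)] by simp
    qed
    have "primeideal (T x) R"
    proof (rule primeidealI[OF TI[OF xc] is_cring])
      have "\<one> \<notin> T x" using x(2) xc by (simp add: T_def)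
      then show "carrier R \<noteq> T x" by blast
    next
      fix a b assume a: "a \<in> carrier R" and b: "b \<in> carrier R" and ab: "a \<otimes> b \<in> T x"
      show "a \<in> T x \<or> b \<in> T x"
      proof (cases "b \<otimes> x \<in> max_torsion")
        case True
        then show ?thesis using b by (simp add: T_def)
      next
        case False
        have "a \<in> T (b \<otimes> x)" using ab a b xc by (simp add: T_def m_assoc)
        then show ?thesis using top[OF b False] by simp
      qed
    qed
    then have "T x \<in> Ass R" unfolding Ass_def using Tx yc xc by blast
    moreover have "T x \<noteq> \<mm>"
    proof
      assume "T x = \<mm>"
      then have "x \<in> max_torsion"
        using kill by (intro max_torsionI_product[OF xc max_ideal_ideal, of s "Suc s"]) (auto simp only: pow_Suc)
      then show False using x(2) by blast
    qed
    moreover have "f \<otimes> x = \<zero>" using x(1) f by (auto simp: C_def annihilator_def m_comm)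
    then have "f \<in> T x" using f ideal_memI(1)[OF max_torsion_ideal] by (simp add: T_def)
    ultimately show False using fr unfolding filter_regular_def by blast
  qed
  then obtain t where "\<forall>k\<in>C. \<forall>y \<in> ideal_pow R \<mm> t. y \<otimes> k = \<zero>" using max_torsion_uniform[OF C] by blast
  then show ?thesis unfolding C_def annihilator_def by blast
qed

end

context cring
begin

lemma quot_ideal_obtain:
  assumes "ideal I R" "ideal K (R Quot I)"
  obtains L where "ideal L R" "I \<subseteq> L" "K = (+>) I ` L"
  using quot_ideal_correspondence[OF assms(1)] assms(2) unfolding bij_betw_def by blast

lemma coset_mem_iff:
  assumes I: "ideal I R" and L: "ideal L R" "I \<subseteq> L" and x: "x \<in> carrier R"
  shows "I +> x \<in> (+>) I ` L \<longleftrightarrow> x \<in> L"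
proof
  assume "I +> x \<in> (+>) I ` L"
  then obtain y where y: "y \<in> L" "I +> x = I +> y" by blast
  have yc: "y \<in> carrier R" using ideal_memI(2)[OF L(1) y(1)] .
  have "x \<ominus> y \<in> I" using quotient_eq_iff_same_a_r_cos[OF I x yc] y(2) by simp
  then have "(x \<ominus> y) \<oplus> y \<in> L" using L y(1) ideal_memI(3)[OF L(1)] by blast
  moreover have "(x \<ominus> y) \<oplus> y = x" using x yc by algebra
  ultimately show "x \<in> L" by simp
qed blast

lemma quot_carrier: "carrier (R Quot I) = (+>) I ` carrier R"
  by (auto simp: FactRing_def A_RCOSETS_def')

end

lemma (in noetherian_cring) quot_noetherian:
  assumes I: "ideal I R"
  shows "noetherian_ring (R Quot I)"
proof -
  interpret A: cring "R Quot I" using I is_cring by (rule ideal.quotient_is_cring)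
  interpret h: ring_hom_ring R "R Quot I" "(+>) I" using I by (rule ideal.rcos_ring_hom_ring)
  show ?thesis
  proof (rule A.noetherian_ringI)
    fix K assume K: "ideal K (R Quot I)"
    obtain L where L: "ideal L R" "I \<subseteq> L" "K = (+>) I ` L" using quot_ideal_obtain[OF I K] .
    obtain G where G: "G \<subseteq> carrier R" "finite G" "L = Idl G" using finetely_gen[OF L(1)] by blast
    let ?G = "(+>) I ` G"
    have Gc: "?G \<subseteq> carrier (R Quot I)" using G(1) quot_carrier by auto
    have "K = Idl\<^bsub>R Quot I\<^esub> ?G"
    proof
      have "G \<subseteq> L" using genideal_self[OF G(1)] G(3) by simp
      then show "Idl\<^bsub>R Quot I\<^esub> ?G \<subseteq> K" using K L(3) by (intro A.genideal_minimal) auto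
      have "L \<subseteq> {r \<in> carrier R. I +> r \<in> Idl\<^bsub>R Quot I\<^esub> ?G}"
        unfolding G(3) using A.genideal_self[OF Gc] G(1)
        by (intro genideal_minimal h.ideal_vimage A.genideal_ideal Gc) auto
      then show "K \<subseteq> Idl\<^bsub>R Quot I\<^esub> ?G" unfolding L(3) by blast
    qed
    then show "\<exists>A\<subseteq>carrier (R Quot I). finite A \<and> K = Idl\<^bsub>R Quot I\<^esub> A" using Gc G(2) by blast
  qed
qed

context noetherian_local_ring
begin

lemma quot_local:
  assumes I: "ideal I R" and le: "I \<subseteq> \<mm>"
  shows "noetherian_local_ring (R Quot I)" and "max_ideal (R Quot I) = (+>) I ` \<mm>"
proof -
  interpret A: cring "R Quot I" using I is_cring by (rule ideal.quotient_is_cring)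
  have max: "maximalideal ((+>) I ` \<mm>) (R Quot I)"
  proof (rule maximalidealI)
    show "ideal ((+>) I ` \<mm>) (R Quot I)" using I max_ideal_ideal by (rule ring_ideal_imp_quot_ideal)
    have "I +> \<one> \<notin> (+>) I ` \<mm>"
      using coset_mem_iff[OF I max_ideal_ideal le one_closed] one_notin_max_ideal by simp
    then show "carrier (R Quot I) \<noteq> (+>) I ` \<mm>" using quot_carrier[of I] by blast
  next
    fix K assume K: "ideal K (R Quot I)" "(+>) I ` \<mm> \<subseteq> K"
    obtain L where L: "ideal L R" "I \<subseteq> L" "K = (+>) I ` L" using quot_ideal_obtain[OF I K(1)] .
    have "\<mm> \<subseteq> L" using K(2) coset_mem_iff[OF I L(1,2)] ideal_memI(2)[OF max_ideal_ideal] unfolding L(3) by blast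
    then have "L = \<mm> \<or> L = carrier R"
      using proper_le_max_ideal[OF L(1)] ideal.one_imp_carrier[OF L(1)] by blast
    then show "K = (+>) I ` \<mm> \<or> K = carrier (R Quot I)" using L(3) quot_carrier[of I] by auto
  qed
  have uniq: "K = (+>) I ` \<mm>" if "maximalideal K (R Quot I)" for K
  proof -
    interpret K: maximalideal K "R Quot I" by fact
    obtain L where L: "ideal L R" "I \<subseteq> L" "K = (+>) I ` L" using quot_ideal_obtain[OF I K.is_ideal] .
    have "\<one> \<notin> L"
    proof
      assume "\<one> \<in> L"
      then have "L = carrier R" using ideal.one_imp_carrier[OF L(1)] by blast
      then show False using K.I_notcarr L(3) quot_carrier[of I] by simp
    qed
    then have "K \<subseteq> (+>) I ` \<mm>" unfolding L(3) using proper_le_max_ideal[OF L(1)] by blast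
    moreover have mI: "ideal ((+>) I ` \<mm>) (R Quot I)" using max by (rule maximalideal.axioms(1))
    moreover have "(+>) I ` \<mm> \<subseteq> carrier (R Quot I)"
      using additive_subgroup.a_subset[OF ideal.axioms(1)[OF mI]] .
    ultimately have "(+>) I ` \<mm> = K \<or> (+>) I ` \<mm> = carrier (R Quot I)"
      by (intro K.I_maximal)
    then show ?thesis using maximalideal.I_notcarr[OF max] by blast
  qed
  have ex1: "\<exists>!M. maximalideal M (R Quot I)" using max uniq by blast
  show "max_ideal (R Quot I) = (+>) I ` \<mm>"
    unfolding max_ideal_def[of "R Quot I"] using max uniq by (rule the_equality)
  interpret N: noetherian_ring "R Quot I" using I by (rule quot_noetherian)
  show "noetherian_local_ring (R Quot I)" by unfold_locales (rule ex1)
qed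

lemma quot_pow:
  assumes I: "ideal I R" and le: "I \<subseteq> \<mm>" and y: "y \<in> ideal_pow R \<mm> t"
  shows "I +> y \<in> ideal_pow (R Quot I) (max_ideal (R Quot I)) t"
proof -
  interpret A: noetherian_local_ring "R Quot I" using quot_local[OF I le] by blast
  interpret h: ring_hom_ring R "R Quot I" "(+>) I" using I by (rule ideal.rcos_ring_hom_ring)
  show ?thesis using y
  proof (induct t arbitrary: y)
    case 0
    then show ?case using h.hom_closed by simp
  next
    case (Suc t)
    let ?K = "{r \<in> carrier R. I +> r \<in> ideal_pow (R Quot I) (max_ideal (R Quot I)) (Suc t)}"
    have K: "ideal ?K R" by (intro h.ideal_vimage A.pow_ideal A.max_ideal_ideal)
    have "ideal_pow R \<mm> t \<cdot> \<mm> \<subseteq> ?K"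
    proof (rule prod_le[OF K])
      fix u v assume u: "u \<in> ideal_pow R \<mm> t" and v: "v \<in> \<mm>"
      have uv: "u \<in> carrier R" "v \<in> carrier R"
        using ideal_memI(2)[OF max_pow_ideal u] ideal_memI(2)[OF max_ideal_ideal v] .
      have "I +> (u \<otimes> v) = (I +> u) \<otimes>\<^bsub>R Quot I\<^esub> (I +> v)" using uv by simp
      also have "\<dots> \<in> ideal_pow (R Quot I) (max_ideal (R Quot I)) (Suc t)"
        unfolding A.pow_Suc using Suc(1)[OF u] v quot_local(2)[OF I le] by (intro ideal_prod.prod) auto
      finally show "u \<otimes> v \<in> ?K" using uv by simp
    qed
    then show ?case using Suc(2) unfolding pow_Suc by blast
  qed
qed

lemma filter_regular_colon_torsion:
  assumes I: "ideal I R" and le: "I \<subseteq> \<mm>" and f: "f \<in> carrier R"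
    and fr: "filter_regular (R Quot I) (I +> f)"
  shows "\<exists>t. \<forall>\<alpha> y. \<alpha> \<in> carrier R \<longrightarrow> \<alpha> \<otimes> f \<in> I \<longrightarrow> y \<in> ideal_pow R \<mm> t \<longrightarrow> y \<otimes> \<alpha> \<in> I"
proof -
  interpret A: noetherian_local_ring "R Quot I" using quot_local[OF I le] by blast
  interpret h: ring_hom_ring R "R Quot I" "(+>) I" using I by (rule ideal.rcos_ring_hom_ring)
  have zero: "I +> x = \<zero>\<^bsub>R Quot I\<^esub> \<longleftrightarrow> x \<in> I" if "x \<in> carrier R" for x
    using quotient_eq_iff_same_a_r_cos[OF I that zero_closed] that h.hom_zero by (simp add: minus_eq)
  obtain t where t: "\<forall>x\<in>carrier (R Quot I). x \<otimes>\<^bsub>R Quot I\<^esub> (I +> f) = \<zero>\<^bsub>R Quot I\<^esub> \<longrightarrow>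
      (\<forall>y \<in> ideal_pow (R Quot I) (max_ideal (R Quot I)) t. y \<otimes>\<^bsub>R Quot I\<^esub> x = \<zero>\<^bsub>R Quot I\<^esub>)"
    using A.filter_regular_annihilator_torsion[OF fr] by blast
  have "y \<otimes> \<alpha> \<in> I" if "\<alpha> \<in> carrier R" "\<alpha> \<otimes> f \<in> I" "y \<in> ideal_pow R \<mm> t" for \<alpha> y
  proof -
    have yc: "y \<in> carrier R" using ideal_memI(2)[OF max_pow_ideal that(3)] .
    have "(I +> \<alpha>) \<otimes>\<^bsub>R Quot I\<^esub> (I +> f) = I +> (\<alpha> \<otimes> f)" using that(1) f by simp
    also have "\<dots> = \<zero>\<^bsub>R Quot I\<^esub>" using that(1,2) f by (intro zero[THEN iffD2]) auto
    finally have "(I +> y) \<otimes>\<^bsub>R Quot I\<^esub> (I +> \<alpha>) = \<zero>\<^bsub>R Quot I\<^esub>"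
      using t quot_pow[OF I le that(3)] h.hom_closed[OF that(1)] by blast
    moreover have "I +> (y \<otimes> \<alpha>) = (I +> y) \<otimes>\<^bsub>R Quot I\<^esub> (I +> \<alpha>)" using yc that(1) by simp
    ultimately have "I +> (y \<otimes> \<alpha>) = \<zero>\<^bsub>R Quot I\<^esub>" by simp
    then show ?thesis using yc that(1) by (intro zero[THEN iffD1]) auto
  qed
  then show ?thesis by blast
qed

end

context local_ring_with_ideal
begin

text \<open>The first Koszul homology grows, with each new element of the sequence, by the torsion module
  \<open>(I : f\<^sub>m) / I\<close> only, where \<open>I\<close> is generated by the elements before \<open>f\<^sub>m\<close>.\<close>

lemma filter_regular_koszul_torsion:
  assumes fs: "filter_regular_seq R fs" and le: "set fs \<subseteq> max_ideal R" and "m \<le> length fs"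
  shows "\<exists>t. koszul_torsion J t {..<m} (\<lambda>i. fs ! i)"
  using \<open>m \<le> length fs\<close>
proof (induct m)
  case 0
  show ?case unfolding koszul_torsion_def koszul_def by simp
next
  case (Suc m)
  let ?f = "\<lambda>i. fs ! i"
  have fc: "fs ! i \<in> carrier R" if "i < length fs" for i
    using that le ideal_memI(2)[OF max_ideal_ideal] by (meson nth_mem subsetD)
  have ins: "insert m {..<m} = {..<Suc m}" by auto
  interpret koszul_insert R J "{..<m}" m ?f
    by unfold_locales (use fc Suc(2) in auto)
  obtain t1 where t1: "koszul_torsion J t1 {..<m} ?f" using Suc by auto
  have "set (take m fs) = ?f ` {..<m}" using nth_image[of m fs] Suc(2) by (simp add: atLeast0LessThan)
  then have Q: "Idl (set (take m fs)) = lspan {..<m} ?f" using lspan_eq_Idl[OF S(1) fS] by simp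
  have "lspan {..<m} ?f \<subseteq> \<mm>"
    unfolding Q[symmetric] using le by (intro genideal_minimal max_ideal_ideal) (auto dest: in_set_takeD)
  moreover have "filter_regular (R Quot (Idl (set (take m fs)))) ((Idl (set (take m fs))) +> fs ! m)"
    using fs Suc(2) unfolding filter_regular_seq_def by (simp add: Let_def)
  then have "filter_regular (R Quot (lspan {..<m} ?f)) (lspan {..<m} ?f +> fs ! m)"
    by (simp only: Q)
  ultimately obtain t2 where t2: "\<And>\<alpha> y. \<lbrakk>\<alpha> \<in> carrier R; \<alpha> \<otimes> fs ! m \<in> lspan {..<m} ?f; y \<in> ideal_pow R \<mm> t2\<rbrakk>
      \<Longrightarrow> y \<otimes> \<alpha> \<in> lspan {..<m} ?f"
    using filter_regular_colon_torsion[OF Q_ideal _ fi] by blast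
  have "koszul_torsion J (t1 + t2) (insert m {..<m}) ?f"
  proof (rule torsion_insert)
    show "y \<otimes> \<alpha> \<in> lspan {..<m} ?f" if "\<alpha> \<in> carrier R" "\<alpha> \<otimes> fs ! m \<in> lspan {..<m} ?f" "y \<in> P t2" for \<alpha> y
      using t2[OF that(1,2)] that(3) pow_mono[OF J_le_max] by blast
    have "koszul_mult {..<m} ?f (fs ! m) b" if "koszul {..<m} ?f b" for b
      unfolding koszul_mult_def using that Kos(1)[OF that] Syz(2) fi
      by (intro conjI exI[of _ b] exI[of _ "\<lambda>_. \<zero>"]) auto
    then show "syz_torsion J t1 {..<m} ?f (fs ! m)"
      using t1 unfolding koszul_torsion_def syz_torsion_def by blast
  qed
  then show ?case unfolding ins by blast
qed

end

section \<open>Length as the length of intervals of ideals\<close>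

text \<open>A supremum that is bounded by a natural number is attained.\<close>

lemma Sup_enat_add_le:
  assumes "\<And>m n. P m \<Longrightarrow> Q n \<Longrightarrow> enat (m + n) \<le> c" and P0: "P 0" and Q0: "Q 0"
  shows "Sup {enat m | m. P m} + Sup {enat n | n. Q n} \<le> c"
proof (cases c)
  case (enat k)
  have attained: "\<exists>m. Z m \<and> Sup {enat m | m. Z m} \<le> enat m" if "Z 0" "\<And>m. Z m \<Longrightarrow> m \<le> k" for Z
  proof -
    have fin: "finite {m. Z m}" using that(2) by (rule_tac finite_subset[of _ "{..k}"]) auto
    have "Z (Max {m. Z m})" using Max_in[OF fin] that(1) by blast
    moreover have "Sup {enat m | m. Z m} \<le> enat (Max {m. Z m})"
      by (rule Sup_least) (use fin in auto)
    ultimately show ?thesis by blast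
  qed
  have "P m \<Longrightarrow> m \<le> k" "Q m \<Longrightarrow> m \<le> k" for m
    using assms(1)[OF _ Q0, of m] assms(1)[OF P0, of m] enat by auto
  then obtain m n where "P m" "Sup {enat m | m. P m} \<le> enat m" "Q n" "Sup {enat n | n. Q n} \<le> enat n"
    using attained[of P] attained[of Q] P0 Q0 by blast
  note mn = this
  have "Sup {enat m | m. P m} + Sup {enat n | n. Q n} \<le> enat m + enat n"
    using mn(2,4) by (rule add_mono)
  also have "\<dots> \<le> c" using assms(1)[OF mn(1,3)] by simp
  finally show ?thesis .
qed simp

context cring
begin

definition ideal_chain :: "'a set \<Rightarrow> 'a set \<Rightarrow> nat \<Rightarrow> bool"
  where "ideal_chain A B n \<longleftrightarrow> (\<exists>C. (\<forall>i\<le>n. ideal (C i) R \<and> A \<subseteq> C i \<and> C i \<subseteq> B) \<and> (\<forall>i<n. C i \<subset> C (Suc i)))"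

definition interval_length :: "'a set \<Rightarrow> 'a set \<Rightarrow> enat"
  where "interval_length A B = Sup {enat n | n. ideal_chain A B n}"

lemma ideal_chain_0: "\<lbrakk>ideal X R; A \<subseteq> X; X \<subseteq> B\<rbrakk> \<Longrightarrow> ideal_chain A B 0"
  unfolding ideal_chain_def by auto

lemma ideal_chain_mono: "\<lbrakk>ideal_chain A B n; B \<subseteq> B'\<rbrakk> \<Longrightarrow> ideal_chain A B' n"
  unfolding ideal_chain_def by (meson order_trans)

lemma ideal_chain_extend:
  assumes "ideal_chain A X n" "ideal X' R" "X \<subset> X'"
  shows "ideal_chain A X' (Suc n)"
proof -
  obtain C where C: "\<forall>i\<le>n. ideal (C i) R \<and> A \<subseteq> C i \<and> C i \<subseteq> X" "\<forall>i<n. C i \<subset> C (Suc i)"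
    using assms(1) unfolding ideal_chain_def by blast
  let ?D = "\<lambda>i. if i \<le> n then C i else X'"
  have "ideal (?D i) R \<and> A \<subseteq> ?D i \<and> ?D i \<subseteq> X'" for i
    using C(1) assms(2,3) by (cases "i \<le> n") (auto dest: spec[of _ n])
  moreover have "?D i \<subset> ?D (Suc i)" if "i < Suc n" for i
  proof (cases "i = n")
    case True
    have "C n \<subseteq> X" using C(1) by blast
    then show ?thesis using True assms(3) by auto
  qed (use C(2) that in auto)
  ultimately show ?thesis unfolding ideal_chain_def by (intro exI[of _ ?D]) blast
qed

lemma ideal_chain_append:
  assumes "ideal_chain A B m" "ideal_chain B D n"
  shows "ideal_chain A D (m + n)"
proof -
  obtain C1 where C1: "\<forall>i\<le>m. ideal (C1 i) R \<and> A \<subseteq> C1 i \<and> C1 i \<subseteq> B" "\<forall>i<m. C1 i \<subset> C1 (Suc i)"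
    using assms(1) unfolding ideal_chain_def by blast
  obtain C2 where C2: "\<forall>i\<le>n. ideal (C2 i) R \<and> B \<subseteq> C2 i \<and> C2 i \<subseteq> D" "\<forall>i<n. C2 i \<subset> C2 (Suc i)"
    using assms(2) unfolding ideal_chain_def by blast
  have AB: "A \<subseteq> B" "B \<subseteq> D" using C1(1) C2(1) by blast+
  let ?C = "\<lambda>i. if i \<le> m then C1 i else C2 (i - m)"
  have "ideal (?C i) R \<and> A \<subseteq> ?C i \<and> ?C i \<subseteq> D" if "i \<le> m + n" for i
  proof (cases "i \<le> m")
    case True
    then show ?thesis using C1(1)[rule_format, of i] AB by auto
  next
    case False
    then have "ideal (C2 (i - m)) R \<and> B \<subseteq> C2 (i - m) \<and> C2 (i - m) \<subseteq> D" using C2(1) that by simp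
    then show ?thesis using False AB by auto
  qed
  moreover have "?C i \<subset> ?C (Suc i)" if "i < m + n" for i
  proof -
    consider "i < m" | "i = m" | "m < i" by linarith
    then show ?thesis
    proof cases
      case 2
      have "C1 m \<subseteq> B" "B \<subseteq> C2 0" using C1(1) C2(1) by blast+
      moreover have "C2 0 \<subset> C2 (Suc 0)" using C2(2) that 2 by simp
      ultimately show ?thesis using 2 by auto
    next
      case 3
      then show ?thesis using C2(2)[rule_format, of "i - m"] that by (auto simp: Suc_diff_le)
    qed (use C1(2) in auto)
  qed
  ultimately show ?thesis unfolding ideal_chain_def by (intro exI[of _ ?C]) blast
qed

text \<open>By the modular law a strict step \<open>C k \<subset> C (k + 1)\<close> stays strict after intersecting with \<open>B\<close> or after
  adding \<open>B\<close>.\<close>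

lemma ideal_chain_split:
  assumes B: "ideal B R" "A \<subseteq> B" "B \<subseteq> D" and D: "ideal D R" and ch: "ideal_chain A D n"
  shows "\<exists>p q. n \<le> p + q \<and> ideal_chain A B p \<and> ideal_chain B D q"
proof -
  obtain C where C: "\<And>i. i \<le> n \<Longrightarrow> ideal (C i) R \<and> A \<subseteq> C i \<and> C i \<subseteq> D" "\<And>i. i < n \<Longrightarrow> C i \<subset> C (Suc i)"
    using ch unfolding ideal_chain_def by blast
  have ids: "ideal (C k \<inter> B) R" "ideal (C k <+> B) R" "B \<subseteq> C k <+> B" "C k \<subseteq> C k <+> B" if "k \<le> n" for k
    using C(1)[OF that] B(1) le_addR le_addL by (auto intro: i_intersect add_ideals)
  have "\<exists>p q. k \<le> p + q \<and> ideal_chain A (C k \<inter> B) p \<and> ideal_chain B (C k <+> B) q" if "k \<le> n" for k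
    using that
  proof (induct k)
    case 0
    have "ideal_chain A (C 0 \<inter> B) 0" by (rule ideal_chain_0[OF ids(1)]) (use C(1)[of 0] B in auto)
    moreover have "ideal_chain B (C 0 <+> B) 0" by (rule ideal_chain_0[OF ids(2)[of 0] ids(3)[of 0] order_refl]) simp_all
    ultimately show ?case by blast
  next
    case (Suc k)
    then have kn: "k \<le> n" "Suc k \<le> n" by auto
    obtain p q where pq: "k \<le> p + q" "ideal_chain A (C k \<inter> B) p" "ideal_chain B (C k <+> B) q"
      using Suc by auto
    have sub: "C k \<subset> C (Suc k)" using C(2) kn by simp
    have le: "C k \<inter> B \<subseteq> C (Suc k) \<inter> B" "C k <+> B \<subseteq> C (Suc k) <+> B"
      using sub by (blast, intro set_add_mono) auto
    consider "C k \<inter> B \<subset> C (Suc k) \<inter> B" | "C k <+> B \<subset> C (Suc k) <+> B"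
      | "C k \<inter> B = C (Suc k) \<inter> B" "C k <+> B = C (Suc k) <+> B" using le by blast
    then show ?case
    proof cases
      case 1
      have "ideal_chain A (C (Suc k) \<inter> B) (Suc p)" by (rule ideal_chain_extend[OF pq(2) ids(1)[OF kn(2)] 1])
      moreover have "ideal_chain B (C (Suc k) <+> B) q" by (rule ideal_chain_mono[OF pq(3) le(2)])
      moreover have "Suc k \<le> Suc p + q" using pq(1) by simp
      ultimately show ?thesis by blast
    next
      case 2
      have "ideal_chain B (C (Suc k) <+> B) (Suc q)" by (rule ideal_chain_extend[OF pq(3) ids(2)[OF kn(2)] 2])
      moreover have "ideal_chain A (C (Suc k) \<inter> B) p" by (rule ideal_chain_mono[OF pq(2) le(1)])
      moreover have "Suc k \<le> p + Suc q" using pq(1) by simp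
      ultimately show ?thesis by blast
    next
      case 3
      have "C (Suc k) \<subseteq> C k"
      proof
        fix x assume x: "x \<in> C (Suc k)"
        then have "x \<in> C k <+> B" using 3(2) ids(4)[OF kn(2)] by blast
        then obtain c b where cb: "c \<in> C k" "b \<in> B" "x = c \<oplus> b" by (auto simp: mem_add_iff)
        have Ck: "ideal (C k) R" "ideal (C (Suc k)) R" using C(1) kn by auto
        have cc: "c \<in> carrier R" "b \<in> carrier R" using ideal_memI(2)[OF Ck(1) cb(1)] ideal_memI(2)[OF B(1) cb(2)] .
        have "b = x \<ominus> c" unfolding cb(3) using cc by algebra
        then have "b \<in> C (Suc k)" using ideal_memI(5)[OF Ck(2) x] cb(1) sub by auto
        then have "b \<in> C k" using cb(2) 3(1) by blast
        then show "x \<in> C k" unfolding cb(3) using cb(1) ideal_memI(3)[OF Ck(1)] by blast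
      qed
      then show ?thesis using sub by blast
    qed
  qed
  then obtain p q where pq: "n \<le> p + q" "ideal_chain A (C n \<inter> B) p" "ideal_chain B (C n <+> B) q" by blast
  have "ideal_chain A B p" by (rule ideal_chain_mono[OF pq(2)]) simp
  moreover have "ideal_chain B D q" by (rule ideal_chain_mono[OF pq(3)]) (use C(1)[of n] D B(3) in \<open>intro add_le; simp\<close>)
  ultimately show ?thesis using pq(1) by blast
qed

lemma interval_length_add:
  assumes A: "ideal A R" and B: "ideal B R" "A \<subseteq> B" "B \<subseteq> D" and D: "ideal D R"
  shows "interval_length A D = interval_length A B + interval_length B D"
proof (rule antisym)
  show "interval_length A D \<le> interval_length A B + interval_length B D"
    unfolding interval_length_def[of A D]
  proof (rule Sup_least, clarify)
    fix n assume "ideal_chain A D n"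
    then obtain p q where pq: "n \<le> p + q" "ideal_chain A B p" "ideal_chain B D q"
      using ideal_chain_split[OF B D] by blast
    have "enat p \<le> interval_length A B" "enat q \<le> interval_length B D"
      unfolding interval_length_def using pq by (auto intro: Sup_upper)
    then have "enat p + enat q \<le> interval_length A B + interval_length B D" by (rule add_mono)
    then show "enat n \<le> interval_length A B + interval_length B D"
      using pq(1) by (metis enat_ord_simps(1) order_trans plus_enat_simps(1))
  qed
  show "interval_length A B + interval_length B D \<le> interval_length A D"
    unfolding interval_length_def[of A B] interval_length_def[of B D]
  proof (rule Sup_enat_add_le)
    show "enat (m + n) \<le> interval_length A D" if "ideal_chain A B m" "ideal_chain B D n" for m n
      unfolding interval_length_def using ideal_chain_append[OF that] by (auto intro: Sup_upper)
  qed (use ideal_chain_0[OF A] ideal_chain_0[OF B(1)] B in auto)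
qed

lemma ideal_chain_image:
  assumes ch: "ideal_chain A B n"
    and h: "\<And>C. \<lbrakk>ideal C R; A \<subseteq> C; C \<subseteq> B\<rbrakk> \<Longrightarrow> ideal (h C) R \<and> A' \<subseteq> h C \<and> h C \<subseteq> B' \<and> k (h C) = C"
    and mono: "\<And>C C'. C \<subseteq> C' \<Longrightarrow> h C \<subseteq> h C'"
  shows "ideal_chain A' B' n"
proof -
  obtain C where C: "\<forall>i\<le>n. ideal (C i) R \<and> A \<subseteq> C i \<and> C i \<subseteq> B" "\<forall>i<n. C i \<subset> C (Suc i)"
    using ch unfolding ideal_chain_def by blast
  have "h (C i) \<subset> h (C (Suc i))" if i: "i < n" for i
  proof -
    have "k (h (C i)) = C i" "k (h (C (Suc i))) = C (Suc i)" using h C(1) i by simp_all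
    then show ?thesis using mono C(2) i by (metis psubset_eq)
  qed
  moreover have "ideal (h (C i)) R \<and> A' \<subseteq> h (C i) \<and> h (C i) \<subseteq> B'" if "i \<le> n" for i
    using h[of "C i"] C(1) that by simp
  ultimately show ?thesis unfolding ideal_chain_def by (intro exI[of _ "\<lambda>i. h (C i)"]) simp
qed

text \<open>The diamond isomorphism, as the mutually inverse maps \<open>C \<mapsto> C \<inter> X\<close> and \<open>D \<mapsto> D + Y\<close>.\<close>

lemma interval_length_diamond:
  assumes X: "ideal X R" and Y: "ideal Y R"
  shows "interval_length Y (X <+> Y) = interval_length (X \<inter> Y) X"
proof -
  have up: "(C \<inter> X) <+> Y = C" if C: "ideal C R" "Y \<subseteq> C" "C \<subseteq> X <+> Y" for C
  proof
    show "(C \<inter> X) <+> Y \<subseteq> C" using C by (intro add_le) auto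
    show "C \<subseteq> (C \<inter> X) <+> Y"
    proof
      fix z assume z: "z \<in> C"
      then obtain x y where xy: "x \<in> X" "y \<in> Y" "z = x \<oplus> y" using C(3) unfolding mem_add_iff subset_iff by blast
      have cc: "x \<in> carrier R" "y \<in> carrier R" using ideal_memI(2)[OF X xy(1)] ideal_memI(2)[OF Y xy(2)] .
      have "x = z \<ominus> y" unfolding xy(3) using cc by algebra
      then have "x \<in> C" using ideal_memI(5)[OF C(1) z] xy(2) C(2) by blast
      then show "z \<in> (C \<inter> X) <+> Y" unfolding mem_add_iff using xy by blast
    qed
  qed
  have down: "(D <+> Y) \<inter> X = D" if D: "ideal D R" "X \<inter> Y \<subseteq> D" "D \<subseteq> X" for D
  proof
    show "D \<subseteq> (D <+> Y) \<inter> X" using le_addL[OF D(1) Y] D(3) by blast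
    show "(D <+> Y) \<inter> X \<subseteq> D"
    proof
      fix z assume "z \<in> (D <+> Y) \<inter> X"
      then obtain x y where xy: "x \<in> D" "y \<in> Y" "z = x \<oplus> y" "z \<in> X" by (auto simp: mem_add_iff)
      have cc: "x \<in> carrier R" "y \<in> carrier R" using ideal_memI(2)[OF D(1) xy(1)] ideal_memI(2)[OF Y xy(2)] .
      have "y = z \<ominus> x" unfolding xy(3) using cc by algebra
      then have "y \<in> D" using ideal_memI(5)[OF X xy(4)] xy(1,2) D(2,3) by blast
      then show "z \<in> D" unfolding xy(3) using ideal_memI(3)[OF D(1) xy(1)] by blast
    qed
  qed
  have "ideal_chain Y (X <+> Y) n \<longleftrightarrow> ideal_chain (X \<inter> Y) X n" for n
  proof
    assume "ideal_chain Y (X <+> Y) n"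
    then show "ideal_chain (X \<inter> Y) X n"
    proof (rule ideal_chain_image[where h = "\<lambda>C. C \<inter> X" and k = "\<lambda>D. D <+> Y"])
      show "ideal (C \<inter> X) R \<and> X \<inter> Y \<subseteq> C \<inter> X \<and> C \<inter> X \<subseteq> X \<and> (C \<inter> X) <+> Y = C"
        if "ideal C R" "Y \<subseteq> C" "C \<subseteq> X <+> Y" for C
        using i_intersect[OF that(1) X] that(2) up[OF that] by blast
    qed blast
  next
    assume "ideal_chain (X \<inter> Y) X n"
    then show "ideal_chain Y (X <+> Y) n"
    proof (rule ideal_chain_image[where h = "\<lambda>D. D <+> Y" and k = "\<lambda>C. C \<inter> X"])
      show "ideal (D <+> Y) R \<and> Y \<subseteq> D <+> Y \<and> D <+> Y \<subseteq> X <+> Y \<and> (D <+> Y) \<inter> X = D"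
        if "ideal D R" "X \<inter> Y \<subseteq> D" "D \<subseteq> X" for D
        using add_ideals[OF that(1) Y] le_addR[OF that(1) Y] set_add_mono[OF that(3) order_refl] down[OF that]
        by blast
    qed (intro set_add_mono order_refl)
  qed
  then show ?thesis unfolding interval_length_def by simp
qed

lemma submodule_quot_iff:
  assumes K: "ideal K R"
  shows "submodule C R (quot_module R K) \<longleftrightarrow> ideal C (R Quot K)"
proof -
  interpret A: cring "R Quot K" using K is_cring by (rule ideal.quotient_is_cring)
  have am: "subgroup C (add_monoid (quot_module R K)) \<longleftrightarrow> subgroup C (add_monoid (R Quot K))"
    by (simp add: subgroup_def m_inv_def quot_module_def ring.extend_def module.fields_def)
  have sm: "r \<odot>\<^bsub>quot_module R K\<^esub> x = (K +> r) \<otimes>\<^bsub>R Quot K\<^esub> x" for r x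
    by (simp add: quot_module_def ring.extend_def module.fields_def)
  show ?thesis
  proof
    assume C: "submodule C R (quot_module R K)"
    then have sg: "subgroup C (add_monoid (R Quot K))" using submodule.axioms(1)[OF C] am by simp
    have mult: "a \<otimes>\<^bsub>R Quot K\<^esub> x \<in> C" if "a \<in> carrier (R Quot K)" "x \<in> C" for a x
      using submodule.smult_closed[OF C _ that(2)] that(1) unfolding sm quot_carrier by blast
    have "x \<in> carrier (R Quot K)" if "x \<in> C" for x using subgroup.subset[OF sg] that by auto
    note Cc = this
    have "x \<otimes>\<^bsub>R Quot K\<^esub> a \<in> C" if "a \<in> carrier (R Quot K)" "x \<in> C" for a x
      using mult[OF that] A.m_comm[OF that(1) Cc[OF that(2)]] by simp
    then show "ideal C (R Quot K)" using sg mult by (intro idealI A.ring_axioms)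
  next
    assume C: "ideal C (R Quot K)"
    show "submodule C R (quot_module R K)"
    proof (intro submodule.intro submodule_axioms.intro)
      show "subgroup C (add_monoid (quot_module R K))"
        unfolding am using additive_subgroup.a_subgroup[OF ideal.axioms(1)[OF C]] .
      show "a \<odot>\<^bsub>quot_module R K\<^esub> x \<in> C" if "a \<in> carrier R" "x \<in> C" for a x
        unfolding sm using that ideal.I_l_closed[OF C] quot_carrier by blast
    qed
  qed
qed

lemma module_length_quot:
  assumes K: "ideal K R"
  shows "module_length R (quot_module R K) = interval_length K (carrier R)"
proof -
  have "(\<exists>C. (\<forall>i\<le>n. submodule (C i) R (quot_module R K)) \<and> (\<forall>i<n. C i \<subset> C (Suc i)))
      \<longleftrightarrow> ideal_chain K (carrier R) n" (is "?L \<longleftrightarrow> ?R") for n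
  proof
    assume ?L
    then obtain C where C: "\<And>i. i \<le> n \<Longrightarrow> ideal (C i) (R Quot K)" "\<And>i. i < n \<Longrightarrow> C i \<subset> C (Suc i)"
      unfolding submodule_quot_iff[OF K] by blast
    have "\<forall>i\<in>{..n}. \<exists>L. ideal L R \<and> K \<subseteq> L \<and> C i = (+>) K ` L"
      using quot_ideal_obtain[OF K C(1)] by (metis atMost_iff)
    then obtain D where D: "\<And>i. i \<le> n \<Longrightarrow> ideal (D i) R \<and> K \<subseteq> D i \<and> C i = (+>) K ` D i"
      by (metis atMost_iff)
    have "D i \<subset> D (Suc i)" if i: "i < n" for i
    proof -
      have d: "ideal (D i) R" "K \<subseteq> D i" "C i = (+>) K ` D i" using D[of i] i by auto
      have d': "ideal (D (Suc i)) R" "K \<subseteq> D (Suc i)" "C (Suc i) = (+>) K ` D (Suc i)" using D[of "Suc i"] i by auto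
      have "D i \<subseteq> D (Suc i)"
      proof
        fix x assume x: "x \<in> D i"
        then have "K +> x \<in> (+>) K ` D (Suc i)" using C(2)[OF i] unfolding d(3) d'(3) by blast
        then show "x \<in> D (Suc i)" using coset_mem_iff[OF K d'(1,2)] ideal_memI(2)[OF d(1) x] by simp
      qed
      moreover have "D i \<noteq> D (Suc i)" using C(2)[OF i] unfolding d(3) d'(3) by auto
      ultimately show ?thesis by blast
    qed
    moreover have "D i \<subseteq> carrier R" if "i \<le> n" for i using D[OF that] ideal_memI(2) by blast
    ultimately show ?R unfolding ideal_chain_def using D by (intro exI[of _ D]) blast
  next
    assume ?R
    then obtain D where D: "\<And>i. i \<le> n \<Longrightarrow> ideal (D i) R \<and> K \<subseteq> D i \<and> D i \<subseteq> carrier R" "\<And>i. i < n \<Longrightarrow> D i \<subset> D (Suc i)"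
      unfolding ideal_chain_def by blast
    have "(+>) K ` D i \<subset> (+>) K ` D (Suc i)" if i: "i < n" for i
    proof -
      have d: "ideal (D i) R" "K \<subseteq> D i" "D (Suc i) \<subseteq> carrier R" using D(1)[of i] D(1)[of "Suc i"] i by auto
      obtain x where x: "x \<in> D (Suc i)" "x \<notin> D i" using D(2)[OF i] by blast
      then have "K +> x \<notin> (+>) K ` D i" using coset_mem_iff[OF K d(1,2)] d(3) by blast
      then show ?thesis using D(2)[OF i] x(1) by blast
    qed
    moreover have "submodule ((+>) K ` D i) R (quot_module R K)" if "i \<le> n" for i
      unfolding submodule_quot_iff[OF K] using D(1)[OF that] ring_ideal_imp_quot_ideal[OF K] by blast
    ultimately show ?L by (intro exI[of _ "\<lambda>i. (+>) K ` D i"]) blast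
  qed
  then show ?thesis unfolding module_length_def interval_length_def by simp
qed

end

section \<open>Ideals with the same initial ideal\<close>

locale adic_ideal = cring R for R (structure) +
  fixes J I :: "'a set"
  assumes J: "ideal J R" and I: "ideal I R"
begin

abbreviation F :: "nat \<Rightarrow> 'a set" where "F \<equiv> adic_filt R J I"
abbreviation G :: "(nat \<Rightarrow> 'a set) ring" where "G \<equiv> assoc_gr R J I"

lemmas pow_J_ideal = pow_ideal[OF J]

lemma F_ideal: "ideal (F n) R" unfolding adic_filt_def using pow_J_ideal I by (rule add_ideals)

lemma F_carr: "x \<in> F n \<Longrightarrow> x \<in> carrier R" by (rule ideal_memI(2)[OF F_ideal])

lemma pow_le_F: "ideal_pow R J n \<subseteq> F n" unfolding adic_filt_def using pow_J_ideal I by (rule le_addL)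

lemma I_le_F: "I \<subseteq> F n" unfolding adic_filt_def using pow_J_ideal I by (rule le_addR)

lemma F_0: "F 0 = carrier R"
  using pow_le_F[of 0] F_carr by auto

lemma F_antimono: "m \<le> n \<Longrightarrow> F n \<subseteq> F m"
  unfolding adic_filt_def by (intro set_add_mono pow_antimono J) auto

lemma F_mult:
  assumes x: "x \<in> F m" and y: "y \<in> F n" and k: "k \<le> m + n"
  shows "x \<otimes> y \<in> F k"
proof -
  obtain a i b j where a: "a \<in> ideal_pow R J m" "i \<in> I" "x = a \<oplus> i" and b: "b \<in> ideal_pow R J n" "j \<in> I" "y = b \<oplus> j"
    using x y unfolding adic_filt_def mem_add_iff by blast
  note cs = ideal_memI(2)[OF pow_J_ideal a(1)] ideal_memI(2)[OF I a(2)] ideal_memI(2)[OF pow_J_ideal b(1)] ideal_memI(2)[OF I b(2)]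
  have "a \<otimes> b \<in> F (m + n)" using pow_mult_mem[OF J a(1) b(1)] pow_le_F by blast
  moreover have "i \<otimes> y \<oplus> a \<otimes> j \<in> F (m + n)"
    using a(2) b(2) cs F_carr[OF y] I_le_F ideal_memI(3,6,7)[OF I] by (meson subsetD)
  moreover have "x \<otimes> y = a \<otimes> b \<oplus> (i \<otimes> y \<oplus> a \<otimes> j)" unfolding a(3) b(3) using cs by algebra
  ultimately show ?thesis using ideal_memI(3)[OF F_ideal] F_antimono[OF k] by auto
qed

lemma F_Suc: "ideal_pow R J n <+> F (Suc n) = F n"
proof
  show "ideal_pow R J n <+> F (Suc n) \<subseteq> F n"
    using pow_le_F F_antimono[of n "Suc n"] by (intro add_le F_ideal) auto
  have "I \<subseteq> ideal_pow R J n <+> F (Suc n)"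
    using I_le_F[of "Suc n"] le_addR[OF pow_J_ideal F_ideal, of "Suc n" n] by blast
  moreover have "ideal_pow R J n \<subseteq> ideal_pow R J n <+> F (Suc n)"
    using le_addL[OF pow_J_ideal F_ideal] .
  ultimately show "F n \<subseteq> ideal_pow R J n <+> F (Suc n)"
    unfolding adic_filt_def[of _ _ _ n] using pow_J_ideal F_ideal by (intro add_le add_ideals)
qed

lemma coset_eq_iff: "\<lbrakk>x \<in> carrier R; y \<in> carrier R\<rbrakk> \<Longrightarrow> F n +> x = F n +> y \<longleftrightarrow> x \<ominus> y \<in> F n"
  by (rule quotient_eq_iff_same_a_r_cos[OF F_ideal, symmetric])

lemma coset_self: "x \<in> carrier R \<Longrightarrow> x \<in> F n +> x"
  using additive_subgroup.zero_closed[OF ideal.axioms(1)[OF F_ideal]] by (force simp: a_r_coset_def')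

lemma coset_zero: "F n +> \<zero> = F n"
  using F_carr by (intro a_coset_add_zero) auto

lemma coset_eq_F_iff: "x \<in> carrier R \<Longrightarrow> F n +> x = F n \<longleftrightarrow> x \<in> F n"
  using coset_eq_iff[of x \<zero> n] coset_zero[of n] by (simp add: minus_eq)

text \<open>Every class in \<open>F n / F (n + 1)\<close> has a representative in \<open>J\<^sup>n\<close>. Taking representatives there, and not
  just in \<open>F n\<close>, allows the same family \<open>x\<close> to represent elements for two different ideals \<open>I\<close>.\<close>

definition represents :: "(nat \<Rightarrow> 'a set) \<Rightarrow> (nat \<Rightarrow> 'a) \<Rightarrow> bool"
  where "represents u x \<longleftrightarrow> (\<forall>n. x n \<in> ideal_pow R J n \<and> u n = F (Suc n) +> x n)"

lemma representsD: "represents u x \<Longrightarrow> x n \<in> ideal_pow R J n" "represents u x \<Longrightarrow> x n \<in> carrier R"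
  "represents u x \<Longrightarrow> u n = F (Suc n) +> x n"
  using ideal_memI(2)[OF pow_J_ideal] unfolding represents_def by auto

lemma represents_unique: "represents u x \<Longrightarrow> represents v x \<Longrightarrow> u = v"
  unfolding represents_def by auto

lemma carrier_iff: "u \<in> carrier G \<longleftrightarrow> (\<exists>x. represents u x) \<and> finite {n. u n \<noteq> F (Suc n)}"
proof -
  have "(\<exists>x\<in>F n. u n = F (Suc n) +> x) \<longleftrightarrow> (\<exists>x\<in>ideal_pow R J n. u n = F (Suc n) +> x)" for n
  proof
    assume "\<exists>x\<in>F n. u n = F (Suc n) +> x"
    then obtain x where x: "x \<in> F n" "u n = F (Suc n) +> x" by blast
    then obtain j i where ji: "j \<in> ideal_pow R J n" "i \<in> I" "x = j \<oplus> i" unfolding adic_filt_def mem_add_iff by blast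
    note cs = ideal_memI(2)[OF pow_J_ideal ji(1)] ideal_memI(2)[OF I ji(2)]
    have "x \<ominus> j = i" unfolding ji(3) using cs by algebra
    then have "F (Suc n) +> x = F (Suc n) +> j" using coset_eq_iff F_carr[OF x(1)] cs ji(2) I_le_F by blast
    then show "\<exists>x\<in>ideal_pow R J n. u n = F (Suc n) +> x" using x(2) ji(1) by auto
  qed (use pow_le_F in blast)
  then have "(\<forall>n. \<exists>x\<in>F n. u n = F (Suc n) +> x) \<longleftrightarrow> (\<exists>x. represents u x)"
    unfolding represents_def Bex_def by (simp only:) (rule choice_iff)
  then show ?thesis unfolding assoc_gr_def by (simp add: Let_def)
qed

lemma zero_G: "\<zero>\<^bsub>G\<^esub> k = F (Suc k)" by (simp add: assoc_gr_def Let_def)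

lemma represents_one: "represents \<one>\<^bsub>G\<^esub> (\<lambda>n. if n = 0 then \<one> else \<zero>)"
  using ideal_memI(1)[OF pow_J_ideal] coset_zero by (auto simp: represents_def assoc_gr_def Let_def)

lemma represents_add:
  assumes "represents u x" "represents v y"
  shows "represents (u \<oplus>\<^bsub>G\<^esub> v) (\<lambda>n. x n \<oplus> y n)"
  unfolding represents_def
proof (intro allI conjI)
  fix n
  show "x n \<oplus> y n \<in> ideal_pow R J n" using representsD(1) assms by (intro ideal_memI(3)[OF pow_J_ideal])
  have "(u \<oplus>\<^bsub>G\<^esub> v) n = u n <+> v n" by (simp add: assoc_gr_def Let_def)
  also have "\<dots> = F (Suc n) +> (x n \<oplus> y n)"
    unfolding representsD(3)[OF assms(1)] representsD(3)[OF assms(2)]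
    using representsD(2) assms by (intro ideal.a_rcos_sum F_ideal)
  finally show "(u \<oplus>\<^bsub>G\<^esub> v) n = F (Suc n) +> (x n \<oplus> y n)" .
qed

lemma rcoset_mult_F:
  assumes x: "x \<in> ideal_pow R J p" and y: "y \<in> ideal_pow R J q"
  shows "rcoset_mult R (F (Suc (p + q))) (F (Suc p) +> x) (F (Suc q) +> y) = F (Suc (p + q)) +> (x \<otimes> y)"
proof -
  note cs = ideal_memI(2)[OF pow_J_ideal x] ideal_memI(2)[OF pow_J_ideal y]
  have xF: "x \<in> F p" "y \<in> F q" using x y pow_le_F by auto
  have "F (Suc (p + q)) +> (a \<otimes> b) = F (Suc (p + q)) +> (x \<otimes> y)"
    if a: "a \<in> F (Suc p) +> x" and b: "b \<in> F (Suc q) +> y" for a b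
  proof -
    obtain \<alpha> \<beta> where ab: "\<alpha> \<in> F (Suc p)" "a = \<alpha> \<oplus> x" "\<beta> \<in> F (Suc q)" "b = \<beta> \<oplus> y"
      using a b by (auto simp: a_r_coset_def')
    note cs' = F_carr[OF ab(1)] F_carr[OF ab(3)]
    have "\<alpha> \<otimes> \<beta> \<in> F (Suc (p + q))" "\<alpha> \<otimes> y \<in> F (Suc (p + q))" "x \<otimes> \<beta> \<in> F (Suc (p + q))"
      using F_mult[OF ab(1,3)] F_mult[OF ab(1) xF(2)] F_mult[OF xF(1) ab(3)] by auto
    then have "\<alpha> \<otimes> \<beta> \<oplus> (\<alpha> \<otimes> y \<oplus> x \<otimes> \<beta>) \<in> F (Suc (p + q))" using ideal_memI(3)[OF F_ideal] by blast
    moreover have "a \<otimes> b \<ominus> x \<otimes> y = \<alpha> \<otimes> \<beta> \<oplus> (\<alpha> \<otimes> y \<oplus> x \<otimes> \<beta>)" unfolding ab(2,4) using cs cs' by algebra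
    ultimately show ?thesis using coset_eq_iff cs cs' ab(2,4) by simp
  qed
  moreover have "x \<in> F (Suc p) +> x" "y \<in> F (Suc q) +> y" using coset_self cs by auto
  ultimately show ?thesis unfolding rcoset_mult_def by blast
qed

lemma finsum_mem: "\<lbrakk>finite S; ideal K R; \<And>i. i \<in> S \<Longrightarrow> g i \<in> K\<rbrakk> \<Longrightarrow> (\<Oplus>i\<in>S. g i) \<in> K"
proof (induct S rule: finite_induct)
  case empty
  then show ?case using ideal_memI(1) by simp
next
  case (insert a S)
  have "g \<in> S \<rightarrow> carrier R" "g a \<in> carrier R" using insert ideal_memI(2)[OF insert(4)] by auto
  then show ?case using insert ideal_memI(3)[OF insert(4)] by simp
qed

lemma represents_mult:
  assumes "represents u x" "represents v y"
  shows "represents (u \<otimes>\<^bsub>G\<^esub> v) (\<lambda>n. \<Oplus>p\<in>{..n}. x p \<otimes> y (n - p))"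
  unfolding represents_def
proof (intro allI conjI)
  fix n
  have xc: "x k \<in> carrier R" "y k \<in> carrier R" for k using representsD(2) assms by auto
  show "(\<Oplus>p\<in>{..n}. x p \<otimes> y (n - p)) \<in> ideal_pow R J n"
  proof (rule finsum_mem[OF _ pow_J_ideal])
    fix p assume "p \<in> {..n}"
    then show "x p \<otimes> y (n - p) \<in> ideal_pow R J n"
      using pow_mult_mem[OF J representsD(1)[OF assms(1)] representsD(1)[OF assms(2)], of p "n - p"] by simp
  qed simp
  interpret A: cring "R Quot F (Suc n)" using F_ideal is_cring by (rule ideal.quotient_is_cring)
  interpret h: ring_hom_cring R "R Quot F (Suc n)" "(+>) (F (Suc n))"
    using F_ideal is_cring by (rule ideal.rcos_ring_hom_cring)
  have "(u \<otimes>\<^bsub>G\<^esub> v) n = finsum (R Quot F (Suc n)) (\<lambda>p. rcoset_mult R (F (Suc n)) (u p) (v (n - p))) {..n}"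
    by (simp add: assoc_gr_def Let_def)
  also have "\<dots> = finsum (R Quot F (Suc n)) (\<lambda>p. F (Suc n) +> (x p \<otimes> y (n - p))) {..n}"
  proof (rule A.finsum_cong')
    fix p assume p: "p \<in> {..n}"
    then show "rcoset_mult R (F (Suc n)) (u p) (v (n - p)) = F (Suc n) +> (x p \<otimes> y (n - p))"
      using rcoset_mult_F[OF representsD(1)[OF assms(1), of p] representsD(1)[OF assms(2), of "n - p"]]
        representsD(3)[OF assms(1), of p] representsD(3)[OF assms(2), of "n - p"] by simp
  qed (use xc in \<open>auto intro!: h.hom_closed\<close>)
  also have "\<dots> = F (Suc n) +> (\<Oplus>p\<in>{..n}. x p \<otimes> y (n - p))"
    using xc by (subst h.hom_finsum) (auto simp: comp_def)
  finally show "(u \<otimes>\<^bsub>G\<^esub> v) n = F (Suc n) +> (\<Oplus>p\<in>{..n}. x p \<otimes> y (n - p))" .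
qed

end

locale same_initial_ideals = A: adic_ideal R J I + B: adic_ideal R J I' for R (structure) and J I I' +
  assumes same: "cring.same_initial R J I I'"
begin

lemma inter_eq: "ideal_pow R J n \<inter> A.F (Suc n) = ideal_pow R J n \<inter> B.F (Suc n)"
  using same unfolding A.same_initial_def adic_filt_def by blast

text \<open>The quotient \<open>F n / F (n + 1)\<close> is isomorphic to \<open>J\<^sup>n / (J\<^sup>n \<inter> F (n + 1))\<close>, which is the same for \<open>I\<close> and
  \<open>I'\<close>.\<close>

lemma length_eq: "A.interval_length (A.F n) (carrier R) = A.interval_length (B.F n) (carrier R)"
proof (induct n)
  case 0
  then show ?case by (simp only: A.F_0 B.F_0)
next
  case (Suc n)
  have "A.interval_length (A.F (Suc n)) (A.F n) = A.interval_length (B.F (Suc n)) (B.F n)"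
    using A.interval_length_diamond[OF A.pow_J_ideal[of n] A.F_ideal[of "Suc n"]]
      A.interval_length_diamond[OF A.pow_J_ideal[of n] B.F_ideal[of "Suc n"]]
    by (simp only: A.F_Suc B.F_Suc inter_eq)
  moreover have "A.interval_length (A.F (Suc n)) (carrier R) = A.interval_length (A.F (Suc n)) (A.F n) + A.interval_length (A.F n) (carrier R)"
    using A.F_antimono[of n "Suc n"] A.F_carr by (intro A.interval_length_add A.F_ideal A.oneideal) auto
  moreover have "A.interval_length (B.F (Suc n)) (carrier R) = A.interval_length (B.F (Suc n)) (B.F n) + A.interval_length (B.F n) (carrier R)"
    using B.F_antimono[of n "Suc n"] B.F_carr by (intro A.interval_length_add B.F_ideal A.oneideal) auto
  ultimately show ?case using Suc by simp
qed

text \<open>A coset \<open>F (n + 1) + x\<close> with \<open>x \<in> J\<^sup>n\<close> meets \<open>J\<^sup>n\<close> in a coset of \<open>J\<^sup>n \<inter> F (n + 1)\<close>, which is the same for \<open>I\<close>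
  and \<open>I'\<close>. So this sends the class of \<open>x\<close> to the class of \<open>x\<close>, without a choice of representatives.\<close>

definition transfer_gr :: "(nat \<Rightarrow> 'a set) \<Rightarrow> nat \<Rightarrow> 'a set"
  where "transfer_gr u n = B.F (Suc n) <+> (u n \<inter> ideal_pow R J n)"

lemma transfer_coset:
  assumes x: "x \<in> ideal_pow R J n"
  shows "B.F (Suc n) <+> ((A.F (Suc n) +> x) \<inter> ideal_pow R J n) = B.F (Suc n) +> x"
proof (rule equalityI; rule subsetI)
  note xc = A.ideal_memI(2)[OF A.pow_J_ideal x]
  fix z assume "z \<in> B.F (Suc n) <+> ((A.F (Suc n) +> x) \<inter> ideal_pow R J n)"
  then obtain a b where ab: "a \<in> B.F (Suc n)" "b \<in> A.F (Suc n)" "b \<oplus> x \<in> ideal_pow R J n" "z = a \<oplus> (b \<oplus> x)"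
    unfolding A.mem_add_iff by (auto simp: a_r_coset_def')
  have bc: "b \<in> carrier R" "a \<in> carrier R" using A.F_carr[OF ab(2)] B.F_carr[OF ab(1)] .
  have "b = (b \<oplus> x) \<ominus> x" using bc xc by algebra
  then have "b \<in> ideal_pow R J n" using A.ideal_memI(5)[OF A.pow_J_ideal ab(3) x] by simp
  then have "b \<in> B.F (Suc n)" using ab(2) inter_eq by blast
  then have "a \<oplus> b \<in> B.F (Suc n)" using ab(1) A.ideal_memI(3)[OF B.F_ideal] by blast
  moreover have "z = (a \<oplus> b) \<oplus> x" unfolding ab(4) using bc xc by algebra
  ultimately show "z \<in> B.F (Suc n) +> x" by (auto simp: a_r_coset_def')
next
  note xc = A.ideal_memI(2)[OF A.pow_J_ideal x]
  fix z assume "z \<in> B.F (Suc n) +> x"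
  then obtain a where "a \<in> B.F (Suc n)" "z = a \<oplus> x" by (auto simp: a_r_coset_def')
  then show "z \<in> B.F (Suc n) <+> ((A.F (Suc n) +> x) \<inter> ideal_pow R J n)"
    unfolding A.mem_add_iff using x A.coset_self[OF xc] by blast
qed

lemma transfer_represents: "A.represents u x \<Longrightarrow> B.represents (transfer_gr u) x"
  unfolding A.represents_def B.represents_def transfer_gr_def using transfer_coset by auto

lemma transfer_zero_iff:
  assumes "A.represents u x"
  shows "transfer_gr u n = B.F (Suc n) \<longleftrightarrow> u n = A.F (Suc n)"
proof -
  have x: "x n \<in> ideal_pow R J n" "x n \<in> carrier R" using A.representsD[OF assms] by auto
  have "transfer_gr u n = B.F (Suc n) \<longleftrightarrow> x n \<in> B.F (Suc n)"
    using B.representsD(3)[OF transfer_represents[OF assms]] B.coset_eq_F_iff[OF x(2)] by simp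
  moreover have "u n = A.F (Suc n) \<longleftrightarrow> x n \<in> A.F (Suc n)"
    using A.representsD(3)[OF assms] A.coset_eq_F_iff[OF x(2)] by simp
  ultimately show ?thesis using inter_eq[of n] x(1) by blast
qed

lemma transfer_carrier: "u \<in> carrier A.G \<Longrightarrow> transfer_gr u \<in> carrier B.G"
proof -
  assume "u \<in> carrier A.G"
  then obtain x where x: "A.represents u x" and fin: "finite {n. u n \<noteq> A.F (Suc n)}"
    unfolding A.carrier_iff by blast
  have "{n. transfer_gr u n \<noteq> B.F (Suc n)} = {n. u n \<noteq> A.F (Suc n)}"
    using transfer_zero_iff[OF x] by simp
  then show ?thesis unfolding B.carrier_iff using transfer_represents[OF x] fin by auto
qed

lemma transfer_homogeneous:
  assumes "u \<in> homogeneous A.G n"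
  shows "transfer_gr u \<in> homogeneous B.G n"
proof -
  have u: "u \<in> carrier A.G" "\<And>k. k \<noteq> n \<Longrightarrow> u k = A.F (Suc k)"
    using assms by (simp_all add: homogeneous_def A.zero_G)
  obtain x where x: "A.represents u x" using u(1) unfolding A.carrier_iff by blast
  show ?thesis
    unfolding homogeneous_def B.zero_G
    using transfer_carrier[OF u(1)] u(2) transfer_zero_iff[OF x] by blast
qed

lemma transfer_hom: "transfer_gr \<in> ring_hom A.G B.G"
proof (rule ring_hom_memI)
  fix u v assume u: "u \<in> carrier A.G" and v: "v \<in> carrier A.G"
  then obtain x y where x: "A.represents u x" and y: "A.represents v y" unfolding A.carrier_iff by blast
  show "transfer_gr (u \<otimes>\<^bsub>A.G\<^esub> v) = transfer_gr u \<otimes>\<^bsub>B.G\<^esub> transfer_gr v"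
    using transfer_represents[OF A.represents_mult[OF x y]]
      B.represents_mult[OF transfer_represents[OF x] transfer_represents[OF y]] by (rule B.represents_unique)
  show "transfer_gr (u \<oplus>\<^bsub>A.G\<^esub> v) = transfer_gr u \<oplus>\<^bsub>B.G\<^esub> transfer_gr v"
    using transfer_represents[OF A.represents_add[OF x y]]
      B.represents_add[OF transfer_represents[OF x] transfer_represents[OF y]] by (rule B.represents_unique)
next
  show "transfer_gr \<one>\<^bsub>A.G\<^esub> = \<one>\<^bsub>B.G\<^esub>"
    using transfer_represents[OF A.represents_one] B.represents_one by (rule B.represents_unique)
qed (rule transfer_carrier)

end

lemma (in same_initial_ideals) swap: "same_initial_ideals R J I' I"
  using same by unfold_locales (auto simp: A.same_initial_def)

context same_initial_ideals
begin

lemma transfer_inverse: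
  assumes "u \<in> carrier A.G"
  shows "same_initial_ideals.transfer_gr R J I (transfer_gr u) = u"
proof -
  interpret S: same_initial_ideals R J I' I by (rule swap)
  obtain x where x: "A.represents u x" using assms A.carrier_iff by blast
  show ?thesis using S.transfer_represents[OF transfer_represents[OF x]] x by (rule A.represents_unique)
qed

lemma transfer_graded_iso: "transfer_gr \<in> graded_ring_iso A.G B.G"
proof -
  interpret S: same_initial_ideals R J I' I by (rule swap)
  note inv = transfer_inverse and inv' = S.transfer_inverse
  have "bij_betw transfer_gr (carrier A.G) (carrier B.G)"
    by (rule bij_betw_byWitness[where f' = S.transfer_gr])
      (use inv inv' transfer_carrier S.transfer_carrier in auto)
  then have "transfer_gr \<in> ring_iso A.G B.G" unfolding ring_iso_def using transfer_hom by simp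
  moreover have "transfer_gr ` homogeneous A.G n = homogeneous B.G n" for n
  proof (rule equalityI; rule subsetI)
    fix v assume v: "v \<in> homogeneous B.G n"
    then have "transfer_gr (S.transfer_gr v) = v" using inv' by (simp add: homogeneous_def)
    then show "v \<in> transfer_gr ` homogeneous A.G n" using S.transfer_homogeneous[OF v] by (metis imageI)
  qed (use transfer_homogeneous in auto)
  ultimately show ?thesis unfolding graded_ring_iso_def by blast
qed

end

section \<open>Reduction to an \<open>\<mm>\<close>-primary ideal, and the theorem\<close>

lemma (in noetherian_cring) radical_pow_le:
  assumes Q: "ideal Q R" and A: "ideal A R" "A \<subseteq> radical R Q"
  shows "\<exists>n. ideal_pow R A n \<subseteq> Q"
proof -
  obtain x and d :: nat where x: "x \<in> {..<d} \<rightarrow> carrier R" and Ax: "A = Idl (x ` {..<d})"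
    using indexed_generators[OF A(1)] .
  have "x ` {..<d} \<subseteq> A" unfolding Ax using x by (intro genideal_self) auto
  then have "\<forall>i\<in>{..<d}. \<exists>m::nat. x i [^] m \<in> Q" using A(2) unfolding radical_def by blast
  then obtain a where a: "\<And>i. i < d \<Longrightarrow> x i [^] (a i :: nat) \<in> Q" by (metis lessThan_iff)
  define b where "b = (\<Sum>i<d. a i)"
  have "monom d x \<alpha> \<in> Q" if \<alpha>: "\<alpha> \<in> expo d (Suc (d * b))" for \<alpha>
  proof -
    have "\<exists>i<d. b < \<alpha> i"
    proof (rule ccontr)
      assume "\<not> ?thesis"
      then have "(\<Sum>i<d. \<alpha> i) \<le> (\<Sum>i<d. b)" by (intro sum_mono) auto
      then show False using \<alpha> by (simp add: expo_def)
    qed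
    then obtain i where i: "i < d" "b < \<alpha> i" by blast
    have xi: "x i \<in> carrier R" using x i by auto
    have "a i \<le> b" unfolding b_def using i by (intro member_le_sum) auto
    then have "x i [^] \<alpha> i = x i [^] a i \<otimes> x i [^] (\<alpha> i - a i)" using i xi by (simp add: nat_pow_mult)
    then have xQ: "x i [^] \<alpha> i \<in> Q" using ideal_memI(7)[OF Q a[OF i(1)]] xi by simp
    have "{..<d} = insert i ({..<d} - {i})" using i by auto
    then have "monom d x \<alpha> = (\<Otimes>j\<in>insert i ({..<d} - {i}). x j [^] \<alpha> j)" by (simp add: monom_def)
    also have "\<dots> = x i [^] \<alpha> i \<otimes> (\<Otimes>j\<in>{..<d} - {i}. x j [^] \<alpha> j)"
      using x xi by (intro finprod_insert) auto
    also have "\<dots> \<in> Q" using x by (intro ideal_memI(7)[OF Q xQ] finprod_closed) auto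
    finally show ?thesis .
  qed
  then have "ideal_pow R A (Suc (d * b)) \<subseteq> Q"
    unfolding pow_eq_monoms[OF x Ax] using Q by (intro genideal_minimal) auto
  then show ?thesis by blast
qed

lemma (in adic_ideal) adic_filt_enlarge:
  assumes J': "ideal J' R" "J \<subseteq> J'" "J' \<subseteq> J <+> I"
  shows "adic_filt R J' I = F"
proof
  fix n
  have F1: "J' \<subseteq> F 1" using J'(3) pow_1[OF J] by (simp add: adic_filt_def)
  have "ideal_pow R J' n \<subseteq> F n" for n
  proof (induct n)
    case 0
    then show ?case by (simp add: F_0)
  next
    case (Suc n)
    have "ideal_pow R J' n \<cdot> J' \<subseteq> F (Suc n)"
      using Suc F1 by (intro prod_le F_ideal F_mult[of _ n _ 1]) auto
    then show ?case by (simp only: pow_Suc)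
  qed
  then have "adic_filt R J' I n \<subseteq> F n"
    unfolding adic_filt_def[of R J'] using I_le_F by (intro add_le F_ideal)
  moreover have "F n \<subseteq> adic_filt R J' I n"
    unfolding adic_filt_def using J'(2) by (intro set_add_mono pow_mono) auto
  ultimately show "adic_filt R J' I n = F n" by blast
qed

text \<open>Feeding the inclusion into itself gives \<open>J \<subseteq> B + J\<^sup>n\<close> for all \<open>n\<close>; Krull's theorem finishes.\<close>

lemma (in local_ring_with_ideal) le_if_le_mod_square:
  assumes B: "ideal B R" and le: "J \<subseteq> B <+> P 2"
  shows "J \<subseteq> B"
proof
  have BP: "ideal (B <+> P n) R" for n using B P_ideal by (rule add_ideals)
  have "J \<subseteq> B <+> P (Suc n)" for n
  proof (induct n)
    case 0
    then show ?case using le_addR[OF B P_ideal[of "Suc 0"]] pow_1[OF J_ideal] by simp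
  next
    case (Suc n)
    have "P n \<cdot> J \<subseteq> B <+> P (Suc (Suc n))"
    proof (rule prod_le[OF BP])
      fix x y assume x: "x \<in> P n" and "y \<in> J"
      then obtain a b where ab: "a \<in> B" "b \<in> P 2" "y = a \<oplus> b" using le unfolding mem_add_iff subset_iff by blast
      note cs = P_carr[OF x] ideal_memI(2)[OF B ab(1)] P_carr[OF ab(2)]
      have "x \<otimes> y = x \<otimes> a \<oplus> x \<otimes> b" unfolding ab(3) using cs by algebra
      moreover have "x \<otimes> a \<in> B" using ideal_memI(6)[OF B ab(1)] cs by simp
      moreover have "x \<otimes> b \<in> P (Suc (Suc n))" by (rule P_mult[OF x ab(2)]) simp
      ultimately show "x \<otimes> y \<in> B <+> P (Suc (Suc n))" unfolding mem_add_iff by blast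
    qed
    then have "P (Suc n) \<subseteq> B <+> P (Suc (Suc n))" by (simp only: pow_Suc)
    then have "B <+> P (Suc n) \<subseteq> B <+> P (Suc (Suc n))"
      using le_addL[OF B P_ideal] by (intro add_le BP)
    then show ?case using Suc by blast
  qed
  then have all: "J \<subseteq> B <+> P n" for n
    using set_add_mono[OF order_refl pow_antimono[OF J_ideal, of n "Suc n"], of B] by fastforce
  fix x assume x: "x \<in> J"
  show "x \<in> B"
    by (rule krull_intersection[OF J_ideal J_le_max B ideal_memI(2)[OF J_ideal x]]) (use all x in blast)
qed

theorem mainTheorem1:
  fixes R :: "('a, 'm) ring_scheme" (structure)
    and fs :: "'a list" and J :: "'a set"
  assumes "noetherian_ring R" and "local_ring R"
    and "filter_regular_seq R fs"
    and "ideal J R"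
    and "is_primary_to R (max_ideal R) (Idl (set fs) <+> J)"
  shows "\<exists>N::nat. N > 0 \<and>
    (\<forall>es. length es = length fs \<and> set es \<subseteq> ideal_pow R (max_ideal R) N \<longrightarrow>
      (let I = Idl (set fs);
           I' = Idl (set (map2 (\<oplus>) fs es))
       in (\<forall>n. module_length R (quot_module R (I <+> ideal_pow R J n))
                 = module_length R (quot_module R (I' <+> ideal_pow R J n)))
          \<and> graded_ring_iso (assoc_gr R J I) (assoc_gr R J I') \<noteq> {}))"
proof -
  interpret noetherian_local_ring R
    using assms(1,2) by (simp add: noetherian_local_ring_def noetherian_cring_def local_ring_def)
  have fsc: "set fs \<subseteq> carrier R" using assms(3) by (simp add: filter_regular_seq_def)
  define I where "I = Idl (set fs)"
  define Jt where "Jt = I <+> J"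
  have I: "ideal I R" unfolding I_def using fsc by (rule genideal_ideal)
  have Jt: "ideal Jt R" unfolding Jt_def using I assms(4) by (rule add_ideals)
  have prim: "primaryideal Jt R" and rad: "radical R Jt = \<mm>"
    using assms(5) unfolding Jt_def I_def is_primary_to_def by (rule conjunct1, rule conjunct2)
  have proper: "carrier R \<noteq> Jt" using prim by (rule primaryideal.Q_notcarr)
  have Jtm: "Jt \<subseteq> \<mm>"
    using proper proper_le_max_ideal[OF Jt] ideal.one_imp_carrier[OF Jt] by blast
  interpret L: local_ring_with_ideal R Jt
    using Jt Jtm by (rule local_ring_with_ideal.intro[OF noetherian_local_ring_axioms local_ring_with_ideal_axioms.intro])
  have fsI: "set fs \<subseteq> I" unfolding I_def using fsc by (rule genideal_self)
  have IJt: "I \<subseteq> Jt" "J \<subseteq> Jt"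
    unfolding Jt_def using le_addL[OF I assms(4)] le_addR[OF I assms(4)] by auto
  define r where "r = length fs"
  define f where "f i = fs ! i" for i
  have f: "f \<in> {..<r} \<rightarrow> carrier R" using fsc by (auto simp: f_def r_def)
  have fim: "f ` {..<r} = set fs" by (auto simp: f_def r_def set_conv_nth)
  have span: "lspan {..<r} f = I" unfolding I_def using lspan_eq_Idl[OF _ f] fim by simp
  obtain c where c: "artin_rees Jt I c" using artin_rees_exists[OF Jt I] by blast
  obtain t where t: "koszul_torsion Jt t {..<r} f"
    using L.filter_regular_koszul_torsion[OF assms(3), of r] fsI IJt Jtm unfolding r_def f_def by blast
  \<comment> \<open>One more than \<open>perturb_all\<close> asks for, so that \<open>k \<ge> 2\<close> and the perturbation lies in \<open>Jt\<^sup>2\<close>.\<close>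
  define k where "k = Suc (Suc (c + 2 ^ r * t))"
  obtain N0 where N0: "ideal_pow R \<mm> N0 \<subseteq> Jt"
    using radical_pow_le[OF Jt max_ideal_ideal] rad by blast
  define N where "N = Suc (N0 * k)"
  have "ideal_pow R \<mm> N \<subseteq> ideal_pow R \<mm> (N0 * k)"
    unfolding N_def by (intro pow_antimono max_ideal_ideal) simp
  also have "\<dots> \<subseteq> ideal_pow R Jt k"
    unfolding pow_pow[OF max_ideal_ideal, symmetric] using N0 by (rule pow_mono)
  finally have mN: "ideal_pow R \<mm> N \<subseteq> ideal_pow R Jt k" .
  have "(\<forall>n. module_length R (quot_module R (I <+> ideal_pow R J n))
            = module_length R (quot_module R (I' <+> ideal_pow R J n)))
      \<and> graded_ring_iso (assoc_gr R J I) (assoc_gr R J I') \<noteq> {}"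
    if es: "length es = length fs" "set es \<subseteq> ideal_pow R \<mm> N" and I'_def: "I' = Idl (set (map2 (\<oplus>) fs es))"
    for es I'
  proof -
    define e where "e i = es ! i" for i
    have ek: "e i \<in> L.P k" if "i < r" for i
      using that es mN unfolding e_def r_def by (metis nth_mem subsetD)
    have e: "e \<in> {..<r} \<rightarrow> L.P (Suc (c + 2 ^ r * t))"
    proof
      fix i assume "i \<in> {..<r}"
      then show "e i \<in> L.P (Suc (c + 2 ^ r * t))" by (intro L.P_mono[OF _ ek]) (simp_all add: k_def)
    qed
    have ec: "e i \<in> carrier R" if "i < r" for i using L.P_carr[OF ek[OF that]] .
    let ?f' = "\<lambda>i. f i \<oplus> e i"
    have f': "?f' \<in> {..<r} \<rightarrow> carrier R" using f ec by auto
    have "map2 (\<oplus>) fs es = map ?f' [0..<r]"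
      using es(1) by (intro nth_equalityI) (auto simp: f_def e_def r_def)
    then have "set (map2 (\<oplus>) fs es) = ?f' ` {..<r}" by (simp add: atLeast0LessThan)
    then have span': "lspan {..<r} ?f' = I'" unfolding I'_def using lspan_eq_Idl[OF _ f'] by simp
    have I': "ideal I' R" unfolding span'[symmetric] using f' by (intro lspan_ideal) simp
    have same: "same_initial Jt I I'"
      using L.perturb_all[OF f _ t e] c unfolding span span' by blast
    have "I \<subseteq> (J <+> I') <+> L.P 2"
    proof -
      have JI': "ideal (J <+> I') R" using assms(4) I' by (rule add_ideals)
      have "f i \<in> (J <+> I') <+> L.P 2" if i: "i < r" for i
      proof -
        have fi: "f i \<in> carrier R" using f i by auto
        have "?f' i \<in> I'" using lspan_base[OF _ f', of i] i span' by simp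
        then have fJ: "?f' i \<in> J <+> I'" using le_addR[OF assms(4) I'] by blast
        have "e i \<in> L.P 2" using L.P_mono[of 2 k, OF _ ek[OF i]] by (simp add: k_def)
        then have "\<ominus> e i \<in> L.P 2" by (rule ideal_memI(4)[OF L.P_ideal])
        moreover have "f i = ?f' i \<oplus> \<ominus> e i" using fi ec[OF i] by algebra
        ultimately show ?thesis
          unfolding mem_add_iff[of _ "J <+> I'"] using fJ by (intro bexI[of _ "?f' i"] bexI[of _ "\<ominus> e i"])
      qed
      then show ?thesis
        unfolding I_def fim[symmetric] using add_ideals[OF JI' L.P_ideal] by (intro genideal_minimal) auto
    qed
    moreover have "J \<subseteq> (J <+> I') <+> L.P 2"
      using le_addL[OF assms(4) I'] le_addL[OF add_ideals[OF assms(4) I'] L.P_ideal] by blast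
    ultimately have "Jt \<subseteq> (J <+> I') <+> L.P 2"
      using add_le[OF add_ideals[OF add_ideals[OF assms(4) I'] L.P_ideal]] unfolding Jt_def by blast
    then have JtI': "Jt \<subseteq> J <+> I'"
      using L.le_if_le_mod_square add_ideals[OF assms(4) I'] by blast
    interpret A: adic_ideal R J I by (rule adic_ideal.intro[OF is_cring adic_ideal_axioms.intro[OF assms(4) I]])
    interpret B: adic_ideal R J I' by (rule adic_ideal.intro[OF is_cring adic_ideal_axioms.intro[OF assms(4) I']])
    interpret S: same_initial_ideals R Jt I I'
      by (intro same_initial_ideals.intro same_initial_ideals_axioms.intro adic_ideal.intro
          adic_ideal_axioms.intro is_cring Jt I I' same)
    have "Jt \<subseteq> J <+> I"
      using add_le[OF add_ideals[OF assms(4) I] le_addR[OF assms(4) I] le_addL[OF assms(4) I]]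
      unfolding Jt_def .
    then have FA: "adic_filt R Jt I = adic_filt R J I"
      using A.adic_filt_enlarge[OF Jt IJt(2)] by blast
    have FB: "adic_filt R Jt I' = adic_filt R J I'"
      using B.adic_filt_enlarge[OF Jt IJt(2) JtI'] .
    have len: "module_length R (quot_module R (K <+> ideal_pow R J n)) = interval_length (adic_filt R J K n) (carrier R)"
      if "ideal K R" for K n
    proof -
      have "K \<subseteq> carrier R" "ideal_pow R J n \<subseteq> carrier R"
        using ideal_memI(2)[OF that] ideal_memI(2)[OF pow_ideal[OF assms(4)]] by auto
      then have "K <+> ideal_pow R J n = adic_filt R J K n" unfolding adic_filt_def by (rule set_add_comm)
      moreover have "ideal (K <+> ideal_pow R J n) R" using that pow_ideal[OF assms(4)] by (rule add_ideals)
      ultimately show ?thesis using module_length_quot by simp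
    qed
    have "assoc_gr R Jt I = assoc_gr R J I" "assoc_gr R Jt I' = assoc_gr R J I'"
      unfolding assoc_gr_def FA FB by simp_all
    then have "graded_ring_iso (assoc_gr R J I) (assoc_gr R J I') \<noteq> {}"
      using S.transfer_graded_iso by auto
    then show ?thesis
      using len[OF I] len[OF I'] S.length_eq unfolding FA FB by simp
  qed
  then show ?thesis
    by (intro exI[of _ N]) (simp add: N_def I_def Let_def)
qed

end
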